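(* Let $X$ be a complex Banach space and let $A:D(A)\to X$ be the generator of a $C_0$-semigroup $T=(T(t))_{t\ge0}$ on $X$ with $\sup_{0<t<\infty}\|T(t)\|<\infty$. Put $K:=\{t\in\mathbb{R}: it\in\sigma(A)\}$. Assume that there is $a\in(0,\infty)$ with $K\subset(-a,a)$, and that there is $\theta\in(\tfrac12,\infty)$ with $\sup\{|t|^{\theta}\,\|R(it,A)\| : t\in\mathbb{R}\setminus(-a,a)\}<\infty$. Let $\phi\in L^\infty(\mathbb{R},X)$ with $(i\,sp(\phi))\cap\sigma(A)=\emptyset$. Then for each $x\in X$ the Cauchy problem $u'=Au+\phi$ on $\mathbb{R}_+$, $u(0)=x$, has a unique mild solution, and all these solutions are in $BUC(\mathbb{R}_+,X)$.
   Context: $\mathbb{R}_+=[0,\infty)$; $BUC(\mathbb{R}_+,X)$ is the space of bounded uniformly continuous functions $\mathbb{R}_+\to X$; $\sigma(A)$ is the spectrum of $A$ and $R(\lambda,A)=(\lambda-A)^{-1}$ for $\lambda\in\mathbb{C}\setminus\sigma(A)$. For $f\in L^1(\mathbb{R},\mathbb{C})$, $\widehat f(\lambda)=\int_{\mathbb{R}}f(t)e^{-i\lambda t}\,dt$. The Beurling spectrum of $\phi\in L^\infty(\mathbb{R},X)$ is $sp(\phi)=\{\omega\in\mathbb{R}: \text{for every } f\in L^1(\mathbb{R},\mathbb{C}),\ \phi*f=0 \text{ implies } \widehat f(\omega)=0\}$. A mild solution of $u'=Au+\phi$ on $\mathbb{R}_+$ is a function $u\in C(\mathbb{R}_+,X)$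 such that, for all $t\ge0$, $\int_0^t u(s)\,ds\in D(A)$ and $u(t)=u(0)+A\int_0^t u(s)\,ds+\int_0^t\phi(s)\,ds$. *)

theory Defs
  imports "HOL-Analysis.Analysis"
begin

text \<open>
  The distribution has real Banach spaces only; a complex Banach space is a real one
  with a compatible complex scalar multiplication and a complex-homogeneous norm.
\<close>

class complex_banach = banach +
  fixes scaleC :: "complex \<Rightarrow> 'a \<Rightarrow> 'a"  (infixr \<open>*\<^sub>C\<close> 75)
  assumes scaleC_add_right: "c *\<^sub>C (x + y) = c *\<^sub>C x + c *\<^sub>C y"
    and scaleC_add_left: "(c + d) *\<^sub>C x = c *\<^sub>C x + d *\<^sub>C x"
    and scaleC_scaleC: "c *\<^sub>C (d *\<^sub>C x) = (c * d) *\<^sub>C x"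
    and scaleR_scaleC: "r *\<^sub>R x = complex_of_real r *\<^sub>C x"
    and norm_scaleC: "norm (c *\<^sub>C x) = norm c * norm x"

instantiation complex :: complex_banach
begin

definition scaleC_complex :: "complex \<Rightarrow> complex \<Rightarrow> complex"
  where "scaleC_complex c x = c * x"

instance
  by standard (simp_all add: scaleC_complex_def algebra_simps norm_mult scaleR_conv_of_real)

end

definition bounded_clinear :: "('a::complex_banach \<Rightarrow> 'b::complex_banach) \<Rightarrow> bool" where
  "bounded_clinear f \<longleftrightarrow> bounded_linear f \<and> (\<forall>c x. f (c *\<^sub>C x) = c *\<^sub>C f x)"


subsection \<open>Bochner integral in arbitrary normed spaces\<close>

text \<open>
  The library's Bochner integral is restricted to second-countable (separable) value types.
  The following is its definition without that restriction. On a non-separable space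
  the existence of the approximating simple functions forces the integrand to be almost
  everywhere separably valued, hence strongly measurable.
\<close>

definition has_bochner :: "'a measure \<Rightarrow> ('a \<Rightarrow> 'b::real_normed_vector) \<Rightarrow> 'b \<Rightarrow> bool" where
  "has_bochner M f x \<longleftrightarrow> f \<in> borel_measurable M \<and>
     (\<exists>s. (\<forall>i. Bochner_Integration.simple_bochner_integrable M (s i)) \<and>
          (\<lambda>i. \<integral>\<^sup>+y. norm (f y - s i y) \<partial>M) \<longlonglongrightarrow> 0 \<and>
          (\<lambda>i. Bochner_Integration.simple_bochner_integral M (s i)) \<longlonglongrightarrow> x)"

definition bochner_integral :: "'a measure \<Rightarrow> ('a \<Rightarrow> 'b::real_normed_vector) \<Rightarrow> 'b" where
  "bochner_integral M f = (if \<exists>x. has_bochner M f x then THE x. has_bochner M f x else 0)"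

lemma has_bochner_eq_has_bochner_integral:
  fixes f :: "'a \<Rightarrow> 'b::{real_normed_vector, second_countable_topology}"
  shows "has_bochner M f x \<longleftrightarrow> has_bochner_integral M f x"
  unfolding has_bochner_def has_bochner_integral.simps by blast

lemma bochner_integral_eq_lebesgue_integral:
  fixes f :: "'a \<Rightarrow> 'b::{real_normed_vector, second_countable_topology}"
  shows "bochner_integral M f = integral\<^sup>L M f"
  unfolding bochner_integral_def lebesgue_integral_def has_bochner_eq_has_bochner_integral ..


subsection \<open>Essentially bounded functions and the Beurling spectrum\<close>

definition strongly_measurable :: "(real \<Rightarrow> 'a::real_normed_vector) \<Rightarrow> bool" where
  "strongly_measurable f \<longleftrightarrow>
     (\<exists>s. (\<forall>i::nat. simple_function lebesgue (s i)) \<and>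
          (AE t in lebesgue. (\<lambda>i. s i t) \<longlonglongrightarrow> f t))"

text \<open>Elements of \<open>L\<^sup>\<infinity>(\<real>, X)\<close> and \<open>L\<^sup>1(\<real>, \<complex>)\<close> are given by representatives.\<close>

definition L_infinity :: "(real \<Rightarrow> 'a::real_normed_vector) set" where
  "L_infinity = {\<phi>. strongly_measurable \<phi> \<and> (\<exists>C. AE t in lebesgue. norm (\<phi> t) \<le> C)}"

definition convolution :: "(real \<Rightarrow> 'a::complex_banach) \<Rightarrow> (real \<Rightarrow> complex) \<Rightarrow> real \<Rightarrow> 'a" where
  "convolution \<phi> f t = bochner_integral lebesgue (\<lambda>s. f s *\<^sub>C \<phi> (t - s))"

definition fourier :: "(real \<Rightarrow> complex) \<Rightarrow> real \<Rightarrow> complex" where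
  "fourier f w = (LINT t|lebesgue. f t * exp (- \<i> * complex_of_real w * complex_of_real t))"

text \<open>
  For \<open>\<phi>\<close> in \<open>L\<^sup>\<infinity>\<close> and \<open>f\<close> in \<open>L\<^sup>1\<close> the convolution exists
  at every point and is continuous, so vanishing almost everywhere and everywhere agree.
\<close>

definition beurling_spectrum :: "(real \<Rightarrow> 'a::complex_banach) \<Rightarrow> real set" where
  "beurling_spectrum \<phi> =
     {w. \<forall>f :: real \<Rightarrow> complex. integrable lebesgue f \<longrightarrow>
           (\<forall>t. convolution \<phi> f t = 0) \<longrightarrow> fourier f w = 0}"


subsection \<open>Unbounded operators and semigroups\<close>

text \<open>
  An operator \<open>A : D(A) \<rightarrow> X\<close> is given by its domain \<open>D\<close> and a function \<open>A\<close>, of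
  which only the values on \<open>D\<close> matter.
\<close>

definition resolvent :: "'a::complex_banach set \<Rightarrow> ('a \<Rightarrow> 'a) \<Rightarrow> complex \<Rightarrow> 'a \<Rightarrow> 'a" where
  "resolvent D A z = inv_into D (\<lambda>x. z *\<^sub>C x - A x)"

definition spectrum :: "'a::complex_banach set \<Rightarrow> ('a \<Rightarrow> 'a) \<Rightarrow> complex set" where
  "spectrum D A =
     {z. \<not> (bij_betw (\<lambda>x. z *\<^sub>C x - A x) D UNIV \<and> bounded_clinear (resolvent D A z))}"

definition C0_semigroup :: "(real \<Rightarrow> 'a::complex_banach \<Rightarrow> 'a) \<Rightarrow> bool" where
  "C0_semigroup T \<longleftrightarrow>
     (\<forall>t\<ge>0. bounded_clinear (T t)) \<and>
     T 0 = id \<and>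
     (\<forall>s\<ge>0. \<forall>t\<ge>0. T (s + t) = T s \<circ> T t) \<and>
     (\<forall>x. continuous_on {0..} (\<lambda>t. T t x))"

definition is_generator ::
    "'a::complex_banach set \<Rightarrow> ('a \<Rightarrow> 'a) \<Rightarrow> (real \<Rightarrow> 'a \<Rightarrow> 'a) \<Rightarrow> bool" where
  "is_generator D A T \<longleftrightarrow>
     D = {x. \<exists>y. ((\<lambda>t. (1 / t) *\<^sub>R (T t x - x)) \<longlongrightarrow> y) (at_right 0)} \<and>
     (\<forall>x\<in>D. ((\<lambda>t. (1 / t) *\<^sub>R (T t x - x)) \<longlongrightarrow> A x) (at_right 0))"

text \<open>Functions on \<open>[0, \<infinity>)\<close> are total functions whose values at negative arguments are ignored.\<close>

definition mild_solution ::
    "'a::complex_banach set \<Rightarrow> ('a \<Rightarrow> 'a) \<Rightarrow> (real \<Rightarrow> 'a) \<Rightarrow> (real \<Rightarrow> 'a) \<Rightarrow> bool" where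
  "mild_solution D A \<phi> u \<longleftrightarrow>
     continuous_on {0..} u \<and>
     (\<forall>t\<ge>0. bochner_integral (lebesgue_on {0..t}) u \<in> D \<and>
        u t = u 0 + A (bochner_integral (lebesgue_on {0..t}) u)
                  + bochner_integral (lebesgue_on {0..t}) \<phi>)"

definition BUC :: "(real \<Rightarrow> 'a::real_normed_vector) set" where
  "BUC = {u. bounded (u ` {0..}) \<and> uniformly_continuous_on {0..} u}"

end

theory Submission
  imports Defs "HOL-Probability.Characteristic_Functions" "HOL-Probability.Sinc_Integral"
begin

text \<open>
  Every solution is \<open>T(t) x + v(t)\<close> with \<open>v(t) = \<integral>\<^sub>0\<^sup>t T(t - s) \<phi>(s) ds\<close>, so the point is that \<open>v\<close>
  is bounded and uniformly continuous.

  Since \<open>K\<close> is compact and disjoint from the Beurling spectrum, there is an integrable \<open>\<psi>\<close> with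
  \<open>\<phi> * \<psi> = 0\<close> whose Fourier transform \<open>B\<close> is a spline of compact support equal to 1 near \<open>K\<close>.
  With \<open>E(t) = exp(- \<epsilon> t) T(t)\<close> for \<open>t \<ge> 0\<close>, extended by 0, this gives \<open>E * \<phi> = (E - E * \<psi>) * \<phi>\<close>.
  The kernel \<open>H = E - E * \<psi>\<close> has Fourier transform \<open>(1 - B(s)) R(\<epsilon> + is, A)\<close>, which avoids the
  spectrum, and \<open>t\<^sup>2 H(t)\<close> is the inverse transform of minus its second derivative, of order
  \<open>|s|\<close> to the power \<open>- 3 \<theta>\<close> and thus integrable. Hence \<open>H\<close> is bounded by a multiple of
  \<open>1 / (1 + t\<^sup>2)\<close> and has an \<open>L\<^sup>1\<close> modulus of continuity, both uniformly in \<open>\<epsilon>\<close>. The same bounds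
  hold for \<open>E * \<phi>\<close>, which differs from the regularised \<open>v\<close> by an orbit of the semigroup; now let
  \<open>\<epsilon>\<close> tend to 0.

  All identities in \<open>X\<close> are tested against functionals, which reduces them to scalar Lebesgue integrals.
\<close>

subsection \<open>Norming functionals\<close>

text \<open>\<open>H\<close> is not itself inverted: \<open>E\<close> jumps at 0, and a bound of
  order |s| to the power -\<theta> on its transform need not be integrable. The factor
  \<open>t\<^sup>2\<close> removes the jump and triples the decay exponent; one derivative alone
  would leave a tail 1/|t|, which is not integrable. Near t = 0 the bound on the semigroup takes
  over. Uniformity in \<epsilon> comes from a perturbation argument that carries the resolvent bound
  from the imaginary axis into a thin strip to its right.

  \<open>H\<close> is operator-valued and only strongly measurable in effect, so it is handled
  through the scalars \<open>l (H(q) y)\<close>, with estimates proportional to the bound of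
  \<open>l\<close> and the norm of \<open>y\<close>; only afterwards is
  \<open>y = \<phi>(t - q)\<close> inserted. Time shifts are moved from \<phi>, which may be
  discontinuous, to \<open>H\<close>.

  The function \<psi> is built locally. For each point of \<open>K\<close> a contraction estimate,
  in place of Wiener's division, shows that \<phi> is annihilated by every band-limited kernel
  supported in frequency near that point; compactness and a partition of unity by splines then
  assemble \<psi>.\<close>

lemma hahn_banach_real:
  fixes x :: "'a::real_normed_vector"
  obtains f :: "'a \<Rightarrow> real" where "linear f" "\<And>y. f y \<le> norm y" "f x = norm x"
proof -
  \<comment> \<open>Zorn's lemma is applied to graphs in \<open>'a \<times> real\<close>: subspaces
    lying below the norm and containing \<open>(x, norm x)\<close>. Single-valuedness is automatic:
    a pair \<open>(0, c)\<close> in such a subspace has c \<le> 0 and -c \<le> 0. This is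
    \<open>uniq\<close> below.\<close>
  define \<G> where "\<G> = {G :: ('a \<times> real) set. subspace G \<and> (\<forall>y c. (y, c) \<in> G \<longrightarrow> c \<le> norm y) \<and> (x, norm x) \<in> G}"
  have "\<exists>G\<in>\<G>. \<forall>X\<in>\<G>. G \<subseteq> X \<longrightarrow> X = G"
  proof (rule subset_Zorn_nonempty)
    have "(range (\<lambda>k. k *\<^sub>R (x, norm x))) \<in> \<G>"
      unfolding \<G>_def
    proof (intro CollectI conjI allI impI)
      show "subspace (range (\<lambda>k. k *\<^sub>R (x, norm x)))"
        using subspace_span[of "{(x, norm x)}"] by (simp add: span_singleton)
      show "(x, norm x) \<in> range (\<lambda>k. k *\<^sub>R (x, norm x))"
        by (metis rangeI scaleR_one)
    next
      fix y c assume "(y, c) \<in> range (\<lambda>k. k *\<^sub>R (x, norm x))"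
      then obtain k where k: "y = k *\<^sub>R x" "c = k * norm x" by auto
      show "c \<le> norm y" unfolding k by (simp add: mult_right_mono)
    qed
    then show "\<G> \<noteq> {}" by blast
  next
    fix \<C> assume ne: "\<C> \<noteq> {}" and ch: "subset.chain \<G> \<C>"
    have sub: "\<C> \<subseteq> \<G>" and lin: "\<And>X Y. X \<in> \<C> \<Longrightarrow> Y \<in> \<C> \<Longrightarrow> X \<subseteq> Y \<or> Y \<subseteq> X"
      using ch by (auto simp: subset_chain_def)
    have "subspace (\<Union>\<C>)"
    proof (rule subspaceI)
      obtain X where "X \<in> \<C>" using ne by blast
      then show "0 \<in> \<Union>\<C>" using sub subspace_0[of X] by (auto simp: \<G>_def)
    next
      fix p q assume "p \<in> \<Union>\<C>" "q \<in> \<Union>\<C>"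
      then obtain X Y where XY: "X \<in> \<C>" "p \<in> X" "Y \<in> \<C>" "q \<in> Y" by auto
      then obtain Z where Z: "Z \<in> \<C>" "p \<in> Z" "q \<in> Z" using lin[of X Y] by auto
      then have "subspace Z" using sub by (auto simp: \<G>_def)
      then have "p + q \<in> Z" using Z by (intro subspace_add)
      then show "p + q \<in> \<Union>\<C>" using Z by blast
    next
      fix p and c :: real assume "p \<in> \<Union>\<C>"
      then obtain X where X: "X \<in> \<C>" "p \<in> X" by auto
      then have "subspace X" using sub by (auto simp: \<G>_def)
      then have "c *\<^sub>R p \<in> X" using X by (intro subspace_scale)
      then show "c *\<^sub>R p \<in> \<Union>\<C>" using X by blast
    qed
    moreover have "(x, norm x) \<in> \<Union>\<C>" using ne sub by (auto simp: \<G>_def)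
    moreover have "c \<le> norm y" if "(y, c) \<in> \<Union>\<C>" for y c
      using that sub by (auto simp: \<G>_def)
    ultimately show "\<Union>\<C> \<in> \<G>" by (auto simp: \<G>_def)
  qed
  then obtain G where G: "G \<in> \<G>" and max: "\<And>X. X \<in> \<G> \<Longrightarrow> G \<subseteq> X \<Longrightarrow> X = G" by blast
  have sG: "subspace G" and leG: "\<And>y c. (y, c) \<in> G \<Longrightarrow> c \<le> norm y" and xG: "(x, norm x) \<in> G"
    using G by (auto simp: \<G>_def)
  have total: "\<exists>c. (y, c) \<in> G" for y
  proof (rule ccontr)
    assume no: "\<nexists>c. (y, c) \<in> G"
    \<comment> \<open>A value \<open>c0\<close> at the new vector \<open>y\<close> keeps the
      extension below the norm iff it lies above every element of \<open>S\<close> and below every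
      \<open>norm (fst q + y) - snd q\<close>. The triangle inequality puts the first family below
      the second, so \<open>Sup S\<close> works.\<close>
    define S where "S = (\<lambda>p. snd p - norm (fst p - y)) ` G"
    have le: "snd p - norm (fst p - y) \<le> norm (fst q + y) - snd q" if "p \<in> G" "q \<in> G" for p q
    proof -
      have "(fst p + fst q, snd p + snd q) \<in> G"
        using subspace_add[OF sG that] by (simp add: plus_prod_def)
      from leG[OF this] have "snd p + snd q \<le> norm ((fst p - y) + (fst q + y))" by simp
      also have "\<dots> \<le> norm (fst p - y) + norm (fst q + y)" by (rule norm_triangle_ineq)
      finally show ?thesis by simp
    qed
    define c0 where "c0 = Sup S"
    have neS: "S \<noteq> {}" using xG by (auto simp: S_def)
    have bdd: "bdd_above S" unfolding S_def using le[OF _ xG] by (auto intro!: bdd_aboveI2)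
    have lo: "snd p - norm (fst p - y) \<le> c0" if "p \<in> G" for p
      unfolding c0_def by (rule cSup_upper[OF _ bdd]) (use that in \<open>auto simp: S_def\<close>)
    have hi: "c0 \<le> norm (fst q + y) - snd q" if "q \<in> G" for q
      unfolding c0_def by (rule cSup_least[OF neS]) (use le that in \<open>auto simp: S_def\<close>)
    define G' where "G' = {p + k *\<^sub>R (y, c0) | p k. p \<in> G}"
    have "G' \<in> \<G>"
      unfolding \<G>_def
    proof (intro CollectI conjI allI impI)
      have "G' = {a + b |a b. a \<in> G \<and> b \<in> span {(y, c0)}}"
        unfolding G'_def span_singleton by blast
      then show "subspace G'" using subspace_sums[OF sG subspace_span[of "{(y, c0)}"]] by simp
      show "(x, norm x) \<in> G'" unfolding G'_def
        using xG by (intro CollectI exI[of _ "(x, norm x)"] exI[of _ 0]) auto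
    next
      fix z d assume "(z, d) \<in> G'"
      then obtain p k where p: "p \<in> G" and "(z, d) = p + k *\<^sub>R (y, c0)"
        unfolding G'_def by blast
      then have zd: "z = fst p + k *\<^sub>R y" "d = snd p + k * c0"
        by (simp_all add: prod_eq_iff)
      consider "k = 0" | "k > 0" | "k < 0" by linarith
      then show "d \<le> norm z"
      proof cases
        case 1 then show ?thesis using leG[of "fst p" "snd p"] p zd by simp
      next
        case 2
        have "(1/k) *\<^sub>R p \<in> G" using sG p by (rule subspace_scale)
        from hi[OF this] have "k * c0 \<le> k * (norm ((1/k) *\<^sub>R fst p + y) - snd p / k)"
          using 2 by (intro mult_left_mono) auto
        also have "\<dots> = norm (k *\<^sub>R ((1/k) *\<^sub>R fst p + y)) - snd p"
          using 2 by (simp add: right_diff_distrib)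
        finally show ?thesis using 2 zd by (simp add: scaleR_add_right)
      next
        case 3
        have "(1/(-k)) *\<^sub>R p \<in> G" using sG p by (rule subspace_scale)
        from lo[OF this] have "(-k) * (snd p / (-k) - norm ((1/(-k)) *\<^sub>R fst p - y)) \<le> (-k) * c0"
          using 3 by (intro mult_left_mono) auto
        moreover have "(-k) * (snd p / (-k) - norm ((1/(-k)) *\<^sub>R fst p - y)) =
            snd p - norm ((-k) *\<^sub>R ((1/(-k)) *\<^sub>R fst p - y))"
          using 3 by (simp only: norm_scaleR) (simp add: algebra_simps)
        moreover have "(-k) *\<^sub>R ((1/(-k)) *\<^sub>R fst p - y) = z"
          using 3 zd by (simp add: scaleR_diff_right)
        ultimately have "snd p - norm z \<le> (-k) * c0" by (simp only:)
        then show ?thesis using zd(2) by simp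
      qed
    qed
    moreover have "G \<subseteq> G'" unfolding G'_def
    proof
      fix p assume "p \<in> G"
      then show "p \<in> {p + k *\<^sub>R (y, c0) | p k. p \<in> G}"
        by (intro CollectI exI[of _ p] exI[of _ 0]) (simp add: zero_prod_def)
    qed
    ultimately have "G' = G" by (rule max)
    moreover have "(y, c0) \<in> G'" unfolding G'_def
      using subspace_0[OF sG] by (intro CollectI exI[of _ 0] exI[of _ 1]) (auto simp: zero_prod_def)
    ultimately show False using no by blast
  qed
  have uniq: "c = d" if "(y, c) \<in> G" "(y, d) \<in> G" for y c d
    using leG[of 0 "c - d"] leG[of 0 "d - c"] subspace_diff[OF sG that] subspace_diff[OF sG that(2,1)]
    by simp
  define f where "f y = (THE c. (y, c) \<in> G)" for y
  have fG: "(y, f y) \<in> G" for y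
    unfolding f_def using total[of y] uniq by (metis theI)
  show ?thesis
  proof
    show "linear f"
    proof (rule linearI)
      show "f (y + z) = f y + f z" for y z
        using subspace_add[OF sG fG[of y] fG[of z]] fG[of "y + z"] uniq by auto
      show "f (r *\<^sub>R y) = r *\<^sub>R f y" for r y
        using subspace_scale[OF sG fG[of y], of r] fG[of "r *\<^sub>R y"] uniq by auto
    qed
    show "f y \<le> norm y" for y using leG fG by blast
    show "f x = norm x" using fG xG uniq by blast
  qed
qed

lemma scaleC_complex_eq [simp]: "c *\<^sub>C (x::complex) = c * x"
  by (simp add: scaleC_complex_def)

lemma scaleC_one [simp]: "1 *\<^sub>C (x::'a::complex_banach) = x"
  using scaleR_scaleC[of 1 x] by simp

lemma bounded_clinear_compose:
  "bounded_clinear f \<Longrightarrow> bounded_clinear g \<Longrightarrow> bounded_clinear (\<lambda>x. f (g x))"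
  by (auto simp: bounded_clinear_def intro: bounded_linear_compose)

text \<open>The bound \<open>c\<close> is a parameter because functionals get composed with
  \<open>S t\<close> and \<open>lap 1\<close>, whose norms may exceed 1. No sign is imposed on
  \<open>c\<close>: on the zero space it may be negative, whence the absolute values of
  \<open>c\<close> later on.\<close>

definition functional_bound :: "('a::complex_banach \<Rightarrow> complex) \<Rightarrow> real \<Rightarrow> bool" where
  "functional_bound l c \<longleftrightarrow> bounded_clinear l \<and> (\<forall>y. cmod (l y) \<le> c * norm y)"

text \<open>The real functional \<open>f\<close> is complexified as
  \<open>f y - \<i> f (\<i> y)\<close>, whose real part is \<open>f\<close>.\<close>

lemma norming_functional:
  fixes x :: "'a::complex_banach"
  obtains l where "functional_bound l 1" "norm x \<le> cmod (l x)"
proof -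
  obtain f :: "'a \<Rightarrow> real" where f: "linear f" and fle: "\<And>y. f y \<le> norm y" and fx: "f x = norm x"
    using hahn_banach_real[of x] by metis
  interpret f: linear f by fact
  define l where "l y = Complex (f y) (- f (\<i> *\<^sub>C y))" for y
  have l_scaleC: "l (c *\<^sub>C y) = c * l y" for c y
  proof -
    have 1: "c *\<^sub>C y = Re c *\<^sub>R y + Im c *\<^sub>R (\<i> *\<^sub>C y)" for c and y :: 'a
      by (metis complex_eq mult.commute scaleC_add_left scaleC_scaleC scaleR_scaleC)
    have 2: "\<i> *\<^sub>C (\<i> *\<^sub>C y) = - y"
      using scaleR_scaleC[of "-1" y] by (simp add: scaleC_scaleC)
    have "\<i> *\<^sub>C (c *\<^sub>C y) = c *\<^sub>C (\<i> *\<^sub>C y)" by (simp add: scaleC_scaleC mult.commute)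
    also have "\<dots> = Re c *\<^sub>R (\<i> *\<^sub>C y) - Im c *\<^sub>R y"
      unfolding 1[of c "\<i> *\<^sub>C y"] 2 by simp
    finally have 3: "\<i> *\<^sub>C (c *\<^sub>C y) = Re c *\<^sub>R (\<i> *\<^sub>C y) - Im c *\<^sub>R y" .
    show ?thesis unfolding l_def 3
      by (simp add: 1[of c y] f.add f.diff f.scale complex_eq_iff algebra_simps)
  qed
  have l_bound: "cmod (l y) \<le> norm y" for y
  proof (cases "l y = 0")
    case False
    \<comment> \<open>Rotation by this unit scalar makes \<open>l (c *\<^sub>C y)\<close> real and
      equal to \<open>cmod (l y)\<close>, so the bound on the real part suffices.\<close>
    define c where "c = cnj (l y) / cmod (l y)"
    have "l (c *\<^sub>C y) = cmod (l y)"
      unfolding l_scaleC c_def using False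
      by (simp add: field_simps complex_norm_square[symmetric] power2_eq_square)
    then have "cmod (l y) = Re (l (c *\<^sub>C y))" by simp
    also have "\<dots> = f (c *\<^sub>C y)" by (simp add: l_def)
    also have "\<dots> \<le> norm (c *\<^sub>C y)" by (rule fle)
    also have "\<dots> = norm y" using False by (simp add: norm_scaleC c_def norm_divide)
    finally show ?thesis .
  qed simp
  show ?thesis
  proof
    have "bounded_linear l"
    proof (rule bounded_linear_intro[where K = 1])
      show "l (y + z) = l y + l z" for y z
        by (simp add: l_def scaleC_add_right f.add complex_eq_iff)
      show "l (r *\<^sub>R y) = r *\<^sub>R l y" for r y
        unfolding scaleR_scaleC l_scaleC by simp
    qed (use l_bound in simp)
    then show "functional_bound l 1"
      using l_scaleC l_bound by (simp add: functional_bound_def bounded_clinear_def)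
    show "norm x \<le> cmod (l x)"
      using complex_Re_le_cmod[of "l x"] fx by (simp add: l_def)
  qed
qed

lemma norm_le_functionals:
  fixes x :: "'a::complex_banach"
  assumes "\<And>l. functional_bound l 1 \<Longrightarrow> cmod (l x) \<le> c"
  shows "norm x \<le> c"
  by (rule norming_functional[of x]) (use assms in force)

lemma eq_functionals:
  fixes x y :: "'a::complex_banach"
  assumes "\<And>l. functional_bound l 1 \<Longrightarrow> l x = l y"
  shows "x = y"
proof -
  have "norm (x - y) \<le> 0"
  proof (rule norm_le_functionals)
    fix l :: "'a \<Rightarrow> complex" assume l: "functional_bound l 1"
    then interpret bounded_linear l by (simp add: functional_bound_def bounded_clinear_def)
    show "cmod (l (x - y)) \<le> 0" using assms[OF l] by (simp add: diff)
  qed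
  then show ?thesis by simp
qed

subsection \<open>Bochner integrals of limits of simple functions\<close>

text \<open>Strong measurability in an everywhere form. On a non-separable space Borel measurability
  need not survive sums or scalar products, while limits of simple functions compose with every
  sequentially continuous operation.\<close>

definition simple_limit :: "'a measure \<Rightarrow> ('a \<Rightarrow> 'b::topological_space) \<Rightarrow> bool" where
  "simple_limit M f \<longleftrightarrow>
     (\<exists>s. (\<forall>i::nat. simple_function M (s i)) \<and> (\<forall>x\<in>space M. (\<lambda>i. s i x) \<longlonglongrightarrow> f x))"

lemma simple_limit_imp_borel_measurable:
  fixes f :: "'a \<Rightarrow> 'b::metric_space"
  assumes "simple_limit M f"
  shows "f \<in> borel_measurable M"
proof -
  obtain s where "\<And>i::nat. simple_function M (s i)" "\<And>x. x \<in> space M \<Longrightarrow> (\<lambda>i. s i x) \<longlonglongrightarrow> f x"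
    using assms unfolding simple_limit_def by blast
  then show ?thesis
    by (intro borel_measurable_LIMSEQ_metric[of s M f]) (auto intro: borel_measurable_simple_function)
qed

lemma borel_measurable_imp_simple_limit:
  fixes f :: "'a \<Rightarrow> 'b :: {metric_space, second_countable_topology}"
  shows "f \<in> borel_measurable M \<Longrightarrow> simple_limit M f"
  unfolding simple_limit_def
  using borel_measurable_implies_sequence_metric[of f M undefined] by blast

lemma simple_limit_const: "simple_limit M (\<lambda>x. c)"
  unfolding simple_limit_def by (intro exI[of _ "\<lambda>i x. c"]) auto

lemma simple_limit_compose2:
  assumes "simple_limit M f" "simple_limit M g"
    and F: "\<And>p q a b. p \<longlonglongrightarrow> a \<Longrightarrow> q \<longlonglongrightarrow> b \<Longrightarrow> (\<lambda>i::nat. F (p i) (q i)) \<longlonglongrightarrow> F a b"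
  shows "simple_limit M (\<lambda>x. F (f x) (g x))"
proof -
  obtain s t where "\<And>i::nat. simple_function M (s i)" "\<And>x. x \<in> space M \<Longrightarrow> (\<lambda>i. s i x) \<longlonglongrightarrow> f x"
     "\<And>i::nat. simple_function M (t i)" "\<And>x. x \<in> space M \<Longrightarrow> (\<lambda>i. t i x) \<longlonglongrightarrow> g x"
    using assms(1,2) unfolding simple_limit_def by blast
  then show ?thesis unfolding simple_limit_def
    by (intro exI[of _ "\<lambda>i x. F (s i x) (t i x)"]) (auto intro: F simple_function_compose2)
qed

lemma simple_limit_measurable_compose:
  assumes g: "g \<in> measurable M N" and f: "simple_limit N f"
  shows "simple_limit M (\<lambda>x. f (g x))"
proof -
  obtain s where s: "\<And>i::nat. simple_function N (s i)" "\<And>x. x \<in> space N \<Longrightarrow> (\<lambda>i. s i x) \<longlonglongrightarrow> f x"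
    using f unfolding simple_limit_def by blast
  have "simple_function M (\<lambda>x. s i (g x))" for i
  proof -
    have gs: "g ` space M \<subseteq> space N" using g by (auto dest: measurable_space)
    have "(\<lambda>x. s i (g x)) ` space M \<subseteq> s i ` space N" using gs by auto
    then have "finite ((\<lambda>x. s i (g x)) ` space M)"
      using simple_functionD(1)[OF s(1)] by (rule finite_subset)
    moreover have "(\<lambda>x. s i (g x)) -` X \<inter> space M \<in> sets M" for X
    proof -
      have "(\<lambda>x. s i (g x)) -` X \<inter> space M = g -` (s i -` X \<inter> space N) \<inter> space M"
        using gs by auto
      then show ?thesis using measurable_sets[OF g simple_functionD(2)[OF s(1)]] by simp
    qed
    ultimately show ?thesis unfolding simple_function_def by auto
  qed
  then show ?thesis unfolding simple_limit_def
    using s(2) g by (intro exI[of _ "\<lambda>i x. s i (g x)"]) (auto dest: measurable_space)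
qed

lemma tendsto_scaleC:
  fixes g :: "'b \<Rightarrow> 'a::complex_banach"
  assumes f: "(f \<longlongrightarrow> a) F" and g: "(g \<longlongrightarrow> b) F"
  shows "((\<lambda>x. f x *\<^sub>C g x) \<longlongrightarrow> a *\<^sub>C b) F"
proof -
  have eq: "f x *\<^sub>C g x - a *\<^sub>C b = (f x - a) *\<^sub>C g x + a *\<^sub>C (g x - b)" for x
  proof -
    have "f x *\<^sub>C g x = (f x - a) *\<^sub>C g x + a *\<^sub>C g x" by (simp flip: scaleC_add_left)
    moreover have "a *\<^sub>C g x = a *\<^sub>C (g x - b) + a *\<^sub>C b" by (simp flip: scaleC_add_right)
    ultimately show ?thesis by simp
  qed
  have "((\<lambda>x. f x *\<^sub>C g x - a *\<^sub>C b) \<longlongrightarrow> 0) F"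
  proof (rule tendsto_norm_zero_cancel, rule tendsto_sandwich[where f = "\<lambda>_. 0"])
    show "\<forall>\<^sub>F x in F. norm (f x *\<^sub>C g x - a *\<^sub>C b) \<le> cmod (f x - a) * norm (g x) + cmod a * norm (g x - b)"
      unfolding eq by (intro always_eventually allI order_trans[OF norm_triangle_ineq]) (simp add: norm_scaleC)
    have "((\<lambda>x. cmod (f x - a) * norm (g x) + cmod a * norm (g x - b)) \<longlongrightarrow> cmod (a - a) * norm b + cmod a * norm (b - b)) F"
      by (intro tendsto_intros f g)
    then show "((\<lambda>x. cmod (f x - a) * norm (g x) + cmod a * norm (g x - b)) \<longlongrightarrow> 0) F" by simp
  qed auto
  then show ?thesis by (rule LIM_zero_cancel)
qed

lemma simple_limit_scaleC:
  fixes g :: "'a \<Rightarrow> 'b::complex_banach"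
  assumes "simple_limit M f" "simple_limit M g"
  shows "simple_limit M (\<lambda>x. f x *\<^sub>C g x)"
  by (rule simple_limit_compose2[OF assms tendsto_scaleC])

lemma simple_limit_bounded_linear:
  "bounded_linear l \<Longrightarrow> simple_limit M f \<Longrightarrow> simple_limit M (\<lambda>x. l (f x))"
  by (rule simple_limit_compose2[where g = "\<lambda>x. 0::real" and F = "\<lambda>a b. l a"])
     (auto intro: simple_limit_const bounded_linear.tendsto)

text \<open>The difference of two Borel functions can fail to be Borel on a non-separable space.
  With a simple subtrahend the domain splits into finitely many pieces, and on each of them a
  constant is subtracted.\<close>

lemma borel_measurable_diff_simple:
  fixes f :: "'a \<Rightarrow> 'b::real_normed_vector"
  assumes f: "f \<in> borel_measurable M" and s: "simple_function M s"
  shows "(\<lambda>x. f x - s x) \<in> borel_measurable M"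
proof (rule measurable_compose_countable'[where g = s and I = "s ` space M" and f = "\<lambda>y x. f x - y"])
  show "(\<lambda>x. f x - y) \<in> borel_measurable M" for y
    using f by (rule measurable_compose) (intro borel_measurable_continuous_onI continuous_intros)
  show "countable (s ` space M)" using simple_functionD(1)[OF s] by (rule countable_finite)
  then show "s \<in> measurable M (count_space (s ` space M))"
    using simple_functionD(2)[OF s] by (auto simp: measurable_count_space_eq_countable)
qed

text \<open>The approximating simple functions are pushed through \<open>l\<close>. Since the
  codomain is second countable, an ordinary Lebesgue integral results; all integrals in
  \<open>'a\<close> are tested against functionals through this lemma.\<close>

lemma has_bochner_bounded_linear:
  fixes f :: "'a \<Rightarrow> 'b::real_normed_vector" and l :: "'b \<Rightarrow> 'c::{real_normed_vector, second_countable_topology}"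
  assumes l: "bounded_linear l" and f: "has_bochner M f x"
  shows "has_bochner_integral M (\<lambda>x. l (f x)) (l x)"
proof -
  interpret l: bounded_linear l by fact
  have ml: "l \<in> borel_measurable borel"
    by (intro borel_measurable_continuous_onI l.continuous_on continuous_on_id)
  obtain s where f: "f \<in> borel_measurable M" and s: "\<And>i. Bochner_Integration.simple_bochner_integrable M (s i)"
    and lim: "(\<lambda>i. \<integral>\<^sup>+y. norm (f y - s i y) \<partial>M) \<longlonglongrightarrow> 0"
    and x: "(\<lambda>i. Bochner_Integration.simple_bochner_integral M (s i)) \<longlonglongrightarrow> x"
    using f unfolding has_bochner_def by blast
  have [measurable]: "(\<lambda>y. f y - s i y) \<in> borel_measurable M" for i
    by (rule borel_measurable_diff_simple[OF f]) (use s[of i] in \<open>auto elim: Bochner_Integration.simple_bochner_integrable.cases\<close>)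
  obtain K where K: "K > 0" "\<And>y. norm (l y) \<le> norm y * K"
    using l.pos_bounded by blast
  show ?thesis
  proof (rule has_bochner_integral.intros)
    show "(\<lambda>x. l (f x)) \<in> borel_measurable M" using measurable_compose[OF f ml] .
    show "Bochner_Integration.simple_bochner_integrable M (\<lambda>x. l (s i x))" for i
      using s[of i] by (auto intro: Bochner_Integration.simple_bochner_integrable_compose2 l.zero)
    show "(\<lambda>i. Bochner_Integration.simple_bochner_integral M (\<lambda>x. l (s i x))) \<longlonglongrightarrow> l x"
      using l.tendsto[OF x] by (simp add: Bochner_Integration.simple_bochner_integral_linear[OF l.linear s])
    show "(\<lambda>i. \<integral>\<^sup>+ y. norm (l (f y) - l (s i y)) \<partial>M) \<longlonglongrightarrow> 0"
    proof (rule tendsto_sandwich[where f = "\<lambda>_. 0"])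
      have "(\<integral>\<^sup>+ y. norm (l (f y) - l (s i y)) \<partial>M) \<le> K * (\<integral>\<^sup>+y. norm (f y - s i y) \<partial>M)" for i
      proof -
        have "(\<integral>\<^sup>+ y. norm (l (f y) - l (s i y)) \<partial>M) \<le> (\<integral>\<^sup>+ y. ennreal K * norm (f y - s i y) \<partial>M)"
          using K by (intro nn_integral_mono) (auto simp: ac_simps ennreal_mult[symmetric] l.diff[symmetric])
        also have "\<dots> = K * (\<integral>\<^sup>+ y. norm (f y - s i y) \<partial>M)"
          by (rule nn_integral_cmult) measurable
        finally show ?thesis .
      qed
      then show "\<forall>\<^sub>F i in sequentially. (\<integral>\<^sup>+ y. norm (l (f y) - l (s i y)) \<partial>M) \<le> K * (\<integral>\<^sup>+y. norm (f y - s i y) \<partial>M)"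
        by simp
      show "(\<lambda>i. K * (\<integral>\<^sup>+y. norm (f y - s i y) \<partial>M)) \<longlonglongrightarrow> 0"
        using ennreal_tendsto_cmult[OF _ lim, of K] by simp
    qed auto
  qed
qed

lemma has_bochner_functional:
  fixes f :: "'a \<Rightarrow> 'b::complex_banach"
  assumes "functional_bound l c" "has_bochner M f x"
  shows "has_bochner_integral M (\<lambda>x. l (f x)) (l x)"
  using assms by (auto intro: has_bochner_bounded_linear simp: functional_bound_def bounded_clinear_def)

text \<open>Functionals separate points and reduce uniqueness to the scalar integral.\<close>

lemma has_bochner_unique:
  fixes f :: "'a \<Rightarrow> 'b::complex_banach"
  assumes "has_bochner M f x" "has_bochner M f y"
  shows "x = y"
  by (rule eq_functionals) (metis assms has_bochner_functional has_bochner_integral_eq)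

lemma bochner_integral_eqI:
  fixes f :: "'a \<Rightarrow> 'b::complex_banach"
  assumes "has_bochner M f x"
  shows "bochner_integral M f = x"
  unfolding bochner_integral_def using assms has_bochner_unique[of M f] by (auto intro!: the_equality)

lemma has_bochner_cong_AE:
  fixes f g :: "'a \<Rightarrow> 'b::real_normed_vector"
  assumes "f \<in> borel_measurable M" "g \<in> borel_measurable M" "AE x in M. f x = g x"
  shows "has_bochner M f = has_bochner M g"
proof -
  have "(\<integral>\<^sup>+y. norm (f y - s y) \<partial>M) = (\<integral>\<^sup>+y. norm (g y - s y) \<partial>M)" for s
    using assms(3) by (intro nn_integral_cong_AE) auto
  then show ?thesis using assms unfolding has_bochner_def fun_eq_iff by simp
qed

lemma simple_limit_has_bochner:
  fixes f :: "'a \<Rightarrow> 'b::complex_banach"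
  assumes f: "simple_limit M f" and fin: "(\<integral>\<^sup>+x. norm (f x) \<partial>M) < \<infinity>"
  shows "has_bochner M f (bochner_integral M f)"
proof -
  have nf[measurable]: "(\<lambda>x. norm (f x)) \<in> borel_measurable M"
    using simple_limit_imp_borel_measurable[OF f] by (rule measurable_compose) measurable
  obtain s where s: "\<And>i::nat. simple_function M (s i)" "\<And>x. x \<in> space M \<Longrightarrow> (\<lambda>i. s i x) \<longlonglongrightarrow> f x"
    using f unfolding simple_limit_def by blast
  have [measurable]: "(\<lambda>x. norm (s i x)) \<in> borel_measurable M" for i
    using simple_function_compose1[OF s(1)] by (rule borel_measurable_simple_function)
  \<comment> \<open>Cutting \<open>s i\<close> off where it exceeds twice the norm of
    \<open>f\<close> keeps pointwise convergence and gives
    \<open>norm (f x - r i x) \<le> 3 * norm (f x)\<close>. Dominated convergence applies, and the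
    integrals of \<open>r i\<close> form a Cauchy sequence. Where \<open>f x = 0\<close> the cut-off
    forces \<open>r i x = 0\<close>.\<close>
  define r where "r i x = (if norm (s i x) \<le> 2 * norm (f x) then s i x else 0)" for i x
  have r: "simple_function M (r i)" for i
    unfolding r_def[abs_def] by (intro simple_function_If s simple_function_const) measurable
  have bound: "norm (r i x) \<le> 2 * norm (f x)" for i x by (auto simp: r_def)
  have rf: "(\<lambda>i. r i x) \<longlonglongrightarrow> f x" if "x \<in> space M" for x
  proof (cases "f x = 0")
    case True
    then have "r i x = 0" for i by (simp add: r_def)
    then show ?thesis using True by simp
  next
    case False
    then have "norm (f x) < 2 * norm (f x)" by simp
    then have "\<forall>\<^sub>F i in sequentially. norm (s i x) < 2 * norm (f x)"
      using tendsto_norm[OF s(2)[OF that]] by (rule order_tendstoD(2)[rotated])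
    then have "\<forall>\<^sub>F i in sequentially. s i x = r i x"
      by eventually_elim (simp add: r_def)
    then show ?thesis using s(2)[OF that] by (rule Lim_transform_eventually[rotated])
  qed
  have fin2: "(\<integral>\<^sup>+ x. ennreal (2 * norm (f x)) \<partial>M) < \<infinity>"
    using fin by (simp add: nn_integral_cmult ennreal_mult ennreal_mult_less_top)
  have [measurable]: "(\<lambda>x. norm (f x - r i x)) \<in> borel_measurable M" for i
    using borel_measurable_diff_simple[OF simple_limit_imp_borel_measurable[OF f] r]
    by (rule measurable_compose) measurable
  have r_int: "Bochner_Integration.simple_bochner_integrable M (r i)" for i
  proof (rule Bochner_Integration.simple_bochner_integrableI_bounded[OF r])
    have "(\<integral>\<^sup>+x. norm (r i x) \<partial>M) \<le> (\<integral>\<^sup>+x. ennreal (2 * norm (f x)) \<partial>M)"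
      by (intro nn_integral_mono) (simp add: bound)
    then show "(\<integral>\<^sup>+x. norm (r i x) \<partial>M) < \<infinity>" using fin2 by (rule le_less_trans)
  qed
  have lim: "(\<lambda>i. \<integral>\<^sup>+y. norm (f y - r i y) \<partial>M) \<longlonglongrightarrow> (\<integral>\<^sup>+y. 0 \<partial>M)"
  proof (rule nn_integral_dominated_convergence[where w = "\<lambda>x. ennreal (3 * norm (f x))"])
    show "AE x in M. ennreal (norm (f x - r j x)) \<le> ennreal (3 * norm (f x))" for j
    proof (intro AE_I2 ennreal_leI)
      fix x show "norm (f x - r j x) \<le> 3 * norm (f x)"
        using norm_triangle_ineq4[of "f x" "r j x"] bound[of j x] by linarith
    qed
    show "(\<integral>\<^sup>+ x. ennreal (3 * norm (f x)) \<partial>M) < \<infinity>"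
      using fin by (simp add: nn_integral_cmult ennreal_mult ennreal_mult_less_top)
    show "AE x in M. (\<lambda>i. ennreal (norm (f x - r i x))) \<longlonglongrightarrow> 0"
    proof (intro AE_I2)
      fix x assume "x \<in> space M"
      from tendsto_diff[OF tendsto_const[of "f x"] rf[OF this]]
      show "(\<lambda>i. ennreal (norm (f x - r i x))) \<longlonglongrightarrow> 0"
        by (simp add: tendsto_norm_zero_iff flip: ennreal_0)
    qed
  qed measurable
  define I where "I i = Bochner_Integration.simple_bochner_integral M (r i)" for i
  define e where "e i = (\<integral>\<^sup>+y. norm (f y - r i y) \<partial>M)" for i
  have e: "e \<longlonglongrightarrow> 0" using lim by (simp add: e_def[abs_def])
  have I_diff: "ennreal (norm (I i - I j)) \<le> e i + e j" for i j
  proof -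
    have "ennreal (norm (I i - I j)) = norm (Bochner_Integration.simple_bochner_integral M (\<lambda>x. r i x - r j x))"
      unfolding I_def using r_int by (subst Bochner_Integration.simple_bochner_integral_diff) auto
    also have "\<dots> \<le> Bochner_Integration.simple_bochner_integral M (\<lambda>x. norm (r i x - r j x))"
      using Bochner_Integration.simple_bochner_integrable_compose2[of "(-)" M "r i" "r j"] r_int
      by (auto intro!: Bochner_Integration.simple_bochner_integral_norm_bound)
    also have "\<dots> = (\<integral>\<^sup>+x. norm (r i x - r j x) \<partial>M)"
      using Bochner_Integration.simple_bochner_integrable_compose2[of "\<lambda>x y. norm (x - y)" M "r i" "r j"] r_int
      by (auto intro!: Bochner_Integration.simple_bochner_integral_eq_nn_integral)
    also have "\<dots> \<le> (\<integral>\<^sup>+x. ennreal (norm (f x - r i x)) + ennreal (norm (f x - r j x)) \<partial>M)"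
    proof (intro nn_integral_mono)
      fix x
      have "norm (r i x - r j x) \<le> norm (f x - r i x) + norm (f x - r j x)"
        by (metis dual_order.refl norm_diff_triangle_le norm_minus_commute)
      then show "ennreal (norm (r i x - r j x)) \<le> ennreal (norm (f x - r i x)) + ennreal (norm (f x - r j x))"
        by (metis ennreal_leI ennreal_plus norm_ge_zero)
    qed
    also have "\<dots> = e i + e j" unfolding e_def by (rule nn_integral_add) auto
    finally show ?thesis .
  qed
  have "Cauchy I"
  proof (rule CauchyI)
    fix d :: real assume d: "0 < d"
    then have "\<forall>\<^sub>F i in sequentially. e i < ennreal (d / 2)"
      using e by (intro order_tendstoD(2)) (auto simp: ennreal_0)
    then obtain N where N: "\<And>i. i \<ge> N \<Longrightarrow> e i < ennreal (d / 2)"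
      by (auto simp: eventually_sequentially)
    have "norm (I m - I n) < d" if "m \<ge> N" "n \<ge> N" for m n
    proof -
      have "ennreal (norm (I m - I n)) \<le> e m + e n" by (rule I_diff)
      also have "\<dots> < ennreal (d / 2) + ennreal (d / 2)"
        using N[OF that(1)] N[OF that(2)] by (rule add_strict_mono)
      also have "\<dots> = ennreal d" using d by (simp flip: ennreal_plus)
      finally show ?thesis using d by (simp add: ennreal_less_iff)
    qed
    then show "\<exists>M. \<forall>m\<ge>M. \<forall>n\<ge>M. norm (I m - I n) < d" by blast
  qed
  then obtain y where "I \<longlonglongrightarrow> y" by (auto simp: Cauchy_convergent_iff convergent_def)
  then have "has_bochner M f y"
    unfolding has_bochner_def using simple_limit_imp_borel_measurable[OF f] r_int e
    by (auto simp: I_def[abs_def] e_def[abs_def])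
  then show ?thesis using bochner_integral_eqI by metis
qed

lemma simple_limit_bochner_functional:
  fixes f :: "'a \<Rightarrow> 'b::complex_banach"
  assumes "simple_limit M f" "(\<integral>\<^sup>+x. norm (f x) \<partial>M) < \<infinity>" "functional_bound l c"
  shows "integrable M (\<lambda>x. l (f x))" "l (bochner_integral M f) = (LINT x|M. l (f x))"
  using has_bochner_functional[OF assms(3) simple_limit_has_bochner[OF assms(1,2)]]
  by (auto simp: has_bochner_integral_iff)

text \<open>\<open>has_bochner\<close> demands Borel measurability, so a change of the integrand on
  a null set has to preserve it. In the completion every subset of a null set is measurable,
  whatever the codomain.\<close>

lemma borel_measurable_completion_AE:
  fixes f g :: "'a \<Rightarrow> 'b::topological_space"
  assumes g: "g \<in> borel_measurable M" and AE: "AE x in completion M. f x = g x"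
  shows "f \<in> borel_measurable (completion M)"
proof (rule borel_measurableI)
  fix S :: "'b set" assume S: "open S"
  have "Measurable.pred (completion M) (\<lambda>x. \<not> f x = g x)"
    by (rule sets_completion_AE) (use AE in \<open>simp add: AE_completion_iff\<close>)
  have gS: "g -` S \<inter> space M \<in> sets (completion M)"
    using measurable_sets[OF measurable_completion[OF g], of S] S by auto
  have "AE x in M. f x = g x" using AE by (simp add: AE_completion_iff)
  then obtain N where N: "N \<in> null_sets M" "{x\<in>space M. f x \<noteq> g x} \<subseteq> N"
    unfolding eventually_ae_filter by auto
  have "f -` S \<inter> space M = (g -` S \<inter> space M - {x\<in>space M. f x \<noteq> g x}) \<union> {x\<in>space M. f x \<noteq> g x \<and> f x \<in> S}"
    by auto
  moreover have "{x\<in>space M. f x \<noteq> g x} \<in> sets (completion M)"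
      "{x\<in>space M. f x \<noteq> g x \<and> f x \<in> S} \<in> sets (completion M)"
    using N by (auto intro!: sets_completionI_sub[of N])
  ultimately show "f -` S \<inter> space (completion M) \<in> sets (completion M)" using gS by auto
qed

text \<open>Almost-everywhere statements over \<open>lebesgue\<close> become everywhere statements
  over \<open>lborel\<close> by setting the function to 0 on one Borel null set. Product
  measurability and Fubini are then available, and neither the convolutions nor the integrals of the
  forcing term see the change.\<close>

lemma L_infinity_representative:
  fixes \<phi> :: "real \<Rightarrow> 'a::real_normed_vector"
  assumes "\<phi> \<in> L_infinity"
  obtains \<psi> C where "simple_limit lborel \<psi>" "\<And>t. norm (\<psi> t) \<le> C" "AE t in lebesgue. \<phi> t = \<psi> t"
proof -
  obtain s C where s: "\<And>i::nat. simple_function lebesgue (s i)" and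
     lim: "AE t in lebesgue. (\<lambda>i. s i t) \<longlonglongrightarrow> \<phi> t" and C: "AE t in lebesgue. norm (\<phi> t) \<le> C"
    using assms unfolding L_infinity_def strongly_measurable_def by blast
  obtain r where r: "\<And>i. simple_function lborel (r i)" and rs: "\<And>i. AE t in lborel. s i t = r i t"
    using completion_ex_simple_function[OF s] by metis
  have "AE t in lborel. (\<forall>i. s i t = r i t) \<and> (\<lambda>i. s i t) \<longlonglongrightarrow> \<phi> t \<and> norm (\<phi> t) \<le> C"
    using lim C rs by (simp add: AE_completion_iff AE_all_countable)
  then have "AE t in lborel. (\<lambda>i. r i t) \<longlonglongrightarrow> \<phi> t \<and> norm (\<phi> t) \<le> C"
    by eventually_elim auto
  then obtain N where N: "N \<in> null_sets lborel"
     and NN: "{t. \<not> ((\<lambda>i. r i t) \<longlonglongrightarrow> \<phi> t \<and> norm (\<phi> t) \<le> C)} \<subseteq> N"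
    unfolding eventually_ae_filter by auto
  define \<psi> where "\<psi> t = (if t \<in> N then 0 else \<phi> t)" for t
  show ?thesis
  proof
    show "simple_limit lborel \<psi>"
      unfolding simple_limit_def
    proof (intro exI[of _ "\<lambda>i t. if t \<in> N then 0 else r i t"] conjI allI ballI)
      show "simple_function lborel (\<lambda>t. if t \<in> N then 0 else r i t)" for i
        using N by (intro simple_function_If_set r simple_function_const) (auto simp: null_sets_def)
      show "(\<lambda>i. if t \<in> N then 0 else r i t) \<longlonglongrightarrow> \<psi> t" for t
        using NN by (auto simp: \<psi>_def)
    qed
    show "norm (\<psi> t) \<le> max C 0" for t
    proof (cases "t \<in> N")
      case False
      then have "norm (\<phi> t) \<le> C" using NN by blast
      then show ?thesis by (simp add: \<psi>_def le_max_iff_disj)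
    qed (simp add: \<psi>_def)
    have "AE t in lborel. t \<notin> N" using N by (rule AE_not_in)
    then show "AE t in lebesgue. \<phi> t = \<psi> t"
      by (auto simp: AE_completion_iff \<psi>_def elim: eventually_mono)
  qed
qed

text \<open>Domination by \<open>g x * k (y + c * x)\<close> covers products (c = 0) and
  convolutions (c = 1, c = -1) at once: by translation invariance the inner integral of
  \<open>k\<close> does not depend on \<open>x\<close>.\<close>

lemma fubini_bound:
  fixes h :: "real \<Rightarrow> real \<Rightarrow> complex" and g k :: "real \<Rightarrow> real"
  assumes [measurable]: "case_prod h \<in> borel_measurable (lborel \<Otimes>\<^sub>M lborel)"
    and g: "integrable lborel g" and k: "integrable lborel k"
    and le: "\<And>x y. cmod (h x y) \<le> g x * k (y + c * x)"
  shows fubini_bound_swap: "(LBINT x. LBINT y. h x y) = (LBINT y. LBINT x. h x y)"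
    and fubini_bound_fst: "integrable lborel (\<lambda>x. LBINT y. h x y)"
    and fubini_bound_snd: "integrable lborel (\<lambda>y. LBINT x. h x y)"
proof -
  have k': "integrable lborel (\<lambda>y. \<bar>k (y + b)\<bar>)" for b
    using lborel_integrable_real_affine[OF integrable_abs[OF k], of 1 b] by (simp add: add.commute)
  have kint: "(LBINT y. \<bar>k (y + b)\<bar>) = (LBINT y. \<bar>k y\<bar>)" for b
    using lborel_integral_real_affine[of 1 "\<lambda>y. \<bar>k y\<bar>" b] by (simp add: add.commute)
  have le': "cmod (h x y) \<le> \<bar>g x\<bar> * \<bar>k (y + c * x)\<bar>" for x y
    using le[of x y] by (simp add: abs_mult[symmetric])
  have int: "integrable (lborel \<Otimes>\<^sub>M lborel) (case_prod h)"
  proof (rule lborel_pair.Fubini_integrable)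
    have hx: "integrable lborel (\<lambda>y. h x y)" for x
      by (rule Bochner_Integration.integrable_bound[OF integrable_mult_right[OF k'[of "c * x"], of "\<bar>g x\<bar>"]])
         (use le' in \<open>auto simp: abs_mult\<close>)
    then show "AE x in lborel. integrable lborel (\<lambda>y. case (x, y) of (x, y) \<Rightarrow> h x y)" using hx by simp
    show "integrable lborel (\<lambda>x. LBINT y. cmod (case (x, y) of (x, y) \<Rightarrow> h x y))"
    proof (rule Bochner_Integration.integrable_bound[where f = "\<lambda>x. \<bar>g x\<bar> * (LBINT y. \<bar>k y\<bar>)"])
      show "integrable lborel (\<lambda>x. \<bar>g x\<bar> * (LBINT y. \<bar>k y\<bar>))"
        using g by (intro integrable_mult_left integrable_abs)
      show "AE x in lborel. norm (LBINT y. cmod (case (x, y) of (x, y) \<Rightarrow> h x y)) \<le> norm (\<bar>g x\<bar> * (LBINT y. \<bar>k y\<bar>))"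
      proof (intro AE_I2)
        fix x
        have "(LBINT y. cmod (h x y)) \<le> (LBINT y. \<bar>g x\<bar> * \<bar>k (y + c * x)\<bar>)"
          using le' by (intro integral_mono integrable_mult_right k' integrable_norm hx) auto
        also have "\<dots> = \<bar>g x\<bar> * (LBINT y. \<bar>k y\<bar>)" by (simp add: kint)
        finally show "norm (LBINT y. cmod (case (x, y) of (x, y) \<Rightarrow> h x y)) \<le> norm (\<bar>g x\<bar> * (LBINT y. \<bar>k y\<bar>))"
          by (simp add: abs_mult)
      qed
    qed measurable
  qed fact
  show "(LBINT x. LBINT y. h x y) = (LBINT y. LBINT x. h x y)"
    using lborel_pair.Fubini_integral[OF int] by simp
  show "integrable lborel (\<lambda>x. LBINT y. h x y)" "integrable lborel (\<lambda>y. LBINT x. h x y)"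
    using lborel_pair.integrable_fst[OF int] lborel_pair.integrable_snd[OF int] by auto
qed

subsection \<open>Fourier inversion\<close>

definition ft :: "(real \<Rightarrow> complex) \<Rightarrow> real \<Rightarrow> complex" where
  "ft f s = (LBINT t. f t * cis (- (s * t)))"

lemma measurable_cis [measurable]: "cis \<in> borel_measurable borel"
  by (intro borel_measurable_continuous_onI continuous_intros)

lemma integrable_mult_cis:
  assumes "integrable lborel f"
  shows "integrable lborel (\<lambda>t. f t * cis (c * t))" "integrable lborel (\<lambda>t. f t * cis (- (c * t)))"
proof -
  have [measurable]: "f \<in> borel_measurable borel" using assms by auto
  show "integrable lborel (\<lambda>t. f t * cis (c * t))" "integrable lborel (\<lambda>t. f t * cis (- (c * t)))"
    by (auto intro!: Bochner_Integration.integrable_bound[OF assms] simp: norm_mult)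
qed

text \<open>The substitution \<open>s = n * x\<close> in the characteristic function of the standard
  normal law.\<close>

lemma gaussian_fourier:
  fixes n :: real
  assumes n: "0 < n"
  shows "integrable lborel (\<lambda>s. complex_of_real (exp (- (s / n)\<^sup>2 / 2)) * cis (s * u))"
    and "(LBINT s. complex_of_real (exp (- (s / n)\<^sup>2 / 2)) * cis (s * u)) =
      n * sqrt (2 * pi) * exp (- (n * u)\<^sup>2 / 2)"
proof -
  have std: "(LBINT x. std_normal_density x *\<^sub>R cis (t * x)) = exp (- t\<^sup>2 / 2)"
    and stdi: "integrable lborel (\<lambda>x. std_normal_density x *\<^sub>R cis (t * x))" for t
  proof -
    have "(LBINT x. std_normal_density x *\<^sub>R cis (t * x)) = char std_normal_distribution t"
      unfolding char_def cis_conv_exp by (subst integral_density) (auto simp: mult_ac)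
    then show "(LBINT x. std_normal_density x *\<^sub>R cis (t * x)) = exp (- t\<^sup>2 / 2)"
      by (simp add: char_std_normal_distribution)
    have "integrable lborel std_normal_density" by (rule integrable_normal_density) simp
    then show "integrable lborel (\<lambda>x. std_normal_density x *\<^sub>R cis (t * x))"
      by (rule Bochner_Integration.integrable_bound) auto
  qed
  define c where "c = sqrt (2 * pi)"
  have c: "c > 0" by (simp add: c_def)
  have eq: "complex_of_real (exp (- ((n * x) / n)\<^sup>2 / 2)) * cis ((n * x) * u)
      = c * (std_normal_density x *\<^sub>R cis ((n * u) * x))" for x
    using n c by (simp add: std_normal_density_def c_def scaleR_conv_of_real mult_ac)
  have "integrable lborel (\<lambda>x. complex_of_real (exp (- ((0 + n * x) / n)\<^sup>2 / 2)) * cis ((0 + n * x) * u))"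
    unfolding add_0 eq by (intro integrable_mult_right stdi)
  then show "integrable lborel (\<lambda>s. complex_of_real (exp (- (s / n)\<^sup>2 / 2)) * cis (s * u))"
    by (subst (asm) lborel_integrable_real_affine_iff) (use n in auto)
  have "(LBINT s. complex_of_real (exp (- (s / n)\<^sup>2 / 2)) * cis (s * u))
      = \<bar>n\<bar> *\<^sub>R (LBINT x. complex_of_real (exp (- ((0 + n * x) / n)\<^sup>2 / 2)) * cis ((0 + n * x) * u))"
    by (rule lborel_integral_real_affine) (use n in simp)
  also have "\<dots> = n *\<^sub>R (c * exp (- (n * u)\<^sup>2 / 2))"
    unfolding add_0 eq integral_mult_right_zero std using n by (simp add: scaleR_conv_of_real)
  finally show "(LBINT s. complex_of_real (exp (- (s / n)\<^sup>2 / 2)) * cis (s * u)) =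
      n * sqrt (2 * pi) * exp (- (n * u)\<^sup>2 / 2)"
    by (simp add: c_def scaleR_conv_of_real)
qed

text \<open>Gaussian summation. The factor \<open>\<gamma> n\<close> permits Fubini, which moves the
  transform onto the Gaussian and yields averages of \<open>f\<close> against normal densities
  concentrating at \<open>t\<close>. Integrability of \<open>ft f\<close> gives the limit on one
  side, continuity and boundedness of \<open>f\<close> the limit on the other.\<close>

theorem fourier_inversion:
  fixes f :: "real \<Rightarrow> complex"
  assumes cont: "continuous_on UNIV f" and bdd: "\<And>t. cmod (f t) \<le> C"
    and f: "integrable lborel f" and F: "integrable lborel (ft f)"
  shows "(LBINT s. ft f s * cis (s * t)) = 2 * pi * f t"
proof -
  have fm[measurable]: "f \<in> borel_measurable borel" using f by auto
  define \<gamma> where "\<gamma> n s = complex_of_real (exp (- (s / real (Suc n))\<^sup>2 / 2))" for n s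
  have \<gamma>m[measurable]: "\<gamma> n \<in> borel_measurable borel" for n unfolding \<gamma>_def[abs_def] by measurable
  have \<gamma>_le: "cmod (\<gamma> n s) \<le> 1" for n s by (simp add: \<gamma>_def)
  have \<gamma>_int: "integrable lborel (\<lambda>s. \<gamma> n s * cis (s * u))" and
    \<gamma>_ft: "(LBINT s. \<gamma> n s * cis (s * u)) = Suc n * sqrt (2 * pi) * exp (- (Suc n * u)\<^sup>2 / 2)" for n and u :: real
    unfolding \<gamma>_def using gaussian_fourier[of "real (Suc n)" u] by (simp_all del: of_nat_Suc)
  have \<gamma>_abs: "integrable lborel (\<lambda>s. cmod (\<gamma> n s))" for n
    using \<gamma>_int[of n 0] by (simp add: integrable_norm)
  have eq: "(LBINT s. \<gamma> n s * (ft f s * cis (s * t))) = 2 * pi * (LBINT x. std_normal_density x *\<^sub>R f (t + x / Suc n))" for n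
  proof -
    have "(LBINT s. \<gamma> n s * (ft f s * cis (s * t))) = (LBINT s. LBINT r. \<gamma> n s * (f r * cis (s * (t - r))))"
    proof (rule Bochner_Integration.integral_cong[OF refl])
      fix s
      have "\<gamma> n s * (ft f s * cis (s * t)) = (\<gamma> n s * cis (s * t)) * ft f s" by simp
      also have "\<dots> = (LBINT r. (\<gamma> n s * cis (s * t)) * (f r * cis (- (s * r))))"
        unfolding ft_def by (rule integral_mult_right_zero[symmetric])
      also have "\<dots> = (LBINT r. \<gamma> n s * (f r * cis (s * (t - r))))"
      proof (rule Bochner_Integration.integral_cong[OF refl])
        fix r
        have "cis (s * (t - r)) = cis (s * t) * cis (- (s * r))" by (simp add: cis_mult algebra_simps)
        then show "(\<gamma> n s * cis (s * t)) * (f r * cis (- (s * r))) = \<gamma> n s * (f r * cis (s * (t - r)))"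
          by simp
      qed
      finally show "\<gamma> n s * (ft f s * cis (s * t)) = (LBINT r. \<gamma> n s * (f r * cis (s * (t - r))))" .
    qed
    also have "\<dots> = (LBINT r. LBINT s. \<gamma> n s * (f r * cis (s * (t - r))))"
      by (rule fubini_bound_swap[where g = "\<lambda>s. cmod (\<gamma> n s)" and k = "\<lambda>r. cmod (f r)" and c = 0])
         (use f \<gamma>_abs in \<open>auto simp: norm_mult intro: integrable_norm\<close>)
    also have "\<dots> = (LBINT r. f r * (Suc n * sqrt (2 * pi) * exp (- (Suc n * (t - r))\<^sup>2 / 2)))"
    proof (rule Bochner_Integration.integral_cong[OF refl])
      fix r
      have "(LBINT s. \<gamma> n s * (f r * cis (s * (t - r)))) = (LBINT s. f r * (\<gamma> n s * cis (s * (t - r))))"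
        by (rule Bochner_Integration.integral_cong) auto
      then show "(LBINT s. \<gamma> n s * (f r * cis (s * (t - r)))) = f r * (Suc n * sqrt (2 * pi) * exp (- (Suc n * (t - r))\<^sup>2 / 2))"
        by (simp add: \<gamma>_ft)
    qed
    \<comment> \<open>With \<open>r = t + x / Suc n\<close> the Gaussian of width
      \<open>1 / Suc n\<close> becomes the standard density; \<open>sqrt (2 * pi)\<close> is
      \<open>2 * pi\<close> times the normalising factor of that density.\<close>
    also have "\<dots> = \<bar>1 / Suc n\<bar> *\<^sub>R (LBINT x. f (t + (1 / Suc n) * x) *
        (Suc n * sqrt (2 * pi) * exp (- (Suc n * (t - (t + (1 / Suc n) * x)))\<^sup>2 / 2)))"
      by (rule lborel_integral_real_affine) simp
    also have "\<dots> = (LBINT x. (1 / Suc n) *\<^sub>R (f (t + (1 / Suc n) * x) *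
        (Suc n * sqrt (2 * pi) * exp (- (Suc n * (t - (t + (1 / Suc n) * x)))\<^sup>2 / 2))))"
      by simp
    also have "\<dots> = (LBINT x. (2 * pi) * (std_normal_density x *\<^sub>R f (t + x / Suc n)))"
    proof (rule Bochner_Integration.integral_cong[OF refl])
      fix x
      have 1: "real (Suc n) * (t - (t + (1 / Suc n) * x)) = - x" by (simp add: field_simps del: of_nat_Suc)
      have 2: "sqrt (2 * pi) = 2 * pi * (1 / sqrt (2 * pi))"
        by (simp add: real_div_sqrt)
      have "(1 / Suc n) *\<^sub>R (f (t + (1 / Suc n) * x) * (Suc n * sqrt (2 * pi) * exp (- (- x)\<^sup>2 / 2)))
          = (sqrt (2 * pi) * exp (- x\<^sup>2 / 2)) *\<^sub>R f (t + x / Suc n)"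
        by (simp add: scaleR_conv_of_real field_simps del: of_nat_Suc)
      also have "\<dots> = (2 * pi) * (std_normal_density x *\<^sub>R f (t + x / Suc n))"
        by (subst 2) (simp add: std_normal_density_def scaleR_conv_of_real)
      finally show "(1 / Suc n) *\<^sub>R (f (t + (1 / Suc n) * x) *
        (Suc n * sqrt (2 * pi) * exp (- (Suc n * (t - (t + (1 / Suc n) * x)))\<^sup>2 / 2)))
        = (2 * pi) * (std_normal_density x *\<^sub>R f (t + x / Suc n))" unfolding 1 .
    qed
    also have "\<dots> = 2 * pi * (LBINT x. std_normal_density x *\<^sub>R f (t + x / Suc n))"
      by (rule integral_mult_right_zero)
    finally show ?thesis .
  qed
  have inv0: "(\<lambda>n. x / real (Suc n)) \<longlonglongrightarrow> 0" for x
    using LIMSEQ_inverse_real_of_nat[THEN tendsto_mult_left, of x] by (simp add: field_simps)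
  have "(\<lambda>n. LBINT s. \<gamma> n s * (ft f s * cis (s * t))) \<longlonglongrightarrow> (LBINT s. ft f s * cis (s * t))"
  proof (rule integral_dominated_convergence[where w = "\<lambda>s. cmod (ft f s)"])
    have [measurable]: "ft f \<in> borel_measurable borel" using F by auto
    show "(\<lambda>s. \<gamma> n s * (ft f s * cis (s * t))) \<in> borel_measurable lborel" for n by measurable
    show "(\<lambda>s. ft f s * cis (s * t)) \<in> borel_measurable lborel" by measurable
    show "integrable lborel (\<lambda>s. cmod (ft f s))" using F by (rule integrable_norm)
    show "AE s in lborel. norm (\<gamma> n s * (ft f s * cis (s * t))) \<le> cmod (ft f s)" for n
      using \<gamma>_le by (auto simp: norm_mult intro!: AE_I2 mult_left_le_one_le)
    have "(\<lambda>n. \<gamma> n s) \<longlonglongrightarrow> of_real (exp (- 0\<^sup>2 / 2))" for s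
      unfolding \<gamma>_def by (intro tendsto_intros inv0) auto
    then have "(\<lambda>n. \<gamma> n s * (ft f s * cis (s * t))) \<longlonglongrightarrow> 1 * (ft f s * cis (s * t))" for s
      by (intro tendsto_mult tendsto_const) simp
    then show "AE s in lborel. (\<lambda>n. \<gamma> n s * (ft f s * cis (s * t))) \<longlonglongrightarrow> ft f s * cis (s * t)" by simp
  qed
  moreover have "(\<lambda>n. LBINT x. std_normal_density x *\<^sub>R f (t + x / Suc n)) \<longlonglongrightarrow> (LBINT x. std_normal_density x *\<^sub>R f t)"
  proof (rule integral_dominated_convergence[where w = "\<lambda>x. C * std_normal_density x"])
    show "(\<lambda>x. std_normal_density x *\<^sub>R f (t + x / Suc n)) \<in> borel_measurable lborel" for n by measurable
    show "(\<lambda>x. std_normal_density x *\<^sub>R f t) \<in> borel_measurable lborel" by measurable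
    show "integrable lborel (\<lambda>x. C * std_normal_density x)" by (intro integrable_mult_right integrable_normal_density) simp
    show "AE x in lborel. norm (std_normal_density x *\<^sub>R f (t + x / Suc n)) \<le> C * std_normal_density x" for n
      using bdd by (intro AE_I2) (simp add: mult.commute[of C] mult_left_mono)
    have "(\<lambda>n. f (t + x / Suc n)) \<longlonglongrightarrow> f (t + 0)" for x
      using cont tendsto_add[OF tendsto_const inv0]
      by (intro isCont_tendsto_compose[of _ f]) (auto simp: continuous_on_eq_continuous_at)
    then show "AE x in lborel. (\<lambda>n. std_normal_density x *\<^sub>R f (t + x / Suc n)) \<longlonglongrightarrow> std_normal_density x *\<^sub>R f t"
      by (auto intro!: tendsto_scaleR)
  qed
  moreover have "(LBINT x. std_normal_density x *\<^sub>R f t) = f t"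
    using integral_normal_density[of 1 0] integrable_normal_density[of 1 0]
    by (subst integral_scaleR_left) auto
  ultimately have "(\<lambda>n. LBINT s. \<gamma> n s * (ft f s * cis (s * t))) \<longlonglongrightarrow> 2 * pi * f t"
    unfolding eq by (auto intro: tendsto_intros)
  then show ?thesis using \<open>(\<lambda>n. LBINT s. \<gamma> n s * (ft f s * cis (s * t))) \<longlonglongrightarrow> (LBINT s. ft f s * cis (s * t))\<close>
    using LIMSEQ_unique by blast
qed

text \<open>Two derivatives make the inverse transform decay like \<open>1 / t\<^sup>2\<close>. They
  are carried as explicit functions because the kernel estimate needs formulas and bounds for
  them.\<close>

definition C2_compact :: "(real \<Rightarrow> complex) \<Rightarrow> (real \<Rightarrow> complex) \<Rightarrow> (real \<Rightarrow> complex) \<Rightarrow> bool" where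
  "C2_compact p p' p'' \<longleftrightarrow>
     (\<forall>s. (p has_vector_derivative p' s) (at s)) \<and> (\<forall>s. (p' has_vector_derivative p'' s) (at s)) \<and>
     continuous_on UNIV p'' \<and> (\<exists>N. \<forall>s. \<bar>s\<bar> > N \<longrightarrow> p s = 0 \<and> p' s = 0 \<and> p'' s = 0)"

lemma C2_compactD:
  assumes "C2_compact p p' p''"
  shows "(p has_vector_derivative p' s) (at s)" "(p' has_vector_derivative p'' s) (at s)"
    "continuous_on UNIV p" "continuous_on UNIV p'" "continuous_on UNIV p''"
  using assms unfolding C2_compact_def
  by (auto simp: continuous_on_eq_continuous_at intro: has_vector_derivative_continuous)

lemma integrable_continuous_compact_support:
  fixes f :: "real \<Rightarrow> complex"
  assumes "continuous_on UNIV f" "\<And>s. \<bar>s\<bar> > N \<Longrightarrow> f s = 0"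
  shows "integrable lborel f" "\<exists>C. \<forall>s. cmod (f s) \<le> C"
proof -
  have "set_integrable lborel {-N..N} f"
    using assms(1) by (intro borel_integrable_atLeastAtMost') (auto intro: continuous_on_subset)
  moreover have "(\<lambda>x. indicator {-N..N} x *\<^sub>R f x) = f"
    using assms(2) by (auto simp: indicator_def fun_eq_iff)
  ultimately show "integrable lborel f" by (simp add: set_integrable_def)
  have "bounded (f ` {-N..N})"
    using assms(1) by (intro compact_imp_bounded compact_continuous_image) (auto intro: continuous_on_subset)
  then obtain C where "\<forall>y\<in>f ` {-N..N}. cmod y \<le> C" unfolding bounded_iff by blast
  then have "\<And>s. s \<in> {-N..N} \<Longrightarrow> cmod (f s) \<le> C" by blast
  then have *: "cmod (f s) \<le> max C 0" for s
  proof (cases "s \<in> {-N..N}")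
    case False
    then show ?thesis using assms(2)[of s] by auto
  qed (auto simp: le_max_iff_disj)
  from * show "\<exists>C. \<forall>s. cmod (f s) \<le> C" by blast
qed

lemma C2_compact_bounded:
  assumes p: "C2_compact p p' p''"
  shows "\<exists>C. \<forall>s. cmod (p s) \<le> C \<and> cmod (p' s) \<le> C \<and> cmod (p'' s) \<le> C"
proof -
  obtain N where "\<And>s. \<bar>s\<bar> > N \<Longrightarrow> p s = 0 \<and> p' s = 0 \<and> p'' s = 0"
    using p by (auto simp: C2_compact_def)
  then obtain C1 C2 C3 where "\<And>s. cmod (p s) \<le> C1" "\<And>s. cmod (p' s) \<le> C2" "\<And>s. cmod (p'' s) \<le> C3"
    using integrable_continuous_compact_support(2)[of _ N] C2_compactD(3-5)[OF p] by metis
  then show ?thesis by (intro exI[of _ "max C1 (max C2 C3)"]) (simp add: le_max_iff_disj)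
qed

lemma C2_compact_integrable:
  assumes p: "C2_compact p p' p''"
  shows "integrable lborel p" "integrable lborel p''"
  using p C2_compactD(3-5)[OF p] unfolding C2_compact_def
  by (auto intro: integrable_continuous_compact_support(1))

lemma C2_compact_fourier_by_parts:
  assumes p: "C2_compact p p' p''"
  shows "(LBINT s. p'' s * cis (s * t)) = - complex_of_real (t\<^sup>2) * (LBINT s. p s * cis (s * t))"
proof -
  obtain N where N: "\<And>s. \<bar>s\<bar> > N \<Longrightarrow> p s = 0 \<and> p' s = 0 \<and> p'' s = 0"
    using p by (auto simp: C2_compact_def)
  define m where "m = \<bar>N\<bar> + 1"
  have m: "m > 0" "m > N" by (auto simp: m_def)
  \<comment> \<open>With this antiderivative of
    \<open>(p'' s + t\<^sup>2 * p s) * cis (s * t)\<close> both integrations by parts take one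
    application of the fundamental theorem; the boundary terms vanish outside the support.\<close>
  define F where "F s = (p' s - \<i> * t * p s) * cis (s * t)" for s
  define f where "f s = (p'' s + t\<^sup>2 * p s) * cis (s * t)" for s
  have dcis: "((\<lambda>s. cis (s * t)) has_vector_derivative \<i> * t * cis (s * t)) (at s)" for s
    unfolding has_vector_derivative_def
    by (auto intro!: derivative_eq_intros simp: fun_eq_iff scaleR_conv_of_real)
  have deriv: "(F has_vector_derivative f s) (at s)" for s
  proof -
    have "(F has_vector_derivative (p' s - \<i> * t * p s) * (\<i> * t * cis (s * t)) + (p'' s - \<i> * t * p' s) * cis (s * t)) (at s)"
      unfolding F_def[abs_def]
      by (intro has_vector_derivative_mult has_vector_derivative_diff C2_compactD[OF p] dcis
          has_vector_derivative_mult_right)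
    also have "(p' s - \<i> * t * p s) * (\<i> * t * cis (s * t)) + (p'' s - \<i> * t * p' s) * cis (s * t) = f s"
      by (simp add: f_def algebra_simps power2_eq_square)
    finally show ?thesis .
  qed
  have cont: "continuous_on UNIV f" unfolding f_def[abs_def]
    by (intro continuous_intros C2_compactD[OF p])
  have "(LBINT s. indicator {-m..m} s *\<^sub>R f s) = F m - F (- m)"
    by (rule integral_FTC_atLeastAtMost)
       (use m deriv cont in \<open>auto intro: has_vector_derivative_at_within continuous_on_subset\<close>)
  also have "\<dots> = 0" using N[of m] N[of "- m"] m by (simp add: F_def)
  also have "(\<lambda>s. indicator {-m..m} s *\<^sub>R f s) = f"
    using N m by (auto simp: indicator_def fun_eq_iff f_def)
  finally have "(LBINT s. f s) = 0" .
  moreover have "(LBINT s. f s) = (LBINT s. p'' s * cis (s * t)) + t\<^sup>2 * (LBINT s. p s * cis (s * t))"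
  proof -
    have i1: "integrable lborel (\<lambda>s. p'' s * cis (s * t))" "integrable lborel (\<lambda>s. p s * cis (s * t))"
      using integrable_mult_cis(1)[OF C2_compact_integrable(2)[OF p], of t]
        integrable_mult_cis(1)[OF C2_compact_integrable(1)[OF p], of t] by (simp_all add: mult.commute)
    have "(LBINT s. f s) = (LBINT s. p'' s * cis (s * t) + t\<^sup>2 * (p s * cis (s * t)))"
      by (simp add: f_def algebra_simps)
    also have "\<dots> = (LBINT s. p'' s * cis (s * t)) + (LBINT s. t\<^sup>2 * (p s * cis (s * t)))"
      by (intro Bochner_Integration.integral_add i1 integrable_mult_right)
    finally show ?thesis by simp
  qed
  ultimately show ?thesis by (simp add: eq_neg_iff_add_eq_0)
qed

definition inv_ft :: "(real \<Rightarrow> complex) \<Rightarrow> real \<Rightarrow> complex" where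
  "inv_ft p t = (LBINT s. p s * cis (s * t)) / (2 * pi)"

lemma integrable_cauchy_density: "integrable lborel (\<lambda>t. c / (1 + t\<^sup>2) :: real)"
proof -
  have "integrable lborel (\<lambda>t::real. inverse (1 + t\<^sup>2))"
    using integrable_inverse_1_plus_square by (simp add: set_integrable_def)
  then have "integrable lborel (\<lambda>t::real. c * inverse (1 + t\<^sup>2))" by (rule integrable_mult_right)
  then show ?thesis by (simp add: divide_inverse)
qed

lemma continuous_fourier_integral:
  assumes "integrable lborel f"
  shows "continuous_on UNIV (\<lambda>t. LBINT s. f s * cis (s * t))"
proof -
  have fm[measurable]: "f \<in> borel_measurable borel" using assms by auto
  show ?thesis
    unfolding continuous_on_eq_continuous_at[OF open_UNIV]
  proof (intro ballI continuous_at_sequentiallyI)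
    fix t :: real and u :: "nat \<Rightarrow> real" assume u: "u \<longlonglongrightarrow> t"
    show "(\<lambda>n. LBINT s. f s * cis (s * u n)) \<longlonglongrightarrow> (LBINT s. f s * cis (s * t))"
    proof (rule integral_dominated_convergence[where w = "\<lambda>s. cmod (f s)"])
      show "AE s in lborel. (\<lambda>n. f s * cis (s * u n)) \<longlonglongrightarrow> f s * cis (s * t)"
        by (intro AE_I2 tendsto_intros u)
    qed (use assms in \<open>auto simp: norm_mult integrable_norm\<close>)
  qed
qed

text \<open>The transform of \<open>p\<close> is, up to the factor \<open>2 * pi\<close>, the
  reflection of \<open>inv_ft p\<close>. The decay of \<open>inv_ft p\<close> thus makes
  \<open>ft p\<close> integrable, \<open>fourier_inversion\<close> applies to \<open>p\<close>, and
  a reflection turns the result into a statement about \<open>inv_ft p\<close>.\<close>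

lemma C2_compact_inv_ft:
  assumes p: "C2_compact p p' p''"
  shows inv_ft_continuous: "continuous_on UNIV (inv_ft p)"
    and inv_ft_decay: "\<exists>c>0. \<forall>t. cmod (inv_ft p t) \<le> c / (1 + t\<^sup>2)"
    and inv_ft_integrable: "integrable lborel (inv_ft p)"
    and ft_inv_ft: "ft (inv_ft p) s = p s"
proof -
  show cont: "continuous_on UNIV (inv_ft p)"
    unfolding inv_ft_def[abs_def]
    by (intro continuous_on_divide continuous_fourier_integral C2_compact_integrable[OF p]) auto
  \<comment> \<open>Up to the factor \<open>2 * pi\<close>, the quantity
    \<open>(1 + t\<^sup>2) * cmod (inv_ft p t)\<close> is at most the sum of the L1 norms of
    \<open>p\<close> and \<open>p''\<close>; adding 1 makes \<open>c\<close> positive.\<close>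
  define c where "c = (LBINT s. cmod (p s)) + (LBINT s. cmod (p'' s)) + 1"
  have c: "c > 0" unfolding c_def by (intro add_nonneg_pos add_nonneg_nonneg integral_nonneg) auto
  have bound: "cmod (inv_ft p t) \<le> c / (1 + t\<^sup>2)" for t
  proof -
    have 1: "cmod (LBINT s. f s * cis (s * t)) \<le> (LBINT s. cmod (f s))" for f
      using integral_norm_bound[of lborel "\<lambda>s. f s * cis (s * t)"] by (simp add: norm_mult)
    have "2 * pi * cmod (inv_ft p t) * (1 + t\<^sup>2) =
        cmod (LBINT s. p s * cis (s * t)) + cmod (- complex_of_real (t\<^sup>2) * (LBINT s. p s * cis (s * t)))"
      by (simp add: inv_ft_def norm_divide norm_mult algebra_simps norm_power)
    also have "cmod (- complex_of_real (t\<^sup>2) * (LBINT s. p s * cis (s * t))) = cmod (LBINT s. p'' s * cis (s * t))"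
      by (simp only: C2_compact_fourier_by_parts[OF p])
    also have "cmod (LBINT s. p s * cis (s * t)) + cmod (LBINT s. p'' s * cis (s * t)) \<le> c"
      unfolding c_def using 1[of p] 1[of p''] by linarith
    finally have "cmod (inv_ft p t) * (1 + t\<^sup>2) \<le> c / (2 * pi)" by (simp add: field_simps)
    also have "\<dots> \<le> c / 1" using c pi_gt3 by (intro divide_left_mono) auto
    finally show ?thesis by (simp add: field_simps add_pos_nonneg)
  qed
  then show "\<exists>c>0. \<forall>t. cmod (inv_ft p t) \<le> c / (1 + t\<^sup>2)" using c by blast
  show int: "integrable lborel (inv_ft p)"
  proof (rule Bochner_Integration.integrable_bound[OF integrable_cauchy_density[of c]])
    show "inv_ft p \<in> borel_measurable lborel" using cont by (simp add: borel_measurable_continuous_onI)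
    show "AE t in lborel. cmod (inv_ft p t) \<le> norm (c / (1 + t\<^sup>2))"
      using bound c by (auto intro!: order_trans[OF bound])
  qed
  have ftp: "ft p t = 2 * pi * inv_ft p (- t)" for t by (simp add: ft_def inv_ft_def mult.commute)
  have refl: "(LBINT t. f (- t)) = (LBINT t. f t)" for f :: "real \<Rightarrow> complex"
    using lborel_integral_real_affine[of "-1" f 0] by simp
  obtain C where "\<And>s. cmod (p s) \<le> C" using C2_compact_bounded[OF p] by blast
  moreover have "integrable lborel (\<lambda>t. inv_ft p (- t))"
    using lborel_integrable_real_affine[OF int, of "-1" 0] by simp
  then have "integrable lborel (ft p)" unfolding ftp[abs_def] by (rule integrable_mult_right)
  ultimately have "(LBINT t. ft p t * cis (t * s)) = 2 * pi * p s"
    by (intro fourier_inversion C2_compactD[OF p] C2_compact_integrable[OF p])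
  also have "(LBINT t. ft p t * cis (t * s)) = (LBINT t. ft p (- t) * cis (- t * s))"
    using refl[of "\<lambda>t. ft p t * cis (t * s)"] by simp
  also have "\<dots> = (LBINT t. (2 * pi) * (inv_ft p t * cis (- (s * t))))"
    by (simp add: ftp mult_ac)
  also have "\<dots> = 2 * pi * ft (inv_ft p) s" unfolding ft_def by (rule integral_mult_right_zero)
  finally show "ft (inv_ft p) s = p s" by simp
qed

lemma C2_compact_sum:
  assumes "finite J" "\<And>j. j \<in> J \<Longrightarrow> C2_compact (p j) (p' j) (p'' j)"
  shows "C2_compact (\<lambda>s. \<Sum>j\<in>J. p j s) (\<lambda>s. \<Sum>j\<in>J. p' j s) (\<lambda>s. \<Sum>j\<in>J. p'' j s)"
proof -
  obtain N where N: "\<And>j s. j \<in> J \<Longrightarrow> \<bar>s\<bar> > N j \<Longrightarrow> p j s = 0 \<and> p' j s = 0 \<and> p'' j s = 0"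
    using assms(2) unfolding C2_compact_def by metis
  have "\<forall>s. \<bar>s\<bar> > (\<Sum>j\<in>J. \<bar>N j\<bar>) \<longrightarrow> (\<forall>j\<in>J. p j s = 0 \<and> p' j s = 0 \<and> p'' j s = 0)"
  proof (intro allI impI ballI)
    fix s j assume s: "(\<Sum>j\<in>J. \<bar>N j\<bar>) < \<bar>s\<bar>" and j: "j \<in> J"
    have "\<bar>N j\<bar> \<le> (\<Sum>j\<in>J. \<bar>N j\<bar>)" using j assms(1) by (intro member_le_sum) auto
    then show "p j s = 0 \<and> p' j s = 0 \<and> p'' j s = 0" using N[OF j, of s] s by linarith
  qed
  then show ?thesis
    using assms(2) unfolding C2_compact_def
    by (auto intro!: has_vector_derivative_sum continuous_on_sum exI[of _ "\<Sum>j\<in>J. \<bar>N j\<bar>"])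
qed

subsection \<open>Cubic B-splines\<close>

definition trunc_power :: "nat \<Rightarrow> real \<Rightarrow> real" where
  "trunc_power n x = max 0 x ^ n"

text \<open>The exponent starts at 2 because \<open>max 0 x\<close> has a corner at 0. At that point
  the difference quotient is \<open>max 0 h ^ Suc n\<close>, which tends to 0.\<close>

lemma has_real_derivative_trunc_power:
  "(trunc_power (Suc (Suc n)) has_real_derivative Suc (Suc n) * trunc_power (Suc n) x) (at x)"
proof (cases x "0::real" rule: linorder_cases)
  case less
  have "((\<lambda>x::real. 0) has_real_derivative Suc (Suc n) * trunc_power (Suc n) x) (at x)"
    using less by (auto simp: trunc_power_def)
  then show ?thesis
    by (rule DERIV_cong_ev[OF refl _ refl, THEN iffD1, rotated])
       (use eventually_nhds_in_open[of "{..<0}" x] less in \<open>auto elim!: eventually_mono simp: trunc_power_def\<close>)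
next
  case equal
  have "((\<lambda>h. max 0 h ^ Suc n) \<longlongrightarrow> (max 0 0 :: real) ^ Suc n) (at 0)"
    by (intro tendsto_intros)
  moreover have "max 0 h ^ Suc n = (trunc_power (Suc (Suc n)) (0 + h) - trunc_power (Suc (Suc n)) 0) / h"
    if "h \<noteq> 0" for h :: real
    using that by (auto simp: trunc_power_def max_def)
  ultimately have "((\<lambda>h. (trunc_power (Suc (Suc n)) (0 + h) - trunc_power (Suc (Suc n)) 0) / h) \<longlongrightarrow> 0) (at 0)"
    by (auto intro: Lim_transform_eventually simp: eventually_at_filter)
  then show ?thesis using equal by (simp add: DERIV_def trunc_power_def)
next
  case greater
  have "((\<lambda>x. x ^ Suc (Suc n)) has_real_derivative Suc (Suc n) * x ^ Suc n) (at x)"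
    using DERIV_pow[of "Suc (Suc n)" x] by simp
  also have "Suc (Suc n) * x ^ Suc n = Suc (Suc n) * trunc_power (Suc n) x"
    using greater by (simp add: trunc_power_def)
  finally show ?thesis
    by (rule DERIV_cong_ev[OF refl _ refl, THEN iffD1, rotated])
       (use eventually_nhds_in_open[of "{0<..}" x] greater in \<open>auto elim!: eventually_mono simp: trunc_power_def\<close>)
qed

text \<open>The third difference of \<open>x\<^sup>3 / 6\<close> is 1, so this is a transition from 0 to 1 on \<open>[0, 3]\<close>.\<close>

definition spline_step :: "nat \<Rightarrow> real \<Rightarrow> real" where
  "spline_step n x = (trunc_power n x - 3 * trunc_power n (x - 1) + 3 * trunc_power n (x - 2)
     - trunc_power n (x - 3)) / fact n"

lemma spline_step_deriv:
  "n = 2 \<or> n = 3 \<Longrightarrow> (spline_step n has_real_derivative spline_step (n - 1) x) (at x)"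
proof -
  have *: "((\<lambda>x. trunc_power (Suc (Suc k)) (x - c)) has_real_derivative Suc (Suc k) * trunc_power (Suc k) (x - c)) (at x)" for k c
    using DERIV_shift[of "trunc_power (Suc (Suc k))" _ x "- c"] has_real_derivative_trunc_power[of k "x - c"] by simp
  have **: "(spline_step (Suc (Suc k)) has_real_derivative spline_step (Suc k) x) (at x)" for k
  proof -
    have 1: "(spline_step (Suc (Suc k)) has_real_derivative
       (Suc (Suc k) * trunc_power (Suc k) x - 3 * (Suc (Suc k) * trunc_power (Suc k) (x - 1))
        + 3 * (Suc (Suc k) * trunc_power (Suc k) (x - 2)) - Suc (Suc k) * trunc_power (Suc k) (x - 3)) / fact (Suc (Suc k))) (at x)"
      unfolding spline_step_def[abs_def]
      by (intro DERIV_cdivide DERIV_diff DERIV_add DERIV_cmult * has_real_derivative_trunc_power)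
    have f: "fact (Suc (Suc k)) = real (Suc (Suc k)) * fact (Suc k)" by simp
    have "(Suc (Suc k) * trunc_power (Suc k) x - 3 * (Suc (Suc k) * trunc_power (Suc k) (x - 1))
        + 3 * (Suc (Suc k) * trunc_power (Suc k) (x - 2)) - Suc (Suc k) * trunc_power (Suc k) (x - 3)) / fact (Suc (Suc k))
       = (Suc (Suc k) * (trunc_power (Suc k) x - 3 * trunc_power (Suc k) (x - 1)
        + 3 * trunc_power (Suc k) (x - 2) - trunc_power (Suc k) (x - 3))) / (real (Suc (Suc k)) * fact (Suc k))"
      unfolding f by (simp add: algebra_simps del: of_nat_Suc fact_Suc)
    also have "\<dots> = spline_step (Suc k) x"
      unfolding spline_step_def by (rule mult_divide_mult_cancel_left) simp
    finally show ?thesis using 1 by simp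
  qed
  assume "n = 2 \<or> n = 3"
  then show ?thesis using **[of 0] **[of 1] by (auto simp: numeral_2_eq_2 numeral_3_eq_3)
qed

lemma spline_step_values:
  "n > 0 \<Longrightarrow> x \<le> 0 \<Longrightarrow> spline_step n x = 0"
  "x \<ge> 3 \<Longrightarrow> spline_step 3 x = 1" "x \<ge> 3 \<Longrightarrow> spline_step 2 x = 0" "x \<ge> 3 \<Longrightarrow> spline_step 1 x = 0"
  by (auto simp: spline_step_def trunc_power_def fact_numeral power2_eq_square power3_eq_cube field_simps)

lemma continuous_spline_step: "continuous_on UNIV (spline_step n)"
  unfolding spline_step_def[abs_def] trunc_power_def by (intro continuous_intros) auto

text \<open>For a < b the function with index 3 rises over \<open>[h * a, h * (a + 3)]\<close> and
  is brought back to 0 by the step over \<open>[h * b, h * (b + 3)]\<close>. The index counts down: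
  2 and 1 give the first and second derivative, whence the chain-rule factor
  \<open>h ^ (3 - n)\<close>.\<close>

definition spline_bump :: "real \<Rightarrow> real \<Rightarrow> real \<Rightarrow> nat \<Rightarrow> real \<Rightarrow> complex" where
  "spline_bump h a b n s = of_real ((spline_step n (s / h - a) - spline_step n (s / h - b)) / h ^ (3 - n))"

lemma C2_compact_spline_bump:
  assumes h: "h > 0"
  shows "C2_compact (spline_bump h a b 3) (spline_bump h a b 2) (spline_bump h a b 1)"
proof -
  have d: "(spline_bump h a b n has_vector_derivative spline_bump h a b (n - 1) s) (at s)" if n: "n = 2 \<or> n = 3" for n s
  proof -
    have 1: "((\<lambda>s. spline_step n (s / h - c)) has_real_derivative spline_step (n - 1) (s / h - c) * (1 / h)) (at s)" for c
      by (rule DERIV_chain2[OF spline_step_deriv[OF n]]) (use h in \<open>auto intro!: derivative_eq_intros\<close>)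
    have "((\<lambda>s. (spline_step n (s / h - a) - spline_step n (s / h - b)) / h ^ (3 - n)) has_real_derivative
        (spline_step (n - 1) (s / h - a) * (1 / h) - spline_step (n - 1) (s / h - b) * (1 / h)) / h ^ (3 - n)) (at s)"
      by (intro DERIV_cdivide DERIV_diff 1)
    moreover have "3 - (n - 1) = Suc (3 - n)" using n by auto
    then have "(spline_step (n - 1) (s / h - a) * (1 / h) - spline_step (n - 1) (s / h - b) * (1 / h)) / h ^ (3 - n)
       = (spline_step (n - 1) (s / h - a) - spline_step (n - 1) (s / h - b)) / h ^ (3 - (n - 1))"
      by (simp add: diff_divide_distrib)
    ultimately have "((\<lambda>s. (spline_step n (s / h - a) - spline_step n (s / h - b)) / h ^ (3 - n)) has_real_derivative
        (spline_step (n - 1) (s / h - a) - spline_step (n - 1) (s / h - b)) / h ^ (3 - (n - 1))) (at s)"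
      by simp
    then show ?thesis unfolding spline_bump_def[abs_def] by (rule has_vector_derivative_of_real)
  qed
  have "spline_bump h a b n s = 0" if s: "\<bar>s\<bar> > h * (\<bar>a\<bar> + \<bar>b\<bar> + 3)" and n: "n = 1 \<or> n = 2 \<or> n = 3" for n s
  proof -
    have "s / h > \<bar>a\<bar> + \<bar>b\<bar> + 3 \<or> s / h < - (\<bar>a\<bar> + \<bar>b\<bar> + 3)"
      using s h by (auto simp: abs_if field_simps split: if_splits)
    then have "(s / h - a \<ge> 3 \<and> s / h - b \<ge> 3) \<or> (s / h - a \<le> 0 \<and> s / h - b \<le> 0)" by linarith
    then show ?thesis using n by (auto simp: spline_bump_def spline_step_values simp del: One_nat_def)
  qed
  moreover have "continuous_on UNIV (spline_bump h a b 1)"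
    unfolding spline_bump_def[abs_def]
    by (intro continuous_intros continuous_on_compose2[OF continuous_spline_step]) (use h in auto)
  ultimately show ?thesis
    unfolding C2_compact_def using d[of 3] d[of 2]
    by (auto intro!: exI[of _ "h * (\<bar>a\<bar> + \<bar>b\<bar> + 3)"])
qed

subsection \<open>Vanishing convolutions\<close>

lemma integrable_mult_bounded:
  fixes f g :: "real \<Rightarrow> complex"
  assumes f: "integrable lborel f" and [measurable]: "g \<in> borel_measurable borel"
    and g: "\<And>x. cmod (g x) \<le> C"
  shows "integrable lborel (\<lambda>x. f x * g x)" "cmod (LBINT x. f x * g x) \<le> C * (LBINT x. cmod (f x))"
proof -
  have [measurable]: "f \<in> borel_measurable borel" using f by auto
  have le: "cmod (f x * g x) \<le> C * cmod (f x)" for x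
    using g[of x] by (simp add: norm_mult mult.commute[of C] mult_left_mono)
  have i: "integrable lborel (\<lambda>x. C * cmod (f x))" using f by auto
  show int: "integrable lborel (\<lambda>x. f x * g x)"
    by (rule Bochner_Integration.integrable_bound[OF i]) (auto intro!: AE_I2 order_trans[OF le])
  have "cmod (LBINT x. f x * g x) \<le> (LBINT x. cmod (f x * g x))" by (rule integral_norm_bound)
  also have "\<dots> \<le> (LBINT x. C * cmod (f x))"
    using int i le by (intro integral_mono integrable_norm) auto
  finally show "cmod (LBINT x. f x * g x) \<le> C * (LBINT x. cmod (f x))" by simp
qed

lemma lborel_integral_reflect:
  fixes f :: "real \<Rightarrow> 'a::{banach, second_countable_topology}"
  shows "(LBINT s. f (t - s)) = (LBINT s. f s)"
  using lborel_integral_real_affine[of "-1" f t] by simp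

lemma lborel_integrable_reflect:
  fixes f :: "real \<Rightarrow> 'a::{banach, second_countable_topology}"
  assumes "integrable lborel f"
  shows "integrable lborel (\<lambda>s. f (t - s))"
  using lborel_integrable_real_affine[OF assms, of "-1" t] by simp

text \<open>With a = -4 and b = 1 the transform rises on [-4, -1], falls on [1, 4] and equals 1 on
  [-1, 1]: a kernel of de la Vallee Poussin type.\<close>

definition plateau :: "real \<Rightarrow> complex" where
  "plateau = inv_ft (spline_bump 1 (-4) 1 3)"

lemma plateau:
  shows plateau_continuous: "continuous_on UNIV plateau"
    and plateau_decay: "\<exists>c>0. \<forall>t. cmod (plateau t) \<le> c / (1 + t\<^sup>2)"
    and plateau_integrable: "integrable lborel plateau"
    and ft_plateau: "\<bar>s\<bar> \<le> 1 \<Longrightarrow> ft plateau s = 1"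
proof -
  note C2 = C2_compact_spline_bump[of 1 "-4" 1]
  show "continuous_on UNIV plateau" "\<exists>c>0. \<forall>t. cmod (plateau t) \<le> c / (1 + t\<^sup>2)"
     "integrable lborel plateau"
    unfolding plateau_def using C2_compact_inv_ft[OF C2] by auto
  assume "\<bar>s\<bar> \<le> 1"
  then show "ft plateau s = 1" unfolding plateau_def ft_inv_ft[OF C2, simplified]
    by (simp add: spline_bump_def spline_step_values abs_le_iff)
qed

definition translation_modulus :: "real \<Rightarrow> real" where
  "translation_modulus h = (LBINT x. cmod (plateau x - plateau (x - h)))"

lemma measurable_plateau [measurable]: "plateau \<in> borel_measurable borel"
  using plateau_continuous by (rule borel_measurable_continuous_onI)

lemma plateau_shift_integrable: "integrable lborel (\<lambda>x. plateau (x - h))"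
  using lborel_integrable_real_affine[OF plateau_integrable, of 1 "- h"] by simp

lemma translation_modulus:
  shows translation_modulus_measurable [measurable]: "translation_modulus \<in> borel_measurable borel"
    and translation_modulus_nonneg: "0 \<le> translation_modulus h"
    and translation_modulus_bounded: "translation_modulus h \<le> 2 * (LBINT x. cmod (plateau x))"
    and translation_modulus_tendsto: "u \<longlonglongrightarrow> 0 \<Longrightarrow> (\<lambda>n. translation_modulus (u n)) \<longlonglongrightarrow> 0"
proof -
  show "translation_modulus \<in> borel_measurable borel"
    unfolding translation_modulus_def[abs_def] by measurable
  show "0 \<le> translation_modulus h" unfolding translation_modulus_def by (rule Bochner_Integration.integral_nonneg) simp
  have shift: "(LBINT x. cmod (plateau (x - h))) = (LBINT x. cmod (plateau x))"
    using lborel_integral_real_affine[of 1 "\<lambda>x. cmod (plateau x)" "- h"] by simp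
  have "translation_modulus h \<le> (LBINT x. cmod (plateau x) + cmod (plateau (x - h)))"
    unfolding translation_modulus_def
    by (intro integral_mono integrable_norm Bochner_Integration.integrable_diff Bochner_Integration.integrable_add
        plateau_integrable plateau_shift_integrable norm_triangle_ineq4)
  also have "\<dots> = 2 * (LBINT x. cmod (plateau x))"
    using shift by (subst Bochner_Integration.integral_add)
      (auto intro: integrable_norm plateau_integrable plateau_shift_integrable)
  finally show "translation_modulus h \<le> 2 * (LBINT x. cmod (plateau x))" .
  assume u: "u \<longlonglongrightarrow> 0"
  obtain c where c: "c > 0" "\<And>t. cmod (plateau t) \<le> c / (1 + t\<^sup>2)" using plateau_decay by blast
  obtain N where N: "\<And>n. n \<ge> N \<Longrightarrow> \<bar>u n\<bar> < 1"
    using LIMSEQ_D[OF u, of 1] by auto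
  have "(\<lambda>n. translation_modulus (u (n + N))) \<longlonglongrightarrow> (LBINT x::real. 0)"
    unfolding translation_modulus_def
  proof (rule integral_dominated_convergence[where w = "\<lambda>x. 4 * c / (1 + x\<^sup>2)"])
    show "integrable lborel (\<lambda>x. 4 * c / (1 + x\<^sup>2))" by (rule integrable_cauchy_density)
    show "AE x in lborel. (\<lambda>n. cmod (plateau x - plateau (x - u (n + N)))) \<longlonglongrightarrow> 0"
    proof (intro AE_I2)
      fix x
      have "(\<lambda>n. x - u (n + N)) \<longlonglongrightarrow> x - 0"
        by (intro tendsto_diff tendsto_const LIMSEQ_ignore_initial_segment u)
      then have "(\<lambda>n. plateau (x - u (n + N))) \<longlonglongrightarrow> plateau x"
        using plateau_continuous
        by (intro isCont_tendsto_compose[of _ plateau]) (auto simp: continuous_on_eq_continuous_at)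
      then have "(\<lambda>n. cmod (plateau x - plateau (x - u (n + N)))) \<longlonglongrightarrow> cmod (plateau x - plateau x)"
        by (intro tendsto_intros)
      then show "(\<lambda>n. cmod (plateau x - plateau (x - u (n + N)))) \<longlonglongrightarrow> 0" by simp
    qed
    show "AE x in lborel. norm (cmod (plateau x - plateau (x - u (n + N)))) \<le> 4 * c / (1 + x\<^sup>2)" for n
    proof (intro AE_I2)
      fix x
      define v where "v = u (n + N)"
      have "\<bar>v\<bar> < 1" using N[of "n + N"] by (simp add: v_def)
      then have v: "v\<^sup>2 \<le> 1" by (simp add: abs_square_le_1)
      \<comment> \<open>The two squares add up to \<open>2 x^2 - 6 x v + 5 v^2\<close>, which
        together with \<open>v^2 \<le> 1\<close> gives the comparison. A shift by at most 1 thus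
        costs a factor 3, and the dominating constant is \<open>4 c = c + 3 c\<close>.\<close>
      have "0 \<le> (x - 2 * v)\<^sup>2" "0 \<le> (x - v)\<^sup>2" by simp_all
      then have "1 + x\<^sup>2 \<le> 3 * (1 + (x - v)\<^sup>2)"
        using v by (simp add: power2_eq_square algebra_simps)
      then have "c / (1 + (x - v)\<^sup>2) \<le> 3 * c / (1 + x\<^sup>2)"
        using c(1) by (simp add: divide_simps add_pos_nonneg not_sum_power2_lt_zero)
      moreover have "cmod (plateau x - plateau (x - v)) \<le> c / (1 + x\<^sup>2) + c / (1 + (x - v)\<^sup>2)"
        using norm_triangle_ineq4[of "plateau x" "plateau (x - v)"] c(2)[of x] c(2)[of "x - v"] by linarith
      moreover have "4 * c / (1 + x\<^sup>2) = c / (1 + x\<^sup>2) + 3 * c / (1 + x\<^sup>2)"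
        by (simp add: add_divide_distrib[symmetric])
      ultimately show "norm (cmod (plateau x - plateau (x - u (n + N)))) \<le> 4 * c / (1 + x\<^sup>2)"
        unfolding v_def by simp
    qed
  qed measurable
  then have "(\<lambda>n. translation_modulus (u (n + N))) \<longlonglongrightarrow> 0" by simp
  then show "(\<lambda>n. translation_modulus (u n)) \<longlonglongrightarrow> 0" by (rule LIMSEQ_offset)
qed

text \<open>
  A band-limited bounded function \<open>y\<close> with spectrum in a small neighbourhood of \<open>w\<close> is reproduced by a
  wide approximate unit, hence \<open>y(t) e\<^sup>-\<^sup>i\<^sup>w\<^sup>t\<close> varies slowly; if moreover \<open>y * f = 0\<close> with
  \<open>f\<close> having non-zero Fourier transform at \<open>w\<close>, then \<open>sup |y| \<le> sup |y| / 2\<close>.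
\<close>

theorem convolution_vanishes_near:
  fixes f :: "real \<Rightarrow> complex"
  assumes f: "integrable lborel f" and fw: "ft f w \<noteq> 0"
  obtains r where "r > 0"
    "\<And>\<phi> C p p' p'' t. \<phi> \<in> borel_measurable borel \<Longrightarrow> (\<And>t. cmod (\<phi> t) \<le> C) \<Longrightarrow>
       (\<And>t. (LBINT s. f s * \<phi> (t - s)) = 0) \<Longrightarrow> C2_compact p p' p'' \<Longrightarrow>
       (\<And>s. p s \<noteq> 0 \<Longrightarrow> \<bar>s - w\<bar> \<le> r) \<Longrightarrow> (LBINT s. inv_ft p s * \<phi> (t - s)) = 0"
proof -
  have fm[measurable]: "f \<in> borel_measurable borel" using f by auto
  define T where "T = 2 * (LBINT x. cmod (plateau x))"
  have T: "translation_modulus h \<le> T" for h unfolding T_def by (rule translation_modulus_bounded)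
  have Tpos: "T \<ge> 0" using translation_modulus_nonneg[of 0] T[of 0] by linarith
  have \<kappa>_int: "integrable lborel (\<lambda>r. translation_modulus (l * r) * cmod (f r))" for l
  proof (rule Bochner_Integration.integrable_bound[where f = "\<lambda>r. T * cmod (f r)"])
    show "integrable lborel (\<lambda>r. T * cmod (f r))" using f by auto
    show "AE r in lborel. norm (translation_modulus (l * r) * cmod (f r)) \<le> norm (T * cmod (f r))"
      using T translation_modulus_nonneg Tpos by (intro AE_I2) (simp add: abs_mult mult_right_mono)
  qed measurable
  have "(\<lambda>n. LBINT r. translation_modulus (inverse (Suc n) * r) * cmod (f r)) \<longlonglongrightarrow> (LBINT r::real. 0)"
  proof (rule integral_dominated_convergence[where w = "\<lambda>r. T * cmod (f r)"])
    show "integrable lborel (\<lambda>r. T * cmod (f r))" using f by auto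
    show "AE r in lborel. norm (translation_modulus (inverse (Suc n) * r) * cmod (f r)) \<le> T * cmod (f r)" for n
      using T translation_modulus_nonneg by (intro AE_I2) (simp add: abs_mult mult_right_mono)
    show "AE r in lborel. (\<lambda>n. translation_modulus (inverse (Suc n) * r) * cmod (f r)) \<longlonglongrightarrow> 0"
    proof (intro AE_I2)
      fix r
      have "(\<lambda>n. inverse (real (Suc n)) * r) \<longlonglongrightarrow> 0 * r"
        by (intro tendsto_mult LIMSEQ_inverse_real_of_nat tendsto_const)
      then have "(\<lambda>n. translation_modulus (inverse (Suc n) * r) * cmod (f r)) \<longlonglongrightarrow> 0 * cmod (f r)"
        by (intro tendsto_mult tendsto_const translation_modulus_tendsto) simp
      then show "(\<lambda>n. translation_modulus (inverse (Suc n) * r) * cmod (f r)) \<longlonglongrightarrow> 0" by simp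
    qed
  qed measurable
  then have "\<forall>\<^sub>F n in sequentially. (LBINT r. translation_modulus (inverse (Suc n) * r) * cmod (f r)) < cmod (ft f w) / 2"
    using fw by (intro order_tendstoD(2)) auto
  then obtain n where n: "(LBINT r. translation_modulus (inverse (Suc n) * r) * cmod (f r)) < cmod (ft f w) / 2"
    by (auto simp: eventually_sequentially)
  \<comment> \<open>The scale \<open>l\<close> at which the weighted modulus is below half of
    \<open>cmod (ft f w)\<close> is also the radius returned. It depends on \<open>f\<close> and
    \<open>w\<close> alone and so serves every bounded function annihilated by
    \<open>f\<close>.\<close>
  define l where "l = inverse (real (Suc n))"
  have l: "l > 0" by (simp add: l_def)
  have \<kappa>: "(LBINT r. translation_modulus (l * r) * cmod (f r)) \<le> cmod (ft f w) / 2"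
    using n by (simp add: l_def)
  show thesis
  proof (rule that[OF l])
    fix \<phi> :: "real \<Rightarrow> complex" and C p p' p'' t
    assume \<phi>[measurable]: "\<phi> \<in> borel_measurable borel" and C: "\<And>t. cmod (\<phi> t) \<le> C"
      and zero: "\<And>t. (LBINT s. f s * \<phi> (t - s)) = 0" and p: "C2_compact p p' p''"
      and supp: "\<And>s. p s \<noteq> 0 \<Longrightarrow> \<bar>s - w\<bar> \<le> l"
    define W where "W = inv_ft p"
    have Wint: "integrable lborel W" unfolding W_def by (rule inv_ft_integrable[OF p])
    then have [measurable]: "W \<in> borel_measurable borel" by auto
    have pint: "integrable lborel p" by (rule C2_compact_integrable[OF p])
    then have [measurable]: "p \<in> borel_measurable borel" by auto
    have C0: "C \<ge> 0" using C[of 0] norm_ge_zero[of "\<phi> 0"] by linarith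
    define y where "y t = (LBINT s. W s * \<phi> (t - s))" for t
    have [measurable]: "y \<in> borel_measurable borel" unfolding y_def[abs_def] by measurable
    define S where "S = C * (LBINT s. cmod (W s))"
    have yS: "cmod (y t) \<le> S" for t
      unfolding y_def S_def by (rule integrable_mult_bounded(2)[OF Wint]) (use C in auto)
    have y': "y t = (LBINT q. W (t - q) * \<phi> q)" for t
      unfolding y_def using lborel_integral_reflect[of "\<lambda>s. W s * \<phi> (t - s)" t] by simp
    have fy: "(LBINT r. f r * y (t - r)) = 0" for t
    proof -
      have "(LBINT r. f r * y (t - r)) = (LBINT r. LBINT s. f r * (W s * \<phi> (t - r - s)))"
        unfolding y_def by simp
      also have "\<dots> = (LBINT s. LBINT r. f r * (W s * \<phi> (t - r - s)))"
      proof (rule fubini_bound_swap[where g = "\<lambda>r. C * cmod (f r)" and k = "\<lambda>s. cmod (W s)" and c = 0])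
        show "cmod (f r * (W s * \<phi> (t - r - s))) \<le> C * cmod (f r) * cmod (W (s + 0 * r))" for r s
          using mult_left_mono[OF C[of "t - r - s"], of "cmod (f r) * cmod (W s)"]
          by (simp add: norm_mult mult_ac)
      qed (use f Wint in auto)
      also have "\<dots> = (LBINT s. W s * (LBINT r. f r * \<phi> (t - s - r)))"
        by (simp add: algebra_simps flip: integral_mult_right_zero)
      finally show ?thesis by (simp add: zero)
    qed
    \<comment> \<open>A dilated and modulated plateau: \<open>ft V s\<close> is
      \<open>ft plateau\<close> at \<open>(s - w) / l\<close>, hence 1 wherever \<open>p\<close> is
      non-zero, so that convolution with \<open>V\<close> reproduces \<open>W\<close> and
      \<open>y\<close>.\<close>
    define V where "V r = l * plateau (l * r) * cis (w * r)" for r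
    have Vint: "integrable lborel V"
      unfolding V_def[abs_def] using lborel_integrable_real_affine[OF plateau_integrable, of l 0] l
      by (intro integrable_mult_cis integrable_mult_right) simp
    then have [measurable]: "V \<in> borel_measurable borel" by auto
    have ftV: "ft V s = 1" if "\<bar>s - w\<bar> \<le> l" for s
    proof -
      have lr: "((s - w) / l) * (0 + l * r) = (s - w) * r" for r using l by simp
      have "ft V s = (LBINT r. l *\<^sub>R (plateau (0 + l * r) * cis (- (((s - w) / l) * (0 + l * r)))))"
        unfolding ft_def V_def lr
        by (rule Bochner_Integration.integral_cong)
           (simp_all add: scaleR_conv_of_real cis_mult algebra_simps)
      also have "\<dots> = \<bar>l\<bar> *\<^sub>R (LBINT r. plateau (0 + l * r) * cis (- (((s - w) / l) * (0 + l * r))))"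
        using l by simp
      also have "\<dots> = (LBINT x. plateau x * cis (- (((s - w) / l) * x)))"
        by (rule lborel_integral_real_affine[symmetric]) (use l in simp)
      also have "\<dots> = 1" unfolding ft_def[symmetric] using that l by (intro ft_plateau) (simp add: abs_divide)
      finally show ?thesis .
    qed
    have VW: "(LBINT r. V r * W (t - r)) = W t" for t
    proof -
      have "(LBINT r. V r * W (t - r)) = (LBINT r. LBINT s. V r * (p s * cis (s * (t - r)))) / (2 * pi)"
        unfolding W_def inv_ft_def by simp
      also have "(LBINT r. LBINT s. V r * (p s * cis (s * (t - r)))) = (LBINT s. LBINT r. V r * (p s * cis (s * (t - r))))"
        by (rule fubini_bound_swap[where g = "\<lambda>r. cmod (V r)" and k = "\<lambda>s. cmod (p s)" and c = 0])
           (use Vint pint in \<open>auto simp: norm_mult\<close>)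
      also have "\<dots> = (LBINT s. (p s * cis (s * t)) * ft V s)"
      proof (rule Bochner_Integration.integral_cong[OF refl])
        fix s
        have "cis (s * (t - r)) = cis (s * t) * cis (- (s * r))" for r
          by (simp add: cis_mult algebra_simps)
        then have "(LBINT r. V r * (p s * cis (s * (t - r)))) = (LBINT r. (p s * cis (s * t)) * (V r * cis (- (s * r))))"
          by (intro Bochner_Integration.integral_cong refl) simp
        then show "(LBINT r. V r * (p s * cis (s * (t - r)))) = (p s * cis (s * t)) * ft V s"
          unfolding ft_def integral_mult_right_zero .
      qed
      also have "\<dots> = (LBINT s. p s * cis (s * t))"
      proof (intro Bochner_Integration.integral_cong refl)
        show "(p s * cis (s * t)) * ft V s = p s * cis (s * t)" for s
          using supp[of s] ftV[of s] by (cases "p s = 0") auto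
      qed
      finally show ?thesis by (simp add: W_def inv_ft_def)
    qed
    have Vy: "(LBINT r. V r * y (t - r)) = y t" for t
    proof -
      have "(LBINT r. V r * y (t - r)) = (LBINT r. LBINT q. V r * (W (t - r - q) * \<phi> q))"
        unfolding y' by simp
      also have "\<dots> = (LBINT q. LBINT r. V r * (W (t - r - q) * \<phi> q))"
      proof (rule fubini_bound_swap[where g = "\<lambda>r. C * cmod (V r)" and k = "\<lambda>z. cmod (W (t - z))" and c = 1])
        show "integrable lborel (\<lambda>z. cmod (W (t - z)))" using Wint by (intro integrable_norm lborel_integrable_reflect)
        show "cmod (V r * (W (t - r - q) * \<phi> q)) \<le> C * cmod (V r) * cmod (W (t - (q + 1 * r)))" for r q
          using mult_left_mono[OF C[of q], of "cmod (V r) * cmod (W (t - r - q))"]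
          by (simp add: norm_mult algebra_simps)
      qed (use Vint in auto)
      also have "\<dots> = (LBINT q. \<phi> q * (LBINT r. V r * W (t - q - r)))"
        by (simp add: algebra_simps flip: integral_mult_right_zero)
      also have "\<dots> = y t" unfolding VW y' by (simp add: mult.commute)
      finally show ?thesis .
    qed
    \<comment> \<open>Removing the carrier frequency \<open>w\<close> leaves a function reproduced
      by the wide kernel \<open>l * plateau (l * x)\<close>. A translation by \<open>h\<close>
      therefore changes it by at most its bound times
      \<open>translation_modulus (l * h)\<close>.\<close>
    define z where "z t = y t * cis (- (w * t))" for t
    have [measurable]: "z \<in> borel_measurable borel" unfolding z_def[abs_def] by measurable
    have zy: "cmod (z t) = cmod (y t)" for t by (simp add: z_def norm_mult)
    have z_eq: "z t = (LBINT q. (l * plateau (l * (t - q))) * z q)" for t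
    proof -
      have "z t = (LBINT r. (V r * y (t - r)) * cis (- (w * t)))"
        unfolding z_def by (simp add: Vy)
      also have "\<dots> = (LBINT r. l * plateau (l * r) * z (t - r))"
        unfolding z_def V_def
        by (intro Bochner_Integration.integral_cong refl) (simp add: cis_mult algebra_simps)
      also have "\<dots> = (LBINT q. (l * plateau (l * (t - q))) * z q)"
        using lborel_integral_reflect[of "\<lambda>r. l * plateau (l * r) * z (t - r)" t] by simp
      finally show ?thesis .
    qed
    have halve: "\<forall>t. cmod (z t) \<le> B / 2" if B: "\<forall>t. cmod (z t) \<le> B" for B
    proof
      fix t
      have kint: "integrable lborel (\<lambda>q. l * plateau (l * (t - q)))" for t
        using lborel_integrable_real_affine[OF plateau_integrable, of "- l" "l * t"] l
        by (intro integrable_mult_right) (simp add: algebra_simps)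
      have diff: "cmod (z t - z (t - h)) \<le> B * translation_modulus (l * h)" for t h
      proof -
        have "z t - z (t - h) = (LBINT q. (l * plateau (l * (t - q))) * z q - (l * plateau (l * (t - h - q))) * z q)"
          unfolding z_eq[of t] z_eq[of "t - h"] using B
          by (intro Bochner_Integration.integral_diff[symmetric] integrable_mult_bounded[OF kint]) auto
        also have "\<dots> = (LBINT q. (l * plateau (l * (t - q)) - l * plateau (l * (t - h - q))) * z q)"
          by (simp add: left_diff_distrib)
        also have "cmod \<dots> \<le> B * (LBINT q. cmod (l * plateau (l * (t - q)) - l * plateau (l * (t - h - q))))"
          using B by (intro integrable_mult_bounded(2) Bochner_Integration.integrable_diff kint) auto
        also have "(LBINT q. cmod (l * plateau (l * (t - q)) - l * plateau (l * (t - h - q)))) = translation_modulus (l * h)"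
        proof -
          have "translation_modulus (l * h) = \<bar>- l\<bar> *\<^sub>R
             (LBINT q. cmod (plateau (l * t + - l * q) - plateau (l * t + - l * q - l * h)))"
            unfolding translation_modulus_def by (rule lborel_integral_real_affine) (use l in simp)
          also have "\<dots> = (LBINT q. cmod (l * (plateau (l * t + - l * q) - plateau (l * t + - l * q - l * h))))"
            using l by (simp add: norm_mult)
          finally show ?thesis by (simp add: algebra_simps)
        qed
        finally show ?thesis .
      qed
      have fz: "(LBINT r. (f r * cis (- (w * r))) * z (t - r)) = 0"
      proof -
        have "(LBINT r. (f r * cis (- (w * r))) * z (t - r)) = (LBINT r. (f r * y (t - r)) * cis (- (w * t)))"
          unfolding z_def by (intro Bochner_Integration.integral_cong refl) (simp add: cis_mult algebra_simps)
        then show ?thesis by (simp add: fy)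
      qed
      have f': "integrable lborel (\<lambda>r. f r * cis (- (w * r)))" by (rule integrable_mult_cis[OF f])
      \<comment> \<open>Since \<open>f\<close> annihilates \<open>y\<close>, subtracting the
        vanishing integral \<open>fz\<close> turns \<open>ft f w * z t\<close> into an average of
        the small differences \<open>z t - z (t - r)\<close>.\<close>
      have "ft f w * z t = (LBINT r. (f r * cis (- (w * r))) * z t) - (LBINT r. (f r * cis (- (w * r))) * z (t - r))"
        unfolding fz by (simp add: ft_def)
      also have "\<dots> = (LBINT r. (f r * cis (- (w * r))) * (z t - z (t - r)))"
        using B by (subst Bochner_Integration.integral_diff[symmetric])
          (auto simp: right_diff_distrib intro!: integrable_mult_bounded[OF f'])
      also have "cmod \<dots> \<le> (LBINT r. cmod ((f r * cis (- (w * r))) * (z t - z (t - r))))"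
        by (rule integral_norm_bound)
      also have "\<dots> \<le> (LBINT r. B * (translation_modulus (l * r) * cmod (f r)))"
      proof (rule integral_mono)
        have "cmod (z t - z (t - r)) \<le> B + B" for r
          using B norm_triangle_ineq4[of "z t" "z (t - r)"] by (smt (verit))
        then show "integrable lborel (\<lambda>r. cmod ((f r * cis (- (w * r))) * (z t - z (t - r))))"
          by (intro integrable_norm integrable_mult_bounded[OF f']) auto
        show "integrable lborel (\<lambda>r. B * (translation_modulus (l * r) * cmod (f r)))"
          by (intro integrable_mult_right \<kappa>_int)
        show "cmod ((f r * cis (- (w * r))) * (z t - z (t - r))) \<le> B * (translation_modulus (l * r) * cmod (f r))" for r
          using mult_left_mono[OF diff[of t r], of "cmod (f r)"] by (simp add: norm_mult mult_ac)
      qed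
      also have "\<dots> = B * (LBINT r. translation_modulus (l * r) * cmod (f r))" by simp
      also have "\<dots> \<le> B * (cmod (ft f w) / 2)"
        using B norm_ge_zero[of "z t"] by (intro mult_left_mono \<kappa>) (smt (verit))
      finally have "cmod (ft f w) * cmod (z t) \<le> cmod (ft f w) * (B / 2)" by (simp add: norm_mult mult_ac)
      then show "cmod (z t) \<le> B / 2" using fw by simp
    qed
    have "\<forall>t. cmod (z t) \<le> S / 2 ^ k" for k
    proof (induction k)
      case 0 show ?case using yS zy by simp
    next
      case (Suc k) then show ?case using halve[OF Suc] by (simp add: mult.commute)
    qed
    moreover have "(\<lambda>k. S / 2 ^ k) \<longlonglongrightarrow> 0"
      using LIMSEQ_divide_realpow_zero[of 2 S] by simp
    ultimately have "cmod (z t) \<le> 0"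
      by (meson LIMSEQ_le_const)
    then show "(LBINT s. inv_ft p s * \<phi> (t - s)) = 0" using zy[of t] by (simp add: y_def W_def)
  qed
qed

subsection \<open>Bounded semigroups\<close>

lemma has_vector_derivative_at_right_quotient:
  assumes "(f has_vector_derivative d) (at_right a)"
  shows "((\<lambda>h. (1 / h) *\<^sub>R (f (a + h) - f a)) \<longlongrightarrow> d) (at_right 0)"
proof -
  have "((\<lambda>y. (1 / norm (y - a)) *\<^sub>R (f y - (f a + (y - a) *\<^sub>R d))) \<longlongrightarrow> 0) (at_right a)"
    using assms unfolding has_vector_derivative_def has_derivative_within by simp
  then have "((\<lambda>h. (1 / \<bar>h\<bar>) *\<^sub>R (f (h + a) - (f a + h *\<^sub>R d))) \<longlongrightarrow> 0) (at_right 0)"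
    unfolding at_right_to_0[of a] filterlim_filtermap by simp
  moreover have "\<forall>\<^sub>F h in at_right 0. (1 / \<bar>h\<bar>) *\<^sub>R (f (h + a) - (f a + h *\<^sub>R d)) = (1 / h) *\<^sub>R (f (a + h) - f a) - d"
    using eventually_at_right_less[of "0::real"]
    by eventually_elim (simp add: add.commute scaleR_diff_right scaleR_add_right)
  ultimately have "((\<lambda>h. (1 / h) *\<^sub>R (f (a + h) - f a) - d) \<longlongrightarrow> 0) (at_right 0)"
    by (rule Lim_transform_eventually)
  then show ?thesis by (rule LIM_zero_cancel)
qed

lemma uniformly_continuous_on_nonnegI:
  fixes f :: "real \<Rightarrow> 'b::metric_space"
  assumes "\<And>e. 0 < e \<Longrightarrow> \<exists>d>0. \<forall>t\<ge>0. \<forall>h>0. h < d \<longrightarrow> dist (f (t + h)) (f t) < e"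
  shows "uniformly_continuous_on {0..} f"
  unfolding uniformly_continuous_on_def
proof (intro allI impI)
  fix e :: real assume e: "0 < e"
  obtain d where d: "0 < d" "\<And>t h. 0 \<le> t \<Longrightarrow> 0 < h \<Longrightarrow> h < d \<Longrightarrow> dist (f (t + h)) (f t) < e"
    using assms[OF e] by blast
  have main: "dist (f s) (f t) < e" if "0 \<le> t" "t \<le> s" "s - t < d" for s t
    using d(2)[of t "s - t"] that e by (cases "s = t") auto
  show "\<exists>d>0. \<forall>t\<in>{0..}. \<forall>s\<in>{0..}. dist s t < d \<longrightarrow> dist (f s) (f t) < e"
  proof (intro exI[of _ d] conjI ballI impI d(1))
    fix t s :: real assume ts: "t \<in> {0..}" "s \<in> {0..}" "dist s t < d"
    show "dist (f s) (f t) < e"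
    proof (cases "t \<le> s")
      case True then show ?thesis using ts by (intro main) (auto simp: dist_real_def)
    next
      case False
      then have "dist (f t) (f s) < e" using ts by (intro main) (auto simp: dist_real_def)
      then show ?thesis by (simp add: dist_commute)
    qed
  qed
qed

lemma tendsto_average_at_right:
  fixes f :: "real \<Rightarrow> 'b::banach"
  assumes "continuous_on {a..} f"
  shows "((\<lambda>h. (1 / h) *\<^sub>R integral {a..a + h} f) \<longlongrightarrow> f a) (at_right 0)"
proof -
  have "((\<lambda>u. integral {a..u} f) has_vector_derivative f a) (at a within {a..a + 1})"
    by (rule integral_has_vector_derivative) (use assms in \<open>auto intro: continuous_on_subset\<close>)
  then have "((\<lambda>u. integral {a..u} f) has_vector_derivative f a) (at_right a)"
    by (simp add: at_within_Icc_at_right)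
  from has_vector_derivative_at_right_quotient[OF this] show ?thesis by simp
qed

lemma integrable_power_times_exp:
  assumes a: "a > 0"
  shows "integrable lborel (\<lambda>t. indicator {0..} t * (t ^ k * exp (- (a * t))) :: real)"
proof -
  have "integrable lborel (\<lambda>x. x ^ k * exp (- x) * indicator {0..} x :: real)"
  proof (rule integrableI_nonneg)
    show "(\<integral>\<^sup>+ x. ennreal (x ^ k * exp (- x) * indicator {0..} x) \<partial>lborel) < \<infinity>"
    proof -
      have "(\<lambda>x::real. ennreal (x ^ k * exp (- x) * indicator {0..} x)) = (\<lambda>x. ennreal (x ^ k * exp (- x)) * indicator {0..} x)"
        by (auto simp: indicator_def)
      then show ?thesis using nn_intergal_power_times_exp_Ici[of k] by simp
    qed
    show "AE x in lborel. 0 \<le> x ^ k * exp (- x) * (indicator {0..} x :: real)"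
      by (intro AE_I2) (auto simp: indicator_def)
  qed measurable
  from lborel_integrable_real_affine[OF this, of a 0]
  have "integrable lborel (\<lambda>t. (a * t) ^ k * exp (- (a * t)) * indicator {0..} (a * t))" using a by simp
  from integrable_mult_right[OF this, of "1 / a ^ k"] show ?thesis
    by (rule Bochner_Integration.integrable_cong[OF refl, THEN iffD1, rotated])
       (use a in \<open>auto simp: power_mult_distrib indicator_def zero_le_mult_iff\<close>)
qed

lemma functional_bound_linear:
  assumes "functional_bound l c"
  shows "bounded_linear l" "l (z *\<^sub>C x) = z * l x" "cmod (l x) \<le> c * norm x" "0 \<le> c * norm x"
    "l (x + y) = l x + l y" "l (x - y) = l x - l y" "l (r *\<^sub>R x) = r *\<^sub>R l x"
proof -
  show bl: "bounded_linear l" using assms by (simp add: functional_bound_def bounded_clinear_def)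
  interpret bounded_linear l by fact
  show "l (x + y) = l x + l y" "l (x - y) = l x - l y" "l (r *\<^sub>R x) = r *\<^sub>R l x"
    by (simp_all add: add diff scaleR)
  show "l (z *\<^sub>C x) = z * l x" using assms by (simp add: functional_bound_def bounded_clinear_def)
  show "cmod (l x) \<le> c * norm x" using assms by (simp add: functional_bound_def)
  then show "0 \<le> c * norm x" using norm_ge_zero[of "l x"] by linarith
qed

lemma functional_integral:
  fixes f :: "real \<Rightarrow> 'a::complex_banach"
  assumes f: "continuous_on {a..b} f" and l: "functional_bound l c"
  shows "l (integral {a..b} f) = (LBINT t. indicator {a..b} t *\<^sub>R l (f t))"
    "set_integrable lborel {a..b} (\<lambda>t. l (f t))"
proof -
  have bl: "bounded_linear l" using functional_bound_linear[OF l] by auto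
  have "f integrable_on {a..b}" using f by (rule integrable_continuous_real)
  then have "l (integral {a..b} f) = integral {a..b} (l \<circ> f)" by (rule integral_linear[symmetric, OF _ bl])
  also have "continuous_on {a..b} (\<lambda>t. l (f t))" by (intro bounded_linear.continuous_on[OF bl] f)
  then show si: "set_integrable lborel {a..b} (\<lambda>t. l (f t))" by (rule borel_integrable_atLeastAtMost')
  from set_borel_integral_eq_integral(2)[OF this]
  have "integral {a..b} (l \<circ> f) = (LBINT t. indicator {a..b} t *\<^sub>R l (f t))"
    by (simp add: set_lebesgue_integral_def comp_def)
  finally show "l (integral {a..b} f) = (LBINT t. indicator {a..b} t *\<^sub>R l (f t))" .
qed

lemma continuous_on_scaleC:
  fixes g :: "'b::topological_space \<Rightarrow> 'a::complex_banach"
  shows "continuous_on S f \<Longrightarrow> continuous_on S g \<Longrightarrow> continuous_on S (\<lambda>x. f x *\<^sub>C g x)"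
  unfolding continuous_on_def by (auto intro: tendsto_scaleC)

lemma scaleC_minus_right: "z *\<^sub>C (x - y :: 'a::complex_banach) = z *\<^sub>C x - z *\<^sub>C y"
proof -
  have "z *\<^sub>C x = z *\<^sub>C (x - y) + z *\<^sub>C y" by (simp flip: scaleC_add_right)
  then show ?thesis by simp
qed

lemma scaleC_minus_left: "(z - w) *\<^sub>C (x :: 'a::complex_banach) = z *\<^sub>C x - w *\<^sub>C x"
proof -
  have "z *\<^sub>C x = (z - w) *\<^sub>C x + w *\<^sub>C x" by (simp flip: scaleC_add_left)
  then show ?thesis by simp
qed

locale bounded_semigroup =
  fixes T :: "real \<Rightarrow> 'a::complex_banach \<Rightarrow> 'a" and D :: "'a set" and A :: "'a \<Rightarrow> 'a" and M :: real
  assumes C0: "C0_semigroup T" and gen: "is_generator D A T"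
    and T_bound: "0 \<le> t \<Longrightarrow> norm (T t x) \<le> M * norm x" and M_ge1: "1 \<le> M"
begin

text \<open>Extending the semigroup by the identity to negative times makes it jointly continuous on the whole line.\<close>

definition S :: "real \<Rightarrow> 'a \<Rightarrow> 'a" where "S t = T (max t 0)"

lemma S_nonneg [simp]: "0 \<le> t \<Longrightarrow> S t = T t" by (simp add: S_def max_def)

lemma S_bounded_clinear: "bounded_clinear (S t)"
  using C0 by (simp add: C0_semigroup_def S_def)

lemma T_add: "0 \<le> s \<Longrightarrow> 0 \<le> t \<Longrightarrow> T (s + t) x = T s (T t x)"
  using C0 by (simp add: C0_semigroup_def)

lemma T_0 [simp]: "T 0 x = x" using C0 by (simp add: C0_semigroup_def)

lemma S_bound: "norm (S t x) \<le> M * norm x" by (simp add: S_def T_bound)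

lemma S_linear: "S t (x + y) = S t x + S t y" "S t (x - y) = S t x - S t y" "S t (z *\<^sub>C x) = z *\<^sub>C S t x"
    "S t (r *\<^sub>R x) = r *\<^sub>R S t x" "S t 0 = 0"
proof -
  have "bounded_linear (S t)" using S_bounded_clinear by (simp add: bounded_clinear_def)
  then interpret bounded_linear "S t" .
  show "S t (x + y) = S t x + S t y" "S t (x - y) = S t x - S t y" "S t (z *\<^sub>C x) = z *\<^sub>C S t x"
    "S t (r *\<^sub>R x) = r *\<^sub>R S t x" "S t 0 = 0"
    using S_bounded_clinear[of t] by (auto simp: add diff scaleR zero bounded_clinear_def)
qed

lemma T_linear:
  assumes "0 \<le> t"
  shows "T t (x + y) = T t x + T t y" "T t (x - y) = T t x - T t y" "T t (z *\<^sub>C x) = z *\<^sub>C T t x"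
    "T t (r *\<^sub>R x) = r *\<^sub>R T t x"
  using S_linear[of t] assms by auto

lemma S_continuous: "continuous_on UNIV (\<lambda>t. S t x)"
proof -
  have "continuous_on {0..} (\<lambda>t. T t x)" using C0 by (simp add: C0_semigroup_def)
  moreover have "continuous_on UNIV (\<lambda>t. max t (0::real))" by (intro continuous_intros)
  ultimately show ?thesis unfolding S_def by (rule continuous_on_compose2) auto
qed

text \<open>Uniform boundedness upgrades strong continuity to joint continuity. Hence
  \<open>S (g t) (f t)\<close> is again a limit of simple functions when \<open>f\<close> is
  one.\<close>

lemma S_tendsto:
  assumes p: "(p \<longlongrightarrow> a) F" and q: "(q \<longlongrightarrow> b) F"
  shows "((\<lambda>i. S (p i) (q i)) \<longlongrightarrow> S a b) F"
proof -
  have c: "((\<lambda>i. S (p i) b) \<longlongrightarrow> S a b) F"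
    using S_continuous[of b] p by (auto simp: continuous_on_eq_continuous_at intro: isCont_tendsto_compose)
  have "((\<lambda>i. S (p i) (q i) - S a b) \<longlongrightarrow> 0) F"
  proof (rule tendsto_norm_zero_cancel, rule tendsto_sandwich[where f = "\<lambda>_. 0"])
    have "norm (S (p i) (q i) - S a b) \<le> M * norm (q i - b) + norm (S (p i) b - S a b)" for i
    proof -
      have "S (p i) (q i) - S a b = S (p i) (q i - b) + (S (p i) b - S a b)" by (simp add: S_linear)
      then have "norm (S (p i) (q i) - S a b) \<le> norm (S (p i) (q i - b)) + norm (S (p i) b - S a b)"
        by (metis norm_triangle_ineq)
      then show ?thesis using S_bound[of "p i" "q i - b"] by linarith
    qed
    then show "\<forall>\<^sub>F i in F. norm (S (p i) (q i) - S a b) \<le> M * norm (q i - b) + norm (S (p i) b - S a b)" by simp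
    have "((\<lambda>i. M * norm (q i - b) + norm (S (p i) b - S a b)) \<longlongrightarrow> M * norm (b - b) + norm (S a b - S a b)) F"
      by (intro tendsto_intros q c)
    then show "((\<lambda>i. M * norm (q i - b) + norm (S (p i) b - S a b)) \<longlongrightarrow> 0) F" by simp
  qed auto
  then show ?thesis by (rule LIM_zero_cancel)
qed

lemma functional_bound_S:
  assumes l: "functional_bound l c"
  shows "functional_bound (\<lambda>x. l (S t x)) (\<bar>c\<bar> * M)"
proof -
  have "cmod (l (S t y)) \<le> \<bar>c\<bar> * M * norm y" for y
  proof -
    have "cmod (l (S t y)) \<le> c * norm (S t y)" using functional_bound_linear[OF l] by blast
    also have "\<dots> \<le> \<bar>c\<bar> * (M * norm y)" using S_bound by (intro mult_mono) auto
    finally show ?thesis by simp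
  qed
  then show ?thesis using l S_bounded_clinear[of t]
    by (auto simp: functional_bound_def intro: bounded_clinear_compose)
qed

lemma functional_S_continuous:
  assumes l: "functional_bound l c"
  shows "continuous_on UNIV (\<lambda>t. l (S t x))"
  by (rule bounded_linear.continuous_on[OF functional_bound_linear(1)[OF l] S_continuous])

lemma generator_iff:
  "x \<in> D \<and> A x = y \<longleftrightarrow> ((\<lambda>t. (1 / t) *\<^sub>R (T t x - x)) \<longlongrightarrow> y) (at_right 0)"
  using gen unfolding is_generator_def
  by (metis (mono_tags, lifting) mem_Collect_eq tendsto_unique trivial_limit_at_right_real)

lemma generatorI:
  assumes "((\<lambda>t. (1 / t) *\<^sub>R (T t x - x)) \<longlongrightarrow> y) (at_right 0)"
  shows "x \<in> D" "A x = y"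
  using assms generator_iff by blast+

lemma generator_tendsto: "x \<in> D \<Longrightarrow> ((\<lambda>t. (1 / t) *\<^sub>R (T t x - x)) \<longlongrightarrow> A x) (at_right 0)"
  using generator_iff by blast

lemma generator_diff:
  assumes "x \<in> D" "y \<in> D"
  shows "x - y \<in> D" "A (x - y) = A x - A y"
proof -
  have "((\<lambda>t. (1 / t) *\<^sub>R (T t x - x) - (1 / t) *\<^sub>R (T t y - y)) \<longlongrightarrow> A x - A y) (at_right 0)"
    by (intro tendsto_diff generator_tendsto assms)
  moreover have "\<forall>\<^sub>F t in at_right 0. (1 / t) *\<^sub>R (T t x - x) - (1 / t) *\<^sub>R (T t y - y) = (1 / t) *\<^sub>R (T t (x - y) - (x - y))"
    using eventually_at_right_less[of "0::real"] by eventually_elim (simp add: T_linear algebra_simps)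
  ultimately have "((\<lambda>t. (1 / t) *\<^sub>R (T t (x - y) - (x - y))) \<longlongrightarrow> A x - A y) (at_right 0)"
    by (rule Lim_transform_eventually)
  then show "x - y \<in> D" "A (x - y) = A x - A y" by (rule generatorI)+
qed

lemma generator_add:
  assumes "x \<in> D" "y \<in> D"
  shows "x + y \<in> D" "A (x + y) = A x + A y"
proof -
  have "((\<lambda>t. (1 / t) *\<^sub>R (T t x - x) + (1 / t) *\<^sub>R (T t y - y)) \<longlongrightarrow> A x + A y) (at_right 0)"
    by (intro tendsto_add generator_tendsto assms)
  moreover have "\<forall>\<^sub>F t in at_right 0. (1 / t) *\<^sub>R (T t x - x) + (1 / t) *\<^sub>R (T t y - y) = (1 / t) *\<^sub>R (T t (x + y) - (x + y))"
    using eventually_at_right_less[of "0::real"] by eventually_elim (simp add: T_linear algebra_simps)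
  ultimately have "((\<lambda>t. (1 / t) *\<^sub>R (T t (x + y) - (x + y))) \<longlongrightarrow> A x + A y) (at_right 0)"
    by (rule Lim_transform_eventually)
  then show "x + y \<in> D" "A (x + y) = A x + A y" by (rule generatorI)+
qed

text \<open>Meant for the Laplace transform, the integrated semigroup and complex scalars, all of
  which commute with \<open>T\<close>.\<close>

lemma generator_commute:
  assumes F: "bounded_linear F" and comm: "\<And>h x. 0 \<le> h \<Longrightarrow> T h (F x) = F (T h x)" and x: "x \<in> D"
  shows "F x \<in> D" "A (F x) = F (A x)"
proof -
  interpret F: bounded_linear F by fact
  have "((\<lambda>t. F ((1 / t) *\<^sub>R (T t x - x))) \<longlongrightarrow> F (A x)) (at_right 0)"
    by (intro F.tendsto generator_tendsto x)
  moreover have "\<forall>\<^sub>F t in at_right 0. F ((1 / t) *\<^sub>R (T t x - x)) = (1 / t) *\<^sub>R (T t (F x) - F x)"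
    using eventually_at_right_less[of "0::real"] by eventually_elim (simp add: comm F.scaleR F.diff)
  ultimately have "((\<lambda>t. (1 / t) *\<^sub>R (T t (F x) - F x)) \<longlongrightarrow> F (A x)) (at_right 0)"
    by (rule Lim_transform_eventually)
  then show "F x \<in> D" "A (F x) = F (A x)" by (rule generatorI)+
qed

subsection \<open>The resolvent as a Laplace transform\<close>

definition lap_kernel :: "complex \<Rightarrow> real \<Rightarrow> complex" where
  "lap_kernel z t = indicator {0..} t * exp (- (z * t))"

definition lap :: "complex \<Rightarrow> 'a \<Rightarrow> 'a" where
  "lap z x = bochner_integral lborel (\<lambda>t. lap_kernel z t *\<^sub>C S t x)"

lemma lap_kernel_measurable [measurable]: "lap_kernel z \<in> borel_measurable borel"
  unfolding lap_kernel_def[abs_def] by measurable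

lemma norm_lap_kernel: "cmod (lap_kernel z t) = indicator {0..} t * exp (- (Re z * t))"
  by (simp add: lap_kernel_def norm_mult indicator_def)

lemma lap_kernel_integrable:
  assumes "Re z > 0" shows "integrable lborel (lap_kernel z)"
proof -
  have "integrable lborel (\<lambda>t. cmod (lap_kernel z t))"
    unfolding norm_lap_kernel using integrable_power_times_exp[OF assms, of 0] by simp
  then show ?thesis by (rule integrable_norm_cancel) measurable
qed

lemma simple_limit_S: "simple_limit N f \<Longrightarrow> g \<in> borel_measurable N \<Longrightarrow> simple_limit N (\<lambda>t. S (g t) (f t))"
  by (rule simple_limit_compose2[where F = S]) (auto intro: borel_measurable_imp_simple_limit S_tendsto)

lemma lap_functional:
  assumes z: "Re z > 0" and l: "functional_bound l c"
  shows "integrable lborel (\<lambda>t. lap_kernel z t * l (S t x))"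
    "l (lap z x) = (LBINT t. lap_kernel z t * l (S t x))"
proof -
  have sl: "simple_limit lborel (\<lambda>t. lap_kernel z t *\<^sub>C S t x)"
    by (intro simple_limit_scaleC simple_limit_S simple_limit_const borel_measurable_imp_simple_limit) measurable
  have i: "integrable lborel (\<lambda>t. cmod (lap_kernel z t) * (M * norm x))"
    using lap_kernel_integrable[OF z] by (intro integrable_mult_left integrable_norm)
  have "(\<integral>\<^sup>+t. norm (lap_kernel z t *\<^sub>C S t x) \<partial>lborel) \<le> (\<integral>\<^sup>+t. norm (cmod (lap_kernel z t) * (M * norm x)) \<partial>lborel)"
    using S_bound M_ge1 by (intro nn_integral_mono ennreal_leI) (simp add: norm_scaleC abs_mult mult_left_mono)
  also have "\<dots> < \<infinity>" using i unfolding integrable_iff_bounded by blast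
  finally have fin: "(\<integral>\<^sup>+t. norm (lap_kernel z t *\<^sub>C S t x) \<partial>lborel) < \<infinity>" .
  show "integrable lborel (\<lambda>t. lap_kernel z t * l (S t x))"
    "l (lap z x) = (LBINT t. lap_kernel z t * l (S t x))"
    using simple_limit_bochner_functional[OF sl fin l] unfolding lap_def
    by (simp_all add: functional_bound_linear(2)[OF l])
qed

lemma lap_bound:
  assumes z: "Re z > 0"
  shows "norm (lap z x) \<le> (LBINT t. cmod (lap_kernel z t)) * M * norm x"
proof (rule norm_le_functionals)
  fix l :: "'a \<Rightarrow> complex" assume l: "functional_bound l 1"
  have i: "integrable lborel (\<lambda>t. cmod (lap_kernel z t) * (M * norm x))"
    using lap_kernel_integrable[OF z] by (intro integrable_mult_left integrable_norm)
  have "cmod (l (lap z x)) \<le> (LBINT t. cmod (lap_kernel z t * l (S t x)))"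
    unfolding lap_functional(2)[OF z l] by (rule integral_norm_bound)
  also have "\<dots> \<le> (LBINT t. cmod (lap_kernel z t) * (M * norm x))"
  proof (intro integral_mono integrable_norm lap_functional[OF z l] i)
    fix t
    have "cmod (l (S t x)) \<le> M * norm x"
      using functional_bound_linear(3)[OF l, of "S t x"] S_bound[of t x] by simp
    then show "cmod (lap_kernel z t * l (S t x)) \<le> cmod (lap_kernel z t) * (M * norm x)"
      by (simp add: norm_mult mult_left_mono)
  qed
  finally show "cmod (l (lap z x)) \<le> (LBINT t. cmod (lap_kernel z t)) * M * norm x" by (simp add: mult.assoc)
qed

lemma lap_bounded_clinear:
  assumes z: "Re z > 0"
  shows "bounded_clinear (lap z)"
proof -
  have add: "lap z (x + y) = lap z x + lap z y" for x y
  proof (rule eq_functionals)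
    fix l :: "'a \<Rightarrow> complex" assume l: "functional_bound l 1"
    show "l (lap z (x + y)) = l (lap z x + lap z y)"
      using lap_functional(1)[OF z l]
      by (simp add: functional_bound_linear[OF l] lap_functional[OF z l] S_linear distrib_left)
  qed
  have sc: "lap z (c *\<^sub>C x) = c *\<^sub>C lap z x" for c x
  proof (rule eq_functionals)
    fix l :: "'a \<Rightarrow> complex" assume l: "functional_bound l 1"
    show "l (lap z (c *\<^sub>C x)) = l (c *\<^sub>C lap z x)"
      by (simp add: functional_bound_linear[OF l] lap_functional[OF z l] S_linear mult.left_commute)
  qed
  have "bounded_linear (lap z)"
    by (rule bounded_linear_intro[where K = "(LBINT t. cmod (lap_kernel z t)) * M"])
       (use add sc lap_bound[OF z] in \<open>auto simp: scaleR_scaleC mult_ac\<close>)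
  then show ?thesis using sc by (simp add: bounded_clinear_def)
qed

lemma lap_T_commute:
  assumes z: "Re z > 0" and h: "0 \<le> h"
  shows "T h (lap z x) = lap z (T h x)"
proof (rule eq_functionals)
  fix l :: "'a \<Rightarrow> complex" assume l: "functional_bound l 1"
  have "l (T h (lap z x)) = (LBINT t. lap_kernel z t * l (S h (S t x)))"
    using lap_functional(2)[OF z functional_bound_S[OF l, of h]] h by simp
  also have "\<dots> = (LBINT t. lap_kernel z t * l (S t (S h x)))"
  proof (intro Bochner_Integration.integral_cong refl)
    fix t
    show "lap_kernel z t * l (S h (S t x)) = lap_kernel z t * l (S t (S h x))"
      using h by (cases "t \<ge> 0") (simp_all add: lap_kernel_def T_add[symmetric] add.commute)
  qed
  finally show "l (T h (lap z x)) = l (lap z (T h x))" using lap_functional(2)[OF z l] h by simp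
qed

text \<open>Shifting the integration variable by \<open>h\<close> gives \<open>T h (lap z x)\<close>
  an explicit dependence on \<open>h\<close>, whose right derivative at 0 will put
  \<open>lap z x\<close> into the domain. The form \<open>{0..0 + h}\<close> matches
  \<open>tendsto_average_at_right\<close>.\<close>

lemma lap_T:
  assumes z: "Re z > 0" and h: "0 \<le> h"
  shows "T h (lap z x) = exp (z * h) *\<^sub>C (lap z x - integral {0..0 + h} (\<lambda>t. exp (- (z * t)) *\<^sub>C S t x))"
proof (rule eq_functionals)
  fix l :: "'a \<Rightarrow> complex" assume l: "functional_bound l 1"
  note lin = functional_bound_linear[OF l]
  have cont: "continuous_on {0..h} (\<lambda>t. exp (- (z * t)) *\<^sub>C S t x)"
    by (intro continuous_on_scaleC continuous_intros continuous_on_subset[OF S_continuous]) auto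
  define F where "F t = lap_kernel z t * l (S t x)" for t
  have Fint: "integrable lborel F" unfolding F_def[abs_def] by (rule lap_functional[OF z l])
  have "l (T h (lap z x)) = (LBINT t. lap_kernel z t * l (S h (S t x)))"
    using lap_functional(2)[OF z functional_bound_S[OF l, of h]] h by simp
  also have "\<dots> = (LBINT t. exp (z * h) * (F (h + 1 * t) - indicator {0..h} (h + 1 * t) *\<^sub>R F (h + 1 * t)))"
  proof (rule integral_cong_AE)
    show "(\<lambda>t. lap_kernel z t * l (S h (S t x))) \<in> borel_measurable lborel"
      by (rule borel_measurable_integrable[OF lap_functional(1)[OF z functional_bound_S[OF l]]])
    show "(\<lambda>t. exp (z * h) * (F (h + 1 * t) - indicator {0..h} (h + 1 * t) *\<^sub>R F (h + 1 * t))) \<in> borel_measurable lborel"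
      using Fint by measurable
    \<comment> \<open>At t = 0 the closed indicator removes \<open>F h\<close> on the right while
      the left side is \<open>l (T h x)\<close>; this one point is negligible.\<close>
    have "lap_kernel z t * l (S h (S t x)) = exp (z * h) * (F (h + 1 * t) - indicator {0..h} (h + 1 * t) *\<^sub>R F (h + 1 * t))" if "t \<noteq> 0" for t
    proof (cases "t > 0")
      case True
      then have "exp (z * h) * exp (- (z * (h + t))) = exp (- (z * t))"
        by (simp add: exp_add[symmetric] algebra_simps)
      then show ?thesis using True h by (simp add: F_def lap_kernel_def T_add)
    next
      case False
      then have "t < 0" using that by simp
      then show ?thesis using h by (simp add: F_def lap_kernel_def indicator_def)
    qed
    then show "AE t in lborel. lap_kernel z t * l (S h (S t x)) = exp (z * h) * (F (h + 1 * t) - indicator {0..h} (h + 1 * t) *\<^sub>R F (h + 1 * t))"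
      using AE_lborel_singleton[of 0] by (auto elim: eventually_mono)
  qed
  also have "\<dots> = exp (z * h) * (LBINT t. F (h + 1 * t) - indicator {0..h} (h + 1 * t) *\<^sub>R F (h + 1 * t))"
    by (rule integral_mult_right_zero)
  also have "(LBINT t. F (h + 1 * t) - indicator {0..h} (h + 1 * t) *\<^sub>R F (h + 1 * t)) = (LBINT t. F t - indicator {0..h} t *\<^sub>R F t)"
    using lborel_integral_real_affine[of 1 "\<lambda>t. F t - indicator {0..h} t *\<^sub>R F t" h] by simp
  also have "\<dots> = (LBINT t. F t) - (LBINT t. indicator {0..h} t *\<^sub>R F t)"
    using Fint by (intro Bochner_Integration.integral_diff integrable_mult_indicator) auto
  also have "(LBINT t. F t) = l (lap z x)" unfolding F_def lap_functional(2)[OF z l] ..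
  also have "(LBINT t. indicator {0..h} t *\<^sub>R F t) = l (integral {0..h} (\<lambda>t. exp (- (z * t)) *\<^sub>C S t x))"
    unfolding functional_integral(1)[OF cont l]
    by (intro Bochner_Integration.integral_cong refl) (auto simp: F_def lap_kernel_def lin indicator_def)
  finally show "l (T h (lap z x)) = l (exp (z * h) *\<^sub>C (lap z x - integral {0..0 + h} (\<lambda>t. exp (- (z * t)) *\<^sub>C S t x)))"
    by (simp add: lin)
qed

lemma lap_in_domain:
  assumes z: "Re z > 0"
  shows "lap z x \<in> D" "A (lap z x) = z *\<^sub>C lap z x - x"
proof -
  define I where "I h = integral {0..0 + h} (\<lambda>t. exp (- (z * complex_of_real t)) *\<^sub>C S t x)" for h
  have cont: "continuous_on {0..} (\<lambda>t. exp (- (z * complex_of_real t)) *\<^sub>C S t x)"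
    by (intro continuous_on_scaleC continuous_intros continuous_on_subset[OF S_continuous]) auto
  have I: "((\<lambda>h. (1 / h) *\<^sub>R I h) \<longlongrightarrow> x) (at_right 0)"
    using tendsto_average_at_right[OF cont] unfolding I_def by simp
  have e: "((\<lambda>h. (exp (z * complex_of_real h) - 1) / h) \<longlongrightarrow> z) (at_right 0)"
  proof -
    have "((\<lambda>h. exp (z * complex_of_real h)) has_vector_derivative z) (at 0)"
      using exp_scaleR_has_vector_derivative_right[of z 0 UNIV] by (simp add: scaleR_conv_of_real mult.commute)
    then have "((\<lambda>h. exp (z * complex_of_real h)) has_vector_derivative z) (at_right 0)"
      by (rule has_vector_derivative_at_within)
    from has_vector_derivative_at_right_quotient[OF this]
    show ?thesis by (simp add: scaleR_conv_of_real)
  qed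
  have "((\<lambda>h. ((exp (z * complex_of_real h) - 1) / h) *\<^sub>C lap z x - exp (z * complex_of_real h) *\<^sub>C ((1 / h) *\<^sub>R I h))
      \<longlongrightarrow> z *\<^sub>C lap z x - exp (z * complex_of_real 0) *\<^sub>C x) (at_right 0)"
    by (intro tendsto_diff tendsto_scaleC e I tendsto_intros)
  moreover have "\<forall>\<^sub>F h in at_right 0. ((exp (z * complex_of_real h) - 1) / h) *\<^sub>C lap z x - exp (z * complex_of_real h) *\<^sub>C ((1 / h) *\<^sub>R I h)
       = (1 / h) *\<^sub>R (T h (lap z x) - lap z x)"
    using eventually_at_right_less[of "0::real"]
  proof eventually_elim
    case (elim h)
    have "(1 / h) *\<^sub>R (T h (lap z x) - lap z x) = complex_of_real (1 / h) *\<^sub>C ((exp (z * h) - 1) *\<^sub>C lap z x - exp (z * h) *\<^sub>C I h)"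
      using lap_T[OF z, of h x] elim
      by (simp add: scaleR_scaleC I_def scaleC_minus_right scaleC_minus_left)
    then show ?case
      by (simp add: scaleC_minus_right scaleC_scaleC scaleR_scaleC mult.commute)
  qed
  ultimately have "((\<lambda>h. (1 / h) *\<^sub>R (T h (lap z x) - lap z x)) \<longlongrightarrow> z *\<^sub>C lap z x - x) (at_right 0)"
    by (auto dest: Lim_transform_eventually)
  then show "lap z x \<in> D" "A (lap z x) = z *\<^sub>C lap z x - x" by (rule generatorI)+
qed

lemma lap_linear:
  assumes z: "Re z > 0"
  shows "bounded_linear (lap z)" "lap z (x + y) = lap z x + lap z y" "lap z (x - y) = lap z x - lap z y" 
    "lap z (c *\<^sub>C x) = c *\<^sub>C lap z x"
proof -
  show bl: "bounded_linear (lap z)" using lap_bounded_clinear[OF z] by (simp add: bounded_clinear_def)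
  interpret bounded_linear "lap z" by fact
  show "lap z (x + y) = lap z x + lap z y" "lap z (x - y) = lap z x - lap z y"  by (simp_all add: add diff)
  show "lap z (c *\<^sub>C x) = c *\<^sub>C lap z x" using lap_bounded_clinear[OF z] by (simp add: bounded_clinear_def)
qed

lemma lap_inverse:
  assumes z: "Re z > 0" and x: "x \<in> D"
  shows "lap z (z *\<^sub>C x - A x) = x"
proof -
  have "A (lap z x) = lap z (A x)"
    using generator_commute(2)[OF lap_linear(1)[OF z] lap_T_commute[OF z] x] .
  then have "lap z (A x) = z *\<^sub>C lap z x - x" using lap_in_domain(2)[OF z, of x] by simp
  then show ?thesis by (simp add: lap_linear[OF z])
qed

text \<open>An equation for the unbounded \<open>A\<close> becomes one for the bounded operator
  \<open>lap 1\<close>, which commutes with integrals and can be tested by functionals. In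
  \<open>mild_solution_duhamel\<close> this plays the part of the closedness of
  \<open>A\<close>.\<close>

lemma domain_iff_lap:
  "x \<in> D \<and> A x = y \<longleftrightarrow> x = lap 1 (x - y)"
proof
  assume "x \<in> D \<and> A x = y"
  then show "x = lap 1 (x - y)" using lap_inverse[of 1 x] by simp
next
  assume "x = lap 1 (x - y)"
  then have "lap 1 (x - y) = x" by simp
  then show "x \<in> D \<and> A x = y" using lap_in_domain[of 1 "x - y"] by simp
qed

end

text \<open>Mild solutions are defined with integrals over \<open>lebesgue_on {0..t}\<close>,
  whereas the estimates use \<open>lborel\<close>; this is the bridge. Its first part makes the
  choice of the representative of the forcing term immaterial.\<close>

lemma bochner_integral_lebesgue_on:
  fixes f :: "real \<Rightarrow> 'a::complex_banach"
  assumes f: "simple_limit lborel f" and C: "\<And>s. norm (f s) \<le> C"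
    and AE: "AE s in lebesgue. g s = f s"
  shows "bochner_integral (lebesgue_on {0..t}) g = bochner_integral (lebesgue_on {0..t}) f"
    and "functional_bound l c \<Longrightarrow> l (bochner_integral (lebesgue_on {0..t}) f) = (LBINT s. indicator {0..t} s *\<^sub>R l (f s))"
proof -
  have id: "(\<lambda>x. x) \<in> measurable (lebesgue_on {0..t}) lborel"
    by (rule measurable_restrict_space1) (use measurable_completion[of "\<lambda>x. x" lborel lborel] in auto)
  have sl: "simple_limit (lebesgue_on {0..t}) f"
    by (rule simple_limit_measurable_compose[OF id f])
  have fin: "(\<integral>\<^sup>+x. norm (f x) \<partial>lebesgue_on {0..t}) < \<infinity>"
  proof -
    have "(\<integral>\<^sup>+x. norm (f x) \<partial>lebesgue_on {0..t}) \<le> (\<integral>\<^sup>+x. ennreal C \<partial>lebesgue_on {0..t})"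
      using C by (intro nn_integral_mono ennreal_leI)
    also have "\<dots> < \<infinity>" by (cases "0 \<le> t") (auto simp: emeasure_restrict_space ennreal_mult_less_top)
    finally show ?thesis .
  qed
  have fm: "f \<in> borel_measurable lborel" using f by (rule simple_limit_imp_borel_measurable)
  have gm: "g \<in> borel_measurable (lebesgue_on {0..t})"
    using borel_measurable_completion_AE[OF fm AE] by (rule measurable_restrict_space1)
  have "AE s in lebesgue_on {0..t}. g s = f s"
    using AE by (auto simp: AE_restrict_space_iff elim: eventually_mono)
  then have "has_bochner (lebesgue_on {0..t}) g = has_bochner (lebesgue_on {0..t}) f"
    by (rule has_bochner_cong_AE[OF gm simple_limit_imp_borel_measurable[OF sl]])
  then show "bochner_integral (lebesgue_on {0..t}) g = bochner_integral (lebesgue_on {0..t}) f"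
    by (simp add: bochner_integral_def)
  assume l: "functional_bound l c"
  have lfm: "(\<lambda>s. l (f s)) \<in> borel_measurable lborel"
    using simple_limit_bounded_linear[OF functional_bound_linear(1)[OF l] f] by (rule simple_limit_imp_borel_measurable)
  have "l (bochner_integral (lebesgue_on {0..t}) f) = (LINT s|lebesgue_on {0..t}. l (f s))"
    by (rule simple_limit_bochner_functional[OF sl fin l])
  also have "\<dots> = (LINT s|lebesgue. indicator {0..t} s *\<^sub>R l (f s))"
    by (rule integral_restrict_space) simp
  also have "\<dots> = (LBINT s. indicator {0..t} s *\<^sub>R l (f s))"
    using lfm by (intro integral_completion borel_measurable_scaleR) auto
  finally show "l (bochner_integral (lebesgue_on {0..t}) f) = (LBINT s. indicator {0..t} s *\<^sub>R l (f s))" .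
qed

lemma bochner_integral_continuous:
  fixes u :: "real \<Rightarrow> 'a::complex_banach"
  assumes u: "continuous_on {0..} u" and t: "0 \<le> t"
  shows "bochner_integral (lebesgue_on {0..t}) u = integral {0..t} u"
proof -
  \<comment> \<open>Freezing \<open>u\<close> outside \<open>{0..t}\<close> gives a bounded function
    that is continuous on the whole line; the values of \<open>u\<close> at negative times are
    arbitrary.\<close>
  define w where "w s = u (max 0 (min s t))" for s
  have w_eq: "w s = u s" if "s \<in> {0..t}" for s using that by (simp add: w_def)
  have cw: "continuous_on UNIV w" unfolding w_def
    by (rule continuous_on_compose2[OF u]) (auto intro!: continuous_intros)
  have cwt: "continuous_on {0..t} w" using cw by (rule continuous_on_subset) simp
  have "compact (u ` {0..t})"
    using u by (intro compact_continuous_image) (auto intro: continuous_on_subset)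
  then have "bounded (u ` {0..t})" by (rule compact_imp_bounded)
  then obtain C where "\<forall>y\<in>u ` {0..t}. norm y \<le> C" unfolding bounded_iff by blast
  then have C: "norm (w s) \<le> C" for s using t by (simp add: w_def)
  have sl: "simple_limit lborel w"
  proof (rule simple_limit_compose2[where f = "\<lambda>s. s" and g = "\<lambda>s. s" and F = "\<lambda>a b. w a"])
    show "(\<lambda>i. w (p i)) \<longlonglongrightarrow> w a" if "p \<longlonglongrightarrow> a" for p and a
      using cw that by (auto simp: continuous_on_eq_continuous_at intro: isCont_tendsto_compose)
  qed (auto intro: borel_measurable_imp_simple_limit)
  have "bochner_integral (lebesgue_on {0..t}) u = bochner_integral (lebesgue_on {0..t}) w"
  proof -
    have "has_bochner (lebesgue_on {0..t}) u x = has_bochner (lebesgue_on {0..t}) w x" for x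
    proof -
      have "(u \<in> borel_measurable (lebesgue_on {0..t})) = (w \<in> borel_measurable (lebesgue_on {0..t}))"
        by (rule measurable_cong) (simp add: w_eq)
      moreover have "(\<integral>\<^sup>+y. norm (u y - s y) \<partial>lebesgue_on {0..t}) = (\<integral>\<^sup>+y. norm (w y - s y) \<partial>lebesgue_on {0..t})" for s
        by (rule nn_integral_cong) (simp add: w_eq)
      ultimately show ?thesis unfolding has_bochner_def by simp
    qed
    then have "has_bochner (lebesgue_on {0..t}) u = has_bochner (lebesgue_on {0..t}) w" by blast
    then show ?thesis by (simp add: bochner_integral_def)
  qed
  also have "\<dots> = integral {0..t} w"
  proof (rule eq_functionals)
    fix l :: "'a \<Rightarrow> complex" assume l: "functional_bound l 1"
    show "l (bochner_integral (lebesgue_on {0..t}) w) = l (integral {0..t} w)"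
      unfolding functional_integral(1)[OF cwt l] by (rule bochner_integral_lebesgue_on(2)[OF sl C _ l, where g = w]) simp
  qed
  also have "\<dots> = integral {0..t} u" by (rule integral_cong) (simp add: w_eq)
  finally show ?thesis .
qed

section \<open>Perturbation of resolvents, the integrated semigroup, and uniqueness of mild
  solutions\<close>

context bounded_semigroup
begin

lemma generator_scaleC:
  assumes "x \<in> D" shows "z *\<^sub>C x \<in> D" "A (z *\<^sub>C x) = z *\<^sub>C A x"
proof -
  have "bounded_linear ((*\<^sub>C) z :: 'a \<Rightarrow> 'a)"
    by (rule bounded_linear_intro[where K = "cmod z"])
       (auto simp: scaleC_add_right norm_scaleC scaleR_scaleC scaleC_scaleC mult.commute)
  then show "z *\<^sub>C x \<in> D" "A (z *\<^sub>C x) = z *\<^sub>C A x"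
    using generator_commute[OF _ _ assms, of "(*\<^sub>C) z"] by (auto simp: T_linear)
qed

abbreviation res :: "complex \<Rightarrow> 'a \<Rightarrow> 'a" where "res \<equiv> resolvent D A"

lemma resolvent_facts:
  assumes z: "z \<notin> spectrum D A"
  shows "res z x \<in> D" "z *\<^sub>C res z x - A (res z x) = x" "x \<in> D \<Longrightarrow> res z (z *\<^sub>C x - A x) = x"
    "bounded_linear (res z)" "norm (res z x) \<le> onorm (res z) * norm x"
proof -
  have bij: "bij_betw (\<lambda>x. z *\<^sub>C x - A x) D UNIV" and bl: "bounded_clinear (res z)"
    using z by (auto simp: spectrum_def)
  show "res z x \<in> D" unfolding resolvent_def
    by (rule inv_into_into) (use bij in \<open>auto simp: bij_betw_def\<close>)
  show "z *\<^sub>C res z x - A (res z x) = x" unfolding resolvent_def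
    using f_inv_into_f[of x "\<lambda>x. z *\<^sub>C x - A x" D] bij by (auto simp: bij_betw_def)
  show "x \<in> D \<Longrightarrow> res z (z *\<^sub>C x - A x) = x" unfolding resolvent_def
    by (rule inv_into_f_f) (use bij in \<open>auto simp: bij_betw_def\<close>)
  show "bounded_linear (res z)" using bl by (simp add: bounded_clinear_def)
  then show "norm (res z x) \<le> onorm (res z) * norm x" by (rule onorm)
qed

text \<open>In \<open>x = res z (y - (w - z) *\<^sub>C x)\<close> the term in \<open>x\<close> is
  absorbed, its factor being at most 1/2. That \<open>w\<close> is a resolvent point is not
  presupposed, so the estimate also yields injectivity of \<open>w - A\<close> and a bound on
  \<open>lap w\<close>.\<close>

lemma norm_bound_near:
  assumes z: "z \<notin> spectrum D A" and N: "onorm (res z) \<le> N" and d: "cmod (w - z) * N \<le> 1 / 2"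
    and x: "x \<in> D" and y: "w *\<^sub>C x - A x = y"
  shows "norm x \<le> 2 * N * norm y"
proof -
  have "z *\<^sub>C x - A x = y - (w - z) *\<^sub>C x" using y by (auto simp: scaleC_minus_left)
  then have "x = res z (y - (w - z) *\<^sub>C x)" using resolvent_facts(3)[OF z x] by simp
  then have "norm x \<le> onorm (res z) * norm (y - (w - z) *\<^sub>C x)" using resolvent_facts(5)[OF z] by metis
  also have "\<dots> \<le> N * (norm y + cmod (w - z) * norm x)"
    using N onorm_pos_le[OF resolvent_facts(4)[OF z]] norm_triangle_ineq4[of y "(w - z) *\<^sub>C x"]
    by (intro mult_mono) (auto simp: norm_scaleC)
  also have "\<dots> = N * norm y + (cmod (w - z) * N) * norm x" by (simp add: algebra_simps)
  also have "(cmod (w - z) * N) * norm x \<le> 1 / 2 * norm x" using d by (intro mult_right_mono) auto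
  finally show ?thesis by simp
qed

text \<open>Solving \<open>w *\<^sub>C x - A x = y\<close> amounts to the fixed point equation
  \<open>x = res z (y - (w - z) *\<^sub>C x)\<close>, a contraction with constant 1/2. Injectivity
  and the bound on the inverse come from \<open>norm_bound_near\<close>.\<close>

lemma resolvent_set_open:
  assumes z: "z \<notin> spectrum D A"
  shows "\<exists>d>0. \<forall>w. cmod (w - z) < d \<longrightarrow> w \<notin> spectrum D A"
proof -
  \<comment> \<open>Adding 1 keeps \<open>N\<close> positive when the resolvent is the zero operator
    on a trivial space.\<close>
  define N where "N = onorm (res z) + 1"
  have N: "N > 0" "onorm (res z) \<le> N"
    using onorm_pos_le[OF resolvent_facts(4)[OF z]] by (auto simp: N_def)
  have "w \<notin> spectrum D A" if w: "cmod (w - z) < 1 / (2 * N)" for w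
  proof -
    have d: "cmod (w - z) * N \<le> 1 / 2" using w N by (simp add: field_simps)
    have ex: "\<exists>x\<in>D. w *\<^sub>C x - A x = y" for y
    proof -
      have "\<exists>!x. res z (y - (w - z) *\<^sub>C x) = x"
      proof (rule banach_fix_type[of "1 / 2" "\<lambda>x. res z (y - (w - z) *\<^sub>C x)"], simp, simp, intro allI)
        fix x1 x2 :: 'a
        have "(y - (w - z) *\<^sub>C x1) - (y - (w - z) *\<^sub>C x2) = (w - z) *\<^sub>C (x2 - x1)"
          unfolding scaleC_minus_right by simp
        then have "res z (y - (w - z) *\<^sub>C x1) - res z (y - (w - z) *\<^sub>C x2) = res z ((w - z) *\<^sub>C (x2 - x1))"
          by (simp flip: linear_diff[OF bounded_linear.linear[OF resolvent_facts(4)[OF z]]])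
        then have "norm (res z (y - (w - z) *\<^sub>C x1) - res z (y - (w - z) *\<^sub>C x2)) \<le> onorm (res z) * norm ((w - z) *\<^sub>C (x2 - x1))"
          by (simp only: resolvent_facts(5)[OF z])
        also have "\<dots> = onorm (res z) * (cmod (w - z) * norm (x2 - x1))" by (simp only: norm_scaleC)
        also have "\<dots> \<le> N * (cmod (w - z) * norm (x2 - x1))" using N by (intro mult_right_mono) auto
        also have "\<dots> = (cmod (w - z) * N) * norm (x2 - x1)" by simp
        also have "\<dots> \<le> 1 / 2 * norm (x2 - x1)" using d by (intro mult_right_mono) auto
        finally show "dist (res z (y - (w - z) *\<^sub>C x1)) (res z (y - (w - z) *\<^sub>C x2)) \<le> 1 / 2 * dist x1 x2"
          by (simp add: dist_norm norm_minus_commute)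
      qed
      then obtain x where x: "res z (y - (w - z) *\<^sub>C x) = x" by auto
      have "z *\<^sub>C x - A x = y - (w - z) *\<^sub>C x" using resolvent_facts(2)[OF z, of "y - (w - z) *\<^sub>C x"] x by simp
      then have "w *\<^sub>C x - A x = y" unfolding scaleC_minus_left by (simp add: algebra_simps)
      moreover have "x \<in> D" using resolvent_facts(1)[OF z, of "y - (w - z) *\<^sub>C x"] x by simp
      ultimately show ?thesis by blast
    qed
    have inj: "x1 = x2" if "x1 \<in> D" "x2 \<in> D" "w *\<^sub>C x1 - A x1 = w *\<^sub>C x2 - A x2" for x1 x2
    proof -
      have "w *\<^sub>C (x1 - x2) - A (x1 - x2) = 0"
        using that by (simp add: generator_diff scaleC_minus_right algebra_simps)
      then have "norm (x1 - x2) \<le> 2 * N * norm (0::'a)"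
        by (rule norm_bound_near[OF z N(2) d generator_diff(1)[OF that(1,2)]])
      then show ?thesis by simp
    qed
    have bij: "bij_betw (\<lambda>x. w *\<^sub>C x - A x) D UNIV"
      unfolding bij_betw_def inj_on_def using inj ex by (auto simp: image_iff) metis
    have rD: "res w y \<in> D" and req: "w *\<^sub>C res w y - A (res w y) = y" for y
    proof -
      have "y \<in> (\<lambda>x. w *\<^sub>C x - A x) ` D" using bij by (simp add: bij_betw_def)
      then show "res w y \<in> D" "w *\<^sub>C res w y - A (res w y) = y"
        unfolding resolvent_def
        using f_inv_into_f[of y "\<lambda>x. w *\<^sub>C x - A x" D] by (auto intro: inv_into_into)
    qed
    have sc: "res w (c *\<^sub>C y) = c *\<^sub>C res w y" for c y
    proof (rule inj)
      show "w *\<^sub>C res w (c *\<^sub>C y) - A (res w (c *\<^sub>C y)) = w *\<^sub>C (c *\<^sub>C res w y) - A (c *\<^sub>C res w y)"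
      proof -
        have "w *\<^sub>C (c *\<^sub>C res w y) - A (c *\<^sub>C res w y) = c *\<^sub>C (w *\<^sub>C res w y - A (res w y))"
          by (simp add: generator_scaleC rD scaleC_minus_right scaleC_scaleC mult.commute)
        then show ?thesis by (simp add: req)
      qed
    qed (auto intro: rD generator_scaleC)
    have "bounded_linear (res w)"
    proof (rule bounded_linear_intro[where K = "2 * N"])
      show "res w (x + y) = res w x + res w y" for x y
      proof (rule inj)
        have "w *\<^sub>C (res w x + res w y) - A (res w x + res w y)
            = (w *\<^sub>C res w x - A (res w x)) + (w *\<^sub>C res w y - A (res w y))"
          by (simp add: generator_add rD scaleC_add_right)
        then show "w *\<^sub>C res w (x + y) - A (res w (x + y)) = w *\<^sub>C (res w x + res w y) - A (res w x + res w y)"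
          by (simp add: req)
      qed (auto intro: rD generator_add)
      show "res w (r *\<^sub>R x) = r *\<^sub>R res w x" for r x by (simp add: scaleR_scaleC sc)
      show "norm (res w x) \<le> norm x * (2 * N)" for x
        using norm_bound_near[OF z N(2) d rD req] by (simp add: mult.commute)
    qed
    then have "bounded_clinear (res w)" using sc by (simp add: bounded_clinear_def)
    then show ?thesis using bij by (simp add: spectrum_def)
  qed
  then show ?thesis using N by (intro exI[of _ "1 / (2 * N)"]) auto
qed

text \<open>With \<open>z\<close> on the imaginary axis this carries a resolvent bound into the open
  right half plane, where the resolvent is the Laplace transform of the semigroup.\<close>

lemma lap_bound_resolvent:
  assumes w: "Re w > 0" and z: "z \<notin> spectrum D A" and N: "onorm (res z) \<le> N" and d: "cmod (w - z) * N \<le> 1 / 2"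
  shows "norm (lap w x) \<le> 2 * N * norm x"
  by (rule norm_bound_near[OF z N d lap_in_domain(1)[OF w]]) (simp add: lap_in_domain(2)[OF w])

lemma resolvent_bound_near:
  assumes z: "z \<notin> spectrum D A" and w: "w \<notin> spectrum D A" and d: "cmod (w - z) * onorm (res z) \<le> 1 / 2"
  shows "onorm (res w) \<le> 2 * onorm (res z)"
proof (rule onorm_bound)
  show "0 \<le> 2 * onorm (res z)" using onorm_pos_le[OF resolvent_facts(4)[OF z]] by simp
  fix y
  have N: "onorm (res z) \<le> onorm (res z)" by simp
  show "norm (res w y) \<le> 2 * onorm (res z) * norm y"
    by (rule norm_bound_near[OF z N d, of "res w y" y]; rule resolvent_facts[OF w])
qed

definition int_semigroup :: "real \<Rightarrow> 'a \<Rightarrow> 'a" where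
  "int_semigroup t x = integral {0..t} (\<lambda>s. S s x)"

lemma S_integrable_on: "(\<lambda>s. S s x) integrable_on {a..b}"
  by (intro integrable_continuous_real continuous_on_subset[OF S_continuous]) auto

lemma int_semigroup_shift:
  assumes "0 \<le> h"
  shows "T h (int_semigroup t x) = integral {0 + h..t + h} (\<lambda>s. S s x)"
proof -
  have bl: "bounded_linear (S h)" using S_bounded_clinear by (simp add: bounded_clinear_def)
  have "T h (int_semigroup t x) = integral {0..t} (S h \<circ> (\<lambda>s. S s x))"
    unfolding int_semigroup_def using integral_linear[OF S_integrable_on bl] assms by simp
  also have "\<dots> = integral {0..t} ((\<lambda>s. S s x) \<circ> ((+) h))"
    by (rule integral_cong) (use assms in \<open>simp add: T_add\<close>)
  also have "\<dots> = integral {0 + h..t + h} (\<lambda>s. S s x)" by (rule integral_shift_Icc_real)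
  finally show ?thesis .
qed

lemma int_semigroup_domain:
  assumes t: "0 \<le> t"
  shows "int_semigroup t x \<in> D" "A (int_semigroup t x) = T t x - x"
proof -
  have "((\<lambda>h. (1 / h) *\<^sub>R integral {t..t + h} (\<lambda>s. S s x) - (1 / h) *\<^sub>R integral {0..0 + h} (\<lambda>s. S s x)) \<longlongrightarrow> S t x - S 0 x) (at_right 0)"
    by (intro tendsto_diff tendsto_average_at_right continuous_on_subset[OF S_continuous]) auto
  moreover have "\<forall>\<^sub>F h in at_right 0. (1 / h) *\<^sub>R integral {t..t + h} (\<lambda>s. S s x) - (1 / h) *\<^sub>R integral {0..0 + h} (\<lambda>s. S s x)
     = (1 / h) *\<^sub>R (T h (int_semigroup t x) - int_semigroup t x)"
    using eventually_at_right_less[of "0::real"]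
  proof eventually_elim
    case (elim h)
    have "integral {0..h} (\<lambda>s. S s x) + integral {h..t + h} (\<lambda>s. S s x) = integral {0..t + h} (\<lambda>s. S s x)"
      "integral {0..t} (\<lambda>s. S s x) + integral {t..t + h} (\<lambda>s. S s x) = integral {0..t + h} (\<lambda>s. S s x)"
      using elim t by (intro Henstock_Kurzweil_Integration.integral_combine S_integrable_on; simp)+
    then have "T h (int_semigroup t x) - int_semigroup t x = integral {t..t + h} (\<lambda>s. S s x) - integral {0..h} (\<lambda>s. S s x)"
      using int_semigroup_shift[of h t x] elim by (simp add: int_semigroup_def algebra_simps)
    then show ?case by (simp add: scaleR_diff_right)
  qed
  ultimately have "((\<lambda>h. (1 / h) *\<^sub>R (T h (int_semigroup t x) - int_semigroup t x)) \<longlongrightarrow> S t x - S 0 x) (at_right 0)"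
    by (rule Lim_transform_eventually)
  from generatorI[OF this] show "int_semigroup t x \<in> D" "A (int_semigroup t x) = T t x - x" using t by auto
qed

lemma int_semigroup_linear: "bounded_linear (int_semigroup t)"
proof (rule bounded_linear_intro[where K = "\<bar>t\<bar> * M"])
  show "int_semigroup t (x + y) = int_semigroup t x + int_semigroup t y" for x y
    unfolding int_semigroup_def S_linear by (intro integral_add S_integrable_on)
  show "int_semigroup t (r *\<^sub>R x) = r *\<^sub>R int_semigroup t x" for r x
    unfolding int_semigroup_def S_linear by (rule integral_cmul)
  show "norm (int_semigroup t x) \<le> norm x * (\<bar>t\<bar> * M)" for x
  proof (cases "0 \<le> t")
    case True
    have "norm (integral {0..t} (\<lambda>s. S s x)) \<le> (M * norm x) * (t - 0)"
      using True by (intro integral_bound continuous_on_subset[OF S_continuous] S_bound) auto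
    then show ?thesis using True by (simp add: int_semigroup_def mult_ac)
  next
    case False
    then have "int_semigroup t x = 0" by (simp add: int_semigroup_def)
    moreover have "0 \<le> norm x * (\<bar>t\<bar> * M)" using M_ge1 by (intro mult_nonneg_nonneg) auto
    ultimately show ?thesis by (simp only: norm_zero)
  qed
qed

text \<open>\<open>A\<close> commutes with \<open>int_semigroup t\<close> because \<open>T\<close>
  does, so the known value of \<open>A (int_semigroup t x)\<close> carries over.\<close>

lemma int_semigroup_generator:
  assumes x: "x \<in> D" and t: "0 \<le> t"
  shows "int_semigroup t (A x) = T t x - x"
proof -
  have comm: "T h (int_semigroup t y) = int_semigroup t (T h y)" if "0 \<le> h" for h y
  proof -
    have bl: "bounded_linear (S h)" using S_bounded_clinear by (simp add: bounded_clinear_def)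
    have "T h (int_semigroup t y) = integral {0..t} (S h \<circ> (\<lambda>s. S s y))"
      unfolding int_semigroup_def using integral_linear[OF S_integrable_on bl] that by simp
    also have "\<dots> = integral {0..t} (\<lambda>s. S s (T h y))"
      by (rule integral_cong) (use that in \<open>simp add: T_add[symmetric] add.commute\<close>)
    finally show ?thesis by (simp add: int_semigroup_def)
  qed
  show ?thesis
    using generator_commute(2)[OF int_semigroup_linear comm x] int_semigroup_domain(2)[OF t, of x] by simp
qed

text \<open>Let \<open>Z s\<close> be the integral of \<open>z\<close> over \<open>{0..s}\<close>.
  Formally \<open>S (t - s) (Z s)\<close> has derivative
  \<open>S (t - s) (z s - A (Z s)) = 0\<close> in \<open>s\<close>, and its values at s = 0 and s =
  t are 0 and \<open>Z t\<close>. Hence \<open>Z t = 0\<close>, and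
  \<open>z t = A (Z t) = 0\<close>.\<close>

lemma homogeneous_unique:
  fixes z :: "real \<Rightarrow> 'a"
  assumes z: "continuous_on {0..} z" and D: "\<And>t. 0 \<le> t \<Longrightarrow> integral {0..t} z \<in> D"
    and eq: "\<And>t. 0 \<le> t \<Longrightarrow> A (integral {0..t} z) = z t" and t: "0 \<le> t"
  shows "z t = 0"
proof -
  define Z where "Z t = integral {0..t} z" for t
  have zi: "z integrable_on {a..b}" if "0 \<le> a" for a b
  proof (rule integrable_continuous_real)
    show "continuous_on {a..b} z" by (rule continuous_on_subset[OF z]) (use that in auto)
  qed
  define F where "F s = S (t - s) (Z s)" for s
  \<comment> \<open>Because \<open>A (Z s) = z s\<close>, the orbit of \<open>Z s\<close> moves by
    the integral of \<open>S (r - s) (z s)\<close>. The increment of \<open>F\<close> is thus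
    governed by \<open>z r - S (r - s) (z s)\<close>, which joint continuity makes small when
    \<open>r\<close> and \<open>s\<close> are near \<open>s0\<close>.\<close>
  have step: "F s' - F s = S (t - s') (integral {s..s'} (\<lambda>r. z r - S (r - s) (z s)))" if s: "0 \<le> s" "s \<le> s'" "s' \<le> t" for s s'
  proof -
    have 1: "Z s' - Z s = integral {s..s'} z"
      using Henstock_Kurzweil_Integration.integral_combine[of 0 s s' z] s zi by (simp add: Z_def algebra_simps)
    have "int_semigroup (s' - s) (z s) = integral {0..s' - s} ((\<lambda>r. S (r - s) (z s)) \<circ> ((+) s))"
      unfolding int_semigroup_def by (simp add: comp_def)
    also have "\<dots> = integral {s..s'} (\<lambda>r. S (r - s) (z s))"
      using integral_shift_Icc_real[of 0 "s' - s" "\<lambda>r. S (r - s) (z s)" s] by simp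
    finally have 2: "T (s' - s) (Z s) - Z s = integral {s..s'} (\<lambda>r. S (r - s) (z s))"
      using int_semigroup_generator[of "Z s" "s' - s"] D[of s] eq[of s] s by (simp add: Z_def)
    have c: "continuous_on {s..s'} (\<lambda>r. S (r - s) (z s))"
      by (rule continuous_on_compose2[OF S_continuous]) (auto intro!: continuous_intros)
    have "Z s' - T (s' - s) (Z s) = integral {s..s'} z - integral {s..s'} (\<lambda>r. S (r - s) (z s))"
      using 1 2 by (metis add_diff_cancel_left' diff_add_cancel diff_diff_eq2 add.commute)
    also have "\<dots> = integral {s..s'} (\<lambda>r. z r - S (r - s) (z s))"
      using s zi by (intro integral_diff[symmetric] integrable_continuous_real[OF c]) auto
    finally have 3: "Z s' - T (s' - s) (Z s) = integral {s..s'} (\<lambda>r. z r - S (r - s) (z s))" .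
    have "F s = S (t - s') (T (s' - s) (Z s))"
      using s T_add[of "t - s'" "s' - s" "Z s"] by (simp add: F_def)
    then have "F s' - F s = S (t - s') (Z s' - T (s' - s) (Z s))" by (simp add: F_def S_linear)
    then show ?thesis using 3 by simp
  qed
  have "F t = F 0"
  proof (rule has_vector_derivative_zero_constant[of "{0..t}" F])
    show "convex {0..t}" by simp
    fix s0 assume s0: "s0 \<in> {0..t}"
    show "(F has_vector_derivative 0) (at s0 within {0..t})"
      unfolding has_vector_derivative_def has_derivative_within_alt
    proof (intro conjI allI impI)
      show "bounded_linear (\<lambda>x. x *\<^sub>R (0::'a))" by simp
      fix e :: real assume e: "e > 0"
      have zs: "continuous (at s0 within {0..t}) z"
        using continuous_on_subset[OF z, of "{0..t}"] s0 by (auto simp: continuous_on_eq_continuous_within)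
      \<comment> \<open>The limit is taken over the square because both times vary; at
        \<open>(s0, s0)\<close> the expression vanishes, \<open>S 0\<close> being the
        identity.\<close>
      define B where "B = {0..t} \<times> {0..t}"
      have "((\<lambda>p. z (snd p) - S (snd p - fst p) (z (fst p))) \<longlongrightarrow> z s0 - S (s0 - s0) (z s0)) (at (s0, s0) within B)"
      proof -
        have c: "continuous_on B (\<lambda>p. z (fst p))" "continuous_on B (\<lambda>p. z (snd p))"
          by (rule continuous_on_compose2[OF z]; auto simp: B_def intro!: continuous_intros)+
        have f: "((\<lambda>p. z (fst p)) \<longlongrightarrow> z s0) (at (s0, s0) within B)" "((\<lambda>p. z (snd p)) \<longlongrightarrow> z s0) (at (s0, s0) within B)"
          using bspec[OF c(1)[unfolded continuous_on_def], of "(s0, s0)"]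
            bspec[OF c(2)[unfolded continuous_on_def], of "(s0, s0)"] s0 by (simp_all add: B_def)
        have sf: "((\<lambda>p. snd p - fst p) \<longlongrightarrow> s0 - s0) (at (s0, s0) within B)"
          using tendsto_diff[OF tendsto_snd[OF tendsto_ident_at[of "(s0, s0)" B]] tendsto_fst[OF tendsto_ident_at[of "(s0, s0)" B]]]
          by simp
        show ?thesis by (rule tendsto_diff[OF f(2) S_tendsto[OF sf f(1)]])
      qed
      moreover have eM: "e / M > 0" using e M_ge1 by simp
      ultimately have "\<forall>\<^sub>F p in at (s0, s0) within B. dist (z (snd p) - S (snd p - fst p) (z (fst p))) (z s0 - S (s0 - s0) (z s0)) < e / M"
        by (rule tendstoD)
      then obtain d where d: "d > 0" and dd: "\<And>p. p \<in> B \<Longrightarrow> p \<noteq> (s0, s0) \<Longrightarrow> dist p (s0, s0) < d \<Longrightarrow>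
           norm (z (snd p) - S (snd p - fst p) (z (fst p))) < e / M"
        unfolding eventually_at by auto
      have small: "norm (z r - S (r - s) (z s)) \<le> e / M" if "s \<in> {0..t}" "r \<in> {0..t}" "\<bar>s - s0\<bar> + \<bar>r - s0\<bar> < d" for s r
      proof (cases "(s, r) = (s0, s0)")
        case True then show ?thesis using eM by simp
      next
        case False
        have "dist (s, r) (s0, s0) \<le> \<bar>s - s0\<bar> + \<bar>r - s0\<bar>"
          unfolding dist_Pair_Pair by (simp add: dist_real_def order_trans[OF sqrt_sum_squares_le_sum_abs])
        then show ?thesis using dd[of "(s, r)"] False that by (auto simp: B_def)
      qed
      have est: "norm (F s' - F s) \<le> e * (s' - s)"
        if s: "0 \<le> s" "s \<le> s'" "s' \<le> t" and near: "\<And>r. r \<in> {s..s'} \<Longrightarrow> \<bar>s - s0\<bar> + \<bar>r - s0\<bar> < d" for s s'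
      proof -
        have "continuous_on {s..s'} (\<lambda>r. z r - S (r - s) (z s))"
          by (intro continuous_on_diff continuous_on_subset[OF z] continuous_on_compose2[OF S_continuous])
             (use s in \<open>auto intro!: continuous_intros\<close>)
        then have "norm (integral {s..s'} (\<lambda>r. z r - S (r - s) (z s))) \<le> e / M * (s' - s)"
          using s near by (intro integral_bound small) auto
        then have "norm (F s' - F s) \<le> M * (e / M * (s' - s))"
          unfolding step[OF s] using M_ge1 by (intro order_trans[OF S_bound] mult_left_mono) auto
        then show ?thesis using M_ge1 by simp
      qed
      show "\<exists>d>0. \<forall>y\<in>{0..t}. norm (y - s0) < d \<longrightarrow> norm (F y - F s0 - (y - s0) *\<^sub>R 0) \<le> e * norm (y - s0)"
      proof (intro exI[of _ "d / 2"] conjI ballI impI)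
        show "d / 2 > 0" using d by simp
        fix y assume y: "y \<in> {0..t}" "norm (y - s0) < d / 2"
        show "norm (F y - F s0 - (y - s0) *\<^sub>R 0) \<le> e * norm (y - s0)"
        proof (cases "s0 \<le> y")
          case True
          then show ?thesis using est[of s0 y] y s0 by (auto simp: abs_if split: if_splits)
        next
          case False
          then have "norm (F s0 - F y) \<le> e * (s0 - y)" using y s0 by (intro est) (auto simp: abs_if split: if_splits)
          then show ?thesis using False by (simp add: norm_minus_commute abs_if)
        qed
      qed
    qed
  next
    fix c assume "\<And>s. s \<in> {0..t} \<Longrightarrow> F s = c"
    then show "F t = F 0" using t by simp
  qed
  then have "Z t = 0" by (simp add: F_def Z_def S_linear)
  then show ?thesis using eq[OF t] generator_diff(2)[OF D[OF t] D[OF t]] by (simp add: Z_def)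
qed

lemma mild_solution_unique:
  assumes u: "mild_solution D A \<phi> u" and v: "mild_solution D A \<phi> v" and "u 0 = v 0" and t: "0 \<le> t"
  shows "u t = v t"
proof -
  have cu: "continuous_on {0..} u" and cv: "continuous_on {0..} v" using u v by (auto simp: mild_solution_def)
  have ui: "u integrable_on {0..s}" "v integrable_on {0..s}" for s
    using cu cv by (auto intro!: integrable_continuous_real intro: continuous_on_subset)
  have mild: "integral {0..s} w \<in> D" "w s = w 0 + A (integral {0..s} w) + bochner_integral (lebesgue_on {0..s}) \<phi>"
    if "mild_solution D A \<phi> w" "0 \<le> s" for w s
  proof -
    have "continuous_on {0..} w" using that(1) by (simp add: mild_solution_def)
    note b = bochner_integral_continuous[OF this that(2)]
    have "bochner_integral (lebesgue_on {0..s}) w \<in> D \<and>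
        w s = w 0 + A (bochner_integral (lebesgue_on {0..s}) w) + bochner_integral (lebesgue_on {0..s}) \<phi>"
      using that unfolding mild_solution_def by blast
    then show "integral {0..s} w \<in> D" "w s = w 0 + A (integral {0..s} w) + bochner_integral (lebesgue_on {0..s}) \<phi>"
      unfolding b by blast+
  qed
  note Du = mild[OF u] and Dv = mild[OF v]
  have "(\<lambda>t. u t - v t) t = 0"
  proof (rule homogeneous_unique[OF _ _ _ t])
    show "continuous_on {0..} (\<lambda>t. u t - v t)" by (intro continuous_on_diff cu cv)
    fix s :: real assume s: "0 \<le> s"
    have i: "integral {0..s} (\<lambda>t. u t - v t) = integral {0..s} u - integral {0..s} v"
      by (rule integral_diff[OF ui])
    show "integral {0..s} (\<lambda>t. u t - v t) \<in> D" unfolding i by (rule generator_diff[OF Du(1)[OF s] Dv(1)[OF s]])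
    show "A (integral {0..s} (\<lambda>t. u t - v t)) = u s - v s"
      unfolding i generator_diff[OF Du(1)[OF s] Dv(1)[OF s]]
      using Du(2)[OF s] Dv(2)[OF s] \<open>u 0 = v 0\<close> by (simp add: algebra_simps)
  qed
  then show ?thesis by simp
qed

end

section \<open>Derivatives of Fourier transforms and powers of the Laplace transform\<close>

lemma has_vector_derivative_quotientI:
  fixes f :: "real \<Rightarrow> 'b::real_normed_vector"
  assumes "((\<lambda>h. (1 / h) *\<^sub>R (f (a + h) - f a)) \<longlongrightarrow> d) (at 0)"
  shows "(f has_vector_derivative d) (at a)"
  unfolding has_vector_derivative_def has_derivative_at
proof
  show "bounded_linear (\<lambda>x. x *\<^sub>R d)" by (rule bounded_linear_scaleR_left)
  have "((\<lambda>h. norm ((1 / h) *\<^sub>R (f (a + h) - f a) - d)) \<longlongrightarrow> 0) (at 0)"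
    using assms by (simp add: LIM_zero tendsto_norm_zero)
  moreover have "\<forall>\<^sub>F h in at 0. norm ((1 / h) *\<^sub>R (f (a + h) - f a) - d) = norm (f (a + h) - f a - h *\<^sub>R d) / norm h"
  proof -
    have "norm ((1 / h) *\<^sub>R (f (a + h) - f a) - d) = norm (f (a + h) - f a - h *\<^sub>R d) / norm h" if "h \<noteq> 0" for h
    proof -
      have "(1 / h) *\<^sub>R (f (a + h) - f a) - d = (1 / h) *\<^sub>R (f (a + h) - f a - h *\<^sub>R d)"
        using that by (simp add: scaleR_diff_right)
      then show ?thesis by (simp add: divide_inverse mult.commute)
    qed
    then show ?thesis by (simp add: eventually_at_filter)
  qed
  ultimately show "((\<lambda>h. norm (f (a + h) - f a - h *\<^sub>R d) / norm h) \<longlongrightarrow> 0) (at 0)"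
    by (rule Lim_transform_eventually)
qed

lemma norm_cis_diff: "cmod (cis a - cis b) \<le> \<bar>a - b\<bar>"
proof -
  have "cis a - cis b = cis b * (cis (a - b) - 1)" by (simp add: cis_mult algebra_simps)
  then have "cmod (cis a - cis b) = cmod (cis (a - b) - 1)" by (simp add: norm_mult)
  also have "\<dots> \<le> \<bar>a - b\<bar>" using iexp_approx1[of "a - b" 0] by (simp add: cis_conv_exp)
  finally show ?thesis .
qed

text \<open>The difference quotients of the exponential in \<open>s\<close> are bounded by |t|, so
  \<open>t * f t\<close> provides the dominating function.\<close>

lemma ft_has_vector_derivative:
  assumes f: "integrable lborel f" and tf: "integrable lborel (\<lambda>t. complex_of_real t * f t)"
  shows "(ft f has_vector_derivative ft (\<lambda>t. - (\<i> * t * f t)) s) (at s)"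
proof (rule has_vector_derivative_quotientI)
  have [measurable]: "f \<in> borel_measurable borel" using f by auto
  show "((\<lambda>h. (1 / h) *\<^sub>R (ft f (s + h) - ft f s)) \<longlongrightarrow> ft (\<lambda>t. - (\<i> * t * f t)) s) (at 0)"
    unfolding tendsto_at_iff_sequentially
  proof (intro allI impI)
    fix X :: "nat \<Rightarrow> real" assume X: "\<forall>i. X i \<in> UNIV - {0}" "X \<longlonglongrightarrow> 0"
    have X0: "X i \<noteq> 0" for i using X(1) by auto
    have quot: "(1 / X n) *\<^sub>R (ft f (s + X n) - ft f s) = (LBINT t. f t * ((1 / X n) *\<^sub>R (cis (- ((s + X n) * t)) - cis (- (s * t)))))" for n
    proof -
      have "ft f (s + X n) - ft f s = (LBINT t. f t * cis (- ((s + X n) * t)) - f t * cis (- (s * t)))"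
        unfolding ft_def by (intro Bochner_Integration.integral_diff[symmetric] integrable_mult_cis f)
      then have "(1 / X n) *\<^sub>R (ft f (s + X n) - ft f s) = (LBINT t. (1 / X n) *\<^sub>R (f t * cis (- ((s + X n) * t)) - f t * cis (- (s * t))))"
        by simp
      then show ?thesis by (simp add: right_diff_distrib)
    qed
    have "(\<lambda>n. LBINT t. f t * ((1 / X n) *\<^sub>R (cis (- ((s + X n) * t)) - cis (- (s * t))))) \<longlonglongrightarrow> (LBINT t. - (\<i> * t * f t) * cis (- (s * t)))"
    proof (rule integral_dominated_convergence[where w = "\<lambda>t. cmod (complex_of_real t * f t)"])
      show "integrable lborel (\<lambda>t. cmod (complex_of_real t * f t))" using tf by (rule integrable_norm)
      show "AE t in lborel. cmod (f t * ((1 / X n) *\<^sub>R (cis (- ((s + X n) * t)) - cis (- (s * t))))) \<le> cmod (complex_of_real t * f t)" for n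
      proof (intro AE_I2)
        fix t
        have "cmod (cis (- ((s + X n) * t)) - cis (- (s * t))) \<le> \<bar>X n\<bar> * \<bar>t\<bar>"
          using norm_cis_diff[of "- ((s + X n) * t)" "- (s * t)"] by (simp add: algebra_simps abs_mult)
        then have "cmod (cis (- ((s + X n) * t)) - cis (- (s * t))) / \<bar>X n\<bar> \<le> \<bar>X n\<bar> * \<bar>t\<bar> / \<bar>X n\<bar>"
          by (intro divide_right_mono) auto
        then have "cmod ((1 / X n) *\<^sub>R (cis (- ((s + X n) * t)) - cis (- (s * t)))) \<le> \<bar>t\<bar>"
          using X0[of n] unfolding norm_scaleR by simp
        then show "cmod (f t * ((1 / X n) *\<^sub>R (cis (- ((s + X n) * t)) - cis (- (s * t))))) \<le> cmod (complex_of_real t * f t)"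
          unfolding norm_mult norm_of_real mult.commute[of "\<bar>t\<bar>"] by (rule mult_left_mono) simp
      qed
      show "AE t in lborel. (\<lambda>n. f t * ((1 / X n) *\<^sub>R (cis (- ((s + X n) * t)) - cis (- (s * t))))) \<longlonglongrightarrow> - (\<i> * t * f t) * cis (- (s * t))"
      proof (intro AE_I2)
        fix t
        have "((\<lambda>s. cis (- (s * t))) has_vector_derivative - (\<i> * t) * cis (- (s * t))) (at s)"
          unfolding has_vector_derivative_def
          by (auto intro!: derivative_eq_intros simp: fun_eq_iff scaleR_conv_of_real)
        then have "((\<lambda>h. (1 / norm h) *\<^sub>R (cis (- ((s + h) * t)) - cis (- (s * t)) - h *\<^sub>R (- (\<i> * t) * cis (- (s * t))))) \<longlongrightarrow> 0) (at 0)"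
          unfolding has_vector_derivative_def has_derivative_at
          by (subst tendsto_norm_zero_iff[symmetric]) (simp add: divide_inverse mult.commute)
        then have "(\<lambda>n. norm ((1 / norm (X n)) *\<^sub>R (cis (- ((s + X n) * t)) - cis (- (s * t)) - X n *\<^sub>R (- (\<i> * t) * cis (- (s * t)))))) \<longlonglongrightarrow> 0"
          using X unfolding tendsto_at_iff_sequentially comp_def by (intro tendsto_norm_zero) blast
        moreover have "norm ((1 / norm (X n)) *\<^sub>R (cis (- ((s + X n) * t)) - cis (- (s * t)) - X n *\<^sub>R (- (\<i> * t) * cis (- (s * t)))))
            = norm ((1 / X n) *\<^sub>R (cis (- ((s + X n) * t)) - cis (- (s * t))) - (- (\<i> * t) * cis (- (s * t))))" for n
        proof -
          have "(1 / X n) *\<^sub>R (cis (- ((s + X n) * t)) - cis (- (s * t))) - (- (\<i> * t) * cis (- (s * t)))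
            = (1 / X n) *\<^sub>R (cis (- ((s + X n) * t)) - cis (- (s * t)) - X n *\<^sub>R (- (\<i> * t) * cis (- (s * t))))"
            using X0[of n] by (simp only: scaleR_diff_right scaleR_scaleR) simp
          then show ?thesis by (simp only: norm_scaleR) simp
        qed
        ultimately have "(\<lambda>n. (1 / X n) *\<^sub>R (cis (- ((s + X n) * t)) - cis (- (s * t))) - (- (\<i> * t) * cis (- (s * t)))) \<longlonglongrightarrow> 0"
          using tendsto_norm_zero_cancel by (simp only:)
        then have "(\<lambda>n. (1 / X n) *\<^sub>R (cis (- ((s + X n) * t)) - cis (- (s * t)))) \<longlonglongrightarrow> - (\<i> * t) * cis (- (s * t))"
          by (rule LIM_zero_cancel)
        then have "(\<lambda>n. f t * ((1 / X n) *\<^sub>R (cis (- ((s + X n) * t)) - cis (- (s * t))))) \<longlonglongrightarrow> f t * (- (\<i> * t) * cis (- (s * t)))"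
          by (intro tendsto_mult tendsto_const)
        then show "(\<lambda>n. f t * ((1 / X n) *\<^sub>R (cis (- ((s + X n) * t)) - cis (- (s * t))))) \<longlonglongrightarrow> - (\<i> * t * f t) * cis (- (s * t))"
          by (simp add: mult_ac)
      qed
    qed measurable
    then show "((\<lambda>h. (1 / h) *\<^sub>R (ft f (s + h) - ft f s)) \<circ> X) \<longlonglongrightarrow> ft (\<lambda>t. - (\<i> * t * f t)) s"
      unfolding comp_def quot by (simp add: ft_def)
  qed
qed

lemma ft_bounded: "cmod (ft f s) \<le> (LBINT t. cmod (f t))"
  unfolding ft_def using integral_norm_bound[of lborel "\<lambda>t. f t * cis (- (s * t))"] by (simp add: norm_mult)

lemma ft_continuous:
  assumes "integrable lborel f" shows "continuous_on UNIV (ft f)"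
proof -
  have "continuous_on UNIV (\<lambda>s. (\<lambda>t. LBINT s. f s * cis (s * t)) (- s))"
    by (rule continuous_on_compose2[OF continuous_fourier_integral[OF assms]]) (auto intro!: continuous_intros)
  then show ?thesis by (simp add: ft_def mult.commute[of _ "_ :: real"])
qed

lemma integral_power_diff:
  assumes v: "0 \<le> v"
  shows "(LBINT t. indicator {0..v} t *\<^sub>R ((v - t) ^ n / fact n :: real)) = v ^ Suc n / fact (Suc n)"
proof -
  define F where "F t = - ((v - t) ^ Suc n / fact (Suc n) :: real)" for t
  have "(F has_vector_derivative (v - t) ^ n / fact n) (at t within {0..v})" for t
  proof -
    have "((\<lambda>t. (v - t) ^ Suc n) has_real_derivative - (real (Suc n) * (v - t) ^ n)) (at t within {0..v})"
      by (auto intro!: derivative_eq_intros simp del: power_Suc)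
    then have "(F has_real_derivative - (- (real (Suc n) * (v - t) ^ n) / fact (Suc n))) (at t within {0..v})"
      unfolding F_def[abs_def] by (intro DERIV_minus DERIV_cdivide)
    then show ?thesis by (simp add: has_real_derivative_iff_has_vector_derivative del: of_nat_Suc)
  qed
  then have "(LBINT t. indicator {0..v} t *\<^sub>R ((v - t) ^ n / fact n :: real)) = F v - F 0"
    by (intro integral_FTC_atLeastAtMost v continuous_intros) auto
  then show ?thesis by (simp add: F_def)
qed

context bounded_semigroup
begin

lemma lap_kernel_power_integrable:
  assumes "Re z > 0"
  shows "integrable lborel (\<lambda>t. lap_kernel z t * complex_of_real (t ^ n))"
proof (rule Bochner_Integration.integrable_bound[OF integrable_power_times_exp[OF assms, of n]])
  show "AE t in lborel. norm (lap_kernel z t * complex_of_real (t ^ n)) \<le> norm (indicator {0..} t * (t ^ n * exp (- (Re z * t))))"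
    by (intro AE_I2) (simp add: norm_mult norm_lap_kernel abs_mult norm_power power_abs mult_ac)
qed measurable

lemma lap_kernel_functional_integrable:
  assumes z: "Re z > 0" and l: "functional_bound l c"
  shows "integrable lborel (\<lambda>t. lap_kernel z t * complex_of_real (t ^ n) * l (S t y))"
proof (rule integrable_mult_bounded(1)[OF lap_kernel_power_integrable[OF z]])
  show "(\<lambda>t. l (S t y)) \<in> borel_measurable borel"
    by (rule borel_measurable_continuous_onI[OF functional_S_continuous[OF l]])
  show "cmod (l (S t y)) \<le> \<bar>c\<bar> * M * norm y" for t
    using functional_bound_linear(3)[OF functional_bound_S[OF l]] .
qed

text \<open>Composing two Laplace integrals and substituting \<open>v = t + u\<close> leaves the
  integral of \<open>(v - t) ^ n / fact n\<close> over \<open>{0..v}\<close>, which raises the power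
  by one. The functional is generalised in the induction because the inner step uses
  \<open>l\<close> composed with \<open>S t\<close>. Thus multiplying an orbit by \<open>t\<close>
  corresponds to a further power of the resolvent.\<close>

lemma lap_power:
  assumes z: "Re z > 0" and l: "functional_bound l c"
  shows "l ((lap z ^^ Suc n) y) = (LBINT t. lap_kernel z t * complex_of_real (t ^ n) * l (S t y)) / fact n"
  using l
proof (induction n arbitrary: l c)
  case 0
  then show ?case using lap_functional(2)[OF z 0, of y] by simp
next
  case (Suc n)
  note l = Suc.prems
  define k where "k t = lap_kernel z t * complex_of_real (t ^ n)" for t
  have kint: "integrable lborel k" unfolding k_def[abs_def] by (rule lap_kernel_power_integrable[OF z])
  have [measurable]: "k \<in> borel_measurable borel" using kint by auto
  have sm: "simple_limit (lborel \<Otimes>\<^sub>M lborel) (\<lambda>p::real \<times> real. S (fst p) (S (snd p - fst p) y))"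
    by (intro simple_limit_S simple_limit_const) measurable
  have lm[measurable]: "(\<lambda>p::real \<times> real. l (S (fst p) (S (snd p - fst p) y))) \<in> borel_measurable (lborel \<Otimes>\<^sub>M lborel)"
    by (rule simple_limit_imp_borel_measurable[OF simple_limit_bounded_linear[OF functional_bound_linear(1)[OF l] sm]])
  have bound: "cmod (l (S t (S u y))) \<le> \<bar>c\<bar> * M * (M * norm y)" for t u
  proof -
    have "cmod (l (S t (S u y))) \<le> \<bar>c\<bar> * M * norm (S u y)"
      using functional_bound_linear(3)[OF functional_bound_S[OF l]] .
    also have "\<dots> \<le> \<bar>c\<bar> * M * (M * norm y)" using S_bound M_ge1 by (intro mult_left_mono) auto
    finally show ?thesis .
  qed
  have "l ((lap z ^^ Suc (Suc n)) y) = (LBINT t. lap_kernel z t * l (S t ((lap z ^^ Suc n) y)))"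
    using lap_functional(2)[OF z l, of "(lap z ^^ Suc n) y"] by simp
  also have "\<dots> = (LBINT t. lap_kernel z t * ((LBINT u. k u * l (S t (S u y))) / fact n))"
    using Suc.IH[OF functional_bound_S[OF l]] by (simp add: k_def)
  also have "\<dots> = (LBINT t. LBINT u. lap_kernel z t * (k u * l (S t (S u y))) / fact n)" by simp
  also have "\<dots> = (LBINT t. LBINT v. lap_kernel z t * (k (v - t) * l (S t (S (v - t) y))) / fact n)"
  proof (rule Bochner_Integration.integral_cong[OF refl])
    fix t
    show "(LBINT u. lap_kernel z t * (k u * l (S t (S u y))) / fact n) = (LBINT v. lap_kernel z t * (k (v - t) * l (S t (S (v - t) y))) / fact n)"
      using lborel_integral_real_affine[of 1 "\<lambda>u. lap_kernel z t * (k u * l (S t (S u y))) / fact n" "- t"] by simp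
  qed
  also have "\<dots> = (LBINT v. LBINT t. lap_kernel z t * (k (v - t) * l (S t (S (v - t) y))) / fact n)"
  proof (rule fubini_bound_swap[where g = "\<lambda>t. cmod (lap_kernel z t) * (\<bar>c\<bar> * M * (M * norm y) / fact n)" and k = "\<lambda>u. cmod (k u)" and c = "-1"])
    show "integrable lborel (\<lambda>t. cmod (lap_kernel z t) * (\<bar>c\<bar> * M * (M * norm y) / fact n))"
      using lap_kernel_integrable[OF z] by (intro integrable_mult_left integrable_norm)
    show "cmod (lap_kernel z t * (k (v - t) * l (S t (S (v - t) y))) / fact n)
        \<le> cmod (lap_kernel z t) * (\<bar>c\<bar> * M * (M * norm y) / fact n) * cmod (k (v + - 1 * t))" for t v
    proof -
      have "cmod (lap_kernel z t) * cmod (k (v - t)) * cmod (l (S t (S (v - t) y))) / fact n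
          \<le> cmod (lap_kernel z t) * cmod (k (v - t)) * (\<bar>c\<bar> * M * (M * norm y)) / fact n"
        using bound by (intro divide_right_mono mult_left_mono) auto
      then show ?thesis by (simp add: norm_mult norm_divide mult_ac)
    qed
    show "(\<lambda>(t, v). lap_kernel z t * (k (v - t) * l (S t (S (v - t) y))) / fact n) \<in> borel_measurable (lborel \<Otimes>\<^sub>M lborel)"
      using lm by (simp add: split_beta') measurable
  qed (use kint in auto)
  also have "\<dots> = (LBINT v. lap_kernel z v * complex_of_real (v ^ Suc n) * l (S v y) / fact (Suc n))"
  proof (rule Bochner_Integration.integral_cong[OF refl])
    fix v :: real
    show "(LBINT t. lap_kernel z t * (k (v - t) * l (S t (S (v - t) y))) / fact n) = lap_kernel z v * complex_of_real (v ^ Suc n) * l (S v y) / fact (Suc n)"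
    proof (cases "0 \<le> v")
      case True
      have "(LBINT t. lap_kernel z t * (k (v - t) * l (S t (S (v - t) y))) / fact n)
          = (LBINT t. (lap_kernel z v * l (S v y)) * complex_of_real (indicator {0..v} t *\<^sub>R ((v - t) ^ n / fact n)))"
      proof (rule Bochner_Integration.integral_cong[OF refl])
        fix t
        have e: "exp (- (z * t)) * exp (- (z * (v - t))) = exp (- (z * v))" by (simp add: exp_add[symmetric] algebra_simps)
        have "lap_kernel z t * (k (v - t) * l (S t (S (v - t) y))) / fact n
            = (exp (- (z * t)) * exp (- (z * (v - t)))) * l (S v y) * (v - t) ^ n / fact n" if "t \<in> {0..v}"
          using that by (simp add: k_def lap_kernel_def flip: T_add)
        then show "lap_kernel z t * (k (v - t) * l (S t (S (v - t) y))) / fact n = (lap_kernel z v * l (S v y)) * complex_of_real (indicator {0..v} t *\<^sub>R ((v - t) ^ n / fact n))"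
          unfolding e using True by (cases "t \<in> {0..v}") (auto simp: lap_kernel_def k_def)
      qed
      also have "\<dots> = (lap_kernel z v * l (S v y)) * complex_of_real (v ^ Suc n / fact (Suc n))"
        unfolding integral_mult_right_zero integral_complex_of_real integral_power_diff[OF True] ..
      finally show ?thesis by (simp add: mult_ac)
    next
      case False
      then have "lap_kernel z t * k (v - t) = 0" for t by (auto simp: lap_kernel_def k_def indicator_def)
      then have "lap_kernel z t * (k (v - t) * l (S t (S (v - t) y))) / fact n = 0" for t
        by (simp add: mult.assoc[symmetric])
      then show ?thesis using False by (simp only: integral_zero) (simp add: lap_kernel_def)
    qed
  qed
  finally show ?case by simp
qed

end

subsection \<open>The semigroup cut off in frequency\<close>

text \<open>
  \<open>B\<close> is the Fourier transform of an integrable function that equals 1 near the critical set, and \<open>N\<close> bounds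
  the resolvent on the rest of the imaginary axis, uniformly from the right.
\<close>

locale spectral_cutoff = bounded_semigroup +
  fixes B B' B'' :: "real \<Rightarrow> complex" and N :: "real \<Rightarrow> real" and L e0 Q :: real
  assumes B: "C2_compact B B' B''"
    and B_supp: "\<And>s. \<bar>s\<bar> > L \<Longrightarrow> B s = 0 \<and> B' s = 0 \<and> B'' s = 0"
    and N_bound: "\<And>e s x. 0 < e \<Longrightarrow> e \<le> e0 \<Longrightarrow> \<not> (B s = 1 \<and> B' s = 0 \<and> B'' s = 0) \<Longrightarrow>
        norm (lap (Complex e s) x) \<le> N s * norm x"
    and N_nonneg: "\<And>s. 0 \<le> N s" and N_le: "\<And>s. N s \<le> Q"
    and N_int: "integrable lborel (\<lambda>s. N s ^ 3)"
begin

definition \<psi> :: "real \<Rightarrow> complex" where "\<psi> = inv_ft B"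

lemma \<psi>_int: "integrable lborel \<psi>" unfolding \<psi>_def by (rule inv_ft_integrable[OF B])

lemma \<psi>_measurable [measurable]: "\<psi> \<in> borel_measurable borel" using \<psi>_int by auto

definition orbit :: "real \<Rightarrow> ('a \<Rightarrow> complex) \<Rightarrow> 'a \<Rightarrow> real \<Rightarrow> complex" where
  "orbit e l y t = lap_kernel (complex_of_real e) t * l (S t y)"

text \<open>The scalar \<open>l (H(q) y)\<close> for the operator kernel \<open>H\<close> of the
  overview. The vector \<open>y\<close> stays free, since it will be replaced by a value of the
  forcing term that depends on \<open>q\<close>.\<close>

definition conv_kernel :: "real \<Rightarrow> ('a \<Rightarrow> complex) \<Rightarrow> 'a \<Rightarrow> real \<Rightarrow> complex" where
  "conv_kernel e l y q = orbit e l y q - (LBINT r. orbit e l y r * \<psi> (q - r))"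

lemma orbit_power_integrable:
  assumes "0 < e" "functional_bound l c"
  shows "integrable lborel (\<lambda>t. complex_of_real (t ^ n) * orbit e l y t)"
  using lap_kernel_functional_integrable[of "complex_of_real e" l c n y] assms
  by (simp add: orbit_def mult_ac)

lemma orbit_bound:
  assumes "0 < e" "functional_bound l c" "0 \<le> c"
  shows "cmod (orbit e l y t) \<le> M * c * norm y"
proof -
  have "cmod (lap_kernel (complex_of_real e) t) \<le> 1"
    using assms(1) by (auto simp: norm_lap_kernel indicator_def)
  moreover have "cmod (l (S t y)) \<le> M * c * norm y"
    using functional_bound_linear(3)[OF functional_bound_S[OF assms(2)], of t y] assms(3) by (simp add: mult_ac)
  ultimately show ?thesis unfolding orbit_def norm_mult
    by (metis mult_left_le_one_le norm_ge_zero order_trans)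
qed

text \<open>The damping \<open>e\<close> moves the Fourier transform from the imaginary axis to the
  line of real part \<open>e\<close>, where the Laplace integral converges absolutely.\<close>

lemma ft_orbit:
  assumes "0 < e" "functional_bound l c"
  shows "ft (\<lambda>t. complex_of_real (t ^ n) * orbit e l y t) s = fact n * l ((lap (Complex e s) ^^ Suc n) y)"
proof -
  have "exp (- (complex_of_real e * t)) * cis (- (s * t)) = exp (- (Complex e s * t))" for t
    by (simp add: cis_conv_exp exp_add[symmetric] Complex_eq algebra_simps)
  then have "lap_kernel (complex_of_real e) t * cis (- (s * t)) = lap_kernel (Complex e s) t" for t
    by (simp add: lap_kernel_def)
  then have "complex_of_real (t ^ n) * orbit e l y t * cis (- (s * t)) = lap_kernel (Complex e s) t * complex_of_real (t ^ n) * l (S t y)" for t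
    unfolding orbit_def by (metis mult.assoc mult.commute)
  then have "ft (\<lambda>t. complex_of_real (t ^ n) * orbit e l y t) s = (LBINT t. lap_kernel (Complex e s) t * complex_of_real (t ^ n) * l (S t y))"
    unfolding ft_def by (simp only:)
  also have "\<dots> = fact n * l ((lap (Complex e s) ^^ Suc n) y)"
    using lap_power[of "Complex e s" l c n y] assms by (simp del: funpow.simps)
  finally show ?thesis .
qed

text \<open>A term-by-term bound for the second derivative of \<open>B - 1\<close> times the
  resolvent: \<open>B''\<close>, \<open>2 B'\<close> and \<open>B\<close> meet the resolvent and its
  first two derivatives, bounded by \<open>Q\<close>, \<open>Q ^ 2\<close> and
  \<open>2 * Q ^ 3\<close>, and the last summand is the part without \<open>B\<close>. Choosing
  \<open>b\<close> by \<open>SOME\<close> makes the function independent of \<open>e\<close>, of the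
  functional and of the vector.\<close>

definition majorant :: "real \<Rightarrow> real" where
  "majorant s = (let b = (SOME b. \<forall>s. cmod (B s) \<le> b \<and> cmod (B' s) \<le> b \<and> cmod (B'' s) \<le> b)
     in indicator {-L..L} s * (b * Q + 2 * b * Q ^ 2 + 2 * b * Q ^ 3) + 2 * N s ^ 3)"

lemma majorant_obtain:
  obtains b where "0 \<le> b" "\<And>s. cmod (B s) \<le> b" "\<And>s. cmod (B' s) \<le> b" "\<And>s. cmod (B'' s) \<le> b"
    "\<And>s. majorant s = indicator {-L..L} s * (b * Q + 2 * b * Q ^ 2 + 2 * b * Q ^ 3) + 2 * N s ^ 3"
proof -
  define b where "b = (SOME b. \<forall>s. cmod (B s) \<le> b \<and> cmod (B' s) \<le> b \<and> cmod (B'' s) \<le> b)"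
  have b: "\<forall>s. cmod (B s) \<le> b \<and> cmod (B' s) \<le> b \<and> cmod (B'' s) \<le> b"
    unfolding b_def using C2_compact_bounded[OF B] by (rule someI_ex)
  moreover have "0 \<le> b" using b order_trans[OF norm_ge_zero[of "B 0"]] by blast
  moreover have "majorant s = indicator {-L..L} s * (b * Q + 2 * b * Q ^ 2 + 2 * b * Q ^ 3) + 2 * N s ^ 3" for s
    by (simp add: majorant_def Let_def flip: b_def)
  ultimately show ?thesis using that by blast
qed

lemma Q_nonneg: "0 \<le> Q" using N_nonneg[of 0] N_le[of 0] by linarith

lemma indicator_integrable: "integrable lborel (\<lambda>s. indicator {-L..L} s * k :: real)"
  by (intro integrable_mult_left integrable_real_indicator) (auto simp: emeasure_lborel_Icc_eq)

lemma majorant_integrable: "integrable lborel majorant"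
proof -
  obtain b where "\<And>s. majorant s = indicator {-L..L} s * (b * Q + 2 * b * Q ^ 2 + 2 * b * Q ^ 3) + 2 * N s ^ 3"
    using majorant_obtain by metis
  then have "majorant = (\<lambda>s. indicator {-L..L} s * (b * Q + 2 * b * Q ^ 2 + 2 * b * Q ^ 3) + 2 * N s ^ 3)" by blast
  then show ?thesis
    using indicator_integrable N_int by (simp del: distrib_left_numeral)
qed

lemma majorant_nonneg: "0 \<le> majorant s"
proof -
  obtain b where b: "0 \<le> b" "\<And>s. majorant s = indicator {-L..L} s * (b * Q + 2 * b * Q ^ 2 + 2 * b * Q ^ 3) + 2 * N s ^ 3"
    using majorant_obtain by metis
  show ?thesis unfolding b(2) using b(1) Q_nonneg N_nonneg[of s]
    by (intro add_nonneg_nonneg mult_nonneg_nonneg) auto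
qed

text \<open>\<open>m\<close> is the second derivative of \<open>(B - 1) * \<rho> 0\<close>, where
  \<open>\<rho> n\<close> is \<open>l\<close> applied to the power n + 1 of the resolvent and
  differentiation raises the index. The two parts are inverted separately:
  \<open>B * \<rho> 0\<close> has compact support and is integrated by parts, while
  \<open>q\<^sup>2\<close> times the orbit is continuous with transform \<open>2 * \<rho> 2\<close>
  and falls under \<open>fourier_inversion\<close>.\<close>

lemma conv_kernel_fourier:
  assumes e: "0 < e" "e \<le> e0" and l: "functional_bound l c" and c: "0 \<le> c"
  obtains m where "m \<in> borel_measurable borel" "\<And>s. cmod (m s) \<le> majorant s * (c * norm y)"
    "\<And>q. complex_of_real (q\<^sup>2) * conv_kernel e l y q = (LBINT s. m s * cis (s * q)) / (2 * pi)"
proof -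
  define \<rho> where "\<rho> n s = l ((lap (Complex e s) ^^ Suc n) y)" for n s
  define g where "g n t = complex_of_real (t ^ n) * orbit e l y t" for n t
  have gint: "integrable lborel (g n)" for n unfolding g_def[abs_def] by (rule orbit_power_integrable[OF e(1) l])
  have ftg: "ft (g n) = (\<lambda>s. fact n * \<rho> n s)" for n
    unfolding g_def \<rho>_def using ft_orbit[OF e(1) l] by (simp add: fun_eq_iff)
  have \<rho>cont: "continuous_on UNIV (\<rho> n)" for n
  proof -
    have "continuous_on UNIV (\<lambda>s. inverse (fact n) * ft (g n) s)" by (intro continuous_intros ft_continuous gint)
    then show ?thesis unfolding ftg by (simp add: mult.assoc[symmetric])
  qed
  have \<rho>deriv: "(\<rho> n has_vector_derivative - (\<i> * Suc n) * \<rho> (Suc n) s) (at s)" for n s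
  proof -
    have eq: "complex_of_real t * g n t = g (Suc n) t" for t by (simp add: g_def)
    have "(ft (g n) has_vector_derivative ft (\<lambda>t. - (\<i> * t * g n t)) s) (at s)"
      by (rule ft_has_vector_derivative) (use gint eq in auto)
    also have "ft (\<lambda>t. - (\<i> * t * g n t)) s = - \<i> * ft (g (Suc n)) s"
    proof -
      have "- (\<i> * t * g n t) * cis (- (s * t)) = - \<i> * (g (Suc n) t * cis (- (s * t)))" for t
        by (simp add: eq[symmetric] mult_ac)
      then show ?thesis unfolding ft_def by (simp only: integral_mult_right_zero)
    qed
    finally have "((\<lambda>s. inverse (fact n) * ft (g n) s) has_vector_derivative inverse (fact n) * (- \<i> * ft (g (Suc n)) s)) (at s)"
      by (rule has_vector_derivative_mult_right)
    moreover have "inverse (fact n) * ((fact n :: complex) * x) = x" for x by (simp add: mult.assoc[symmetric])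
    moreover have "inverse (fact n) * (- \<i> * (fact (Suc n) * x)) = - (\<i> * Suc n) * x" for x :: complex
      by (simp add: field_simps)
    ultimately show ?thesis unfolding ftg by (simp only:)
  qed
  have \<rho>bound: "cmod (\<rho> n s) \<le> N s ^ Suc n * (c * norm y)" if Z: "\<not> (B s = 1 \<and> B' s = 0 \<and> B'' s = 0)" for n s
  proof -
    have "norm ((lap (Complex e s) ^^ k) y) \<le> N s ^ k * norm y" for k
    proof (induction k)
      case (Suc k)
      have "norm ((lap (Complex e s) ^^ Suc k) y) \<le> N s * norm ((lap (Complex e s) ^^ k) y)"
        using N_bound[OF e Z] by simp
      also have "\<dots> \<le> N s * (N s ^ k * norm y)" using N_nonneg Suc by (intro mult_left_mono) auto
      finally show ?case by (simp add: mult_ac)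
    qed simp
    then have "c * norm ((lap (Complex e s) ^^ Suc n) y) \<le> c * (N s ^ Suc n * norm y)"
      using c by (intro mult_left_mono)
    then show ?thesis unfolding \<rho>_def
      using functional_bound_linear(3)[OF l, of "(lap (Complex e s) ^^ Suc n) y"] by (simp add: mult_ac)
  qed
  define p where "p s = B s * \<rho> 0 s" for s
  define p' where "p' s = B s * (- \<i> * \<rho> 1 s) + B' s * \<rho> 0 s" for s
  define p'' where "p'' s = (B s * (- \<i> * (- (2 * \<i>) * \<rho> 2 s)) + B' s * (- \<i> * \<rho> 1 s)) + (B' s * (- \<i> * \<rho> 1 s) + B'' s * \<rho> 0 s)" for s
  have \<rho>0: "(\<rho> 0 has_vector_derivative - \<i> * \<rho> 1 s) (at s)" and \<rho>1: "(\<rho> 1 has_vector_derivative - (2 * \<i>) * \<rho> 2 s) (at s)" for s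
    using \<rho>deriv[of 0 s] \<rho>deriv[of 1 s] by (simp_all add: numeral_2_eq_2 mult_ac)
  have C2p: "C2_compact p p' p''"
    unfolding C2_compact_def
  proof (intro conjI allI)
    show "(p has_vector_derivative p' s) (at s)" for s
      unfolding p_def[abs_def] p'_def by (intro has_vector_derivative_mult \<rho>0 C2_compactD[OF B])
    show "(p' has_vector_derivative p'' s) (at s)" for s
      unfolding p'_def[abs_def] p''_def
      by (intro has_vector_derivative_add has_vector_derivative_mult has_vector_derivative_mult_right \<rho>0 \<rho>1 C2_compactD[OF B])
    show "continuous_on UNIV p''" unfolding p''_def[abs_def]
      by (intro continuous_intros \<rho>cont C2_compactD[OF B])
    show "\<exists>N. \<forall>s. \<bar>s\<bar> > N \<longrightarrow> p s = 0 \<and> p' s = 0 \<and> p'' s = 0"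
      using B_supp by (auto simp: p_def p'_def p''_def intro!: exI[of _ L])
  qed
  define m where "m s = p'' s + 2 * \<rho> 2 s" for s
  have mcont: "continuous_on UNIV m" unfolding m_def[abs_def]
    by (intro continuous_intros \<rho>cont C2_compactD[OF C2p])
  \<comment> \<open>The constant \<open>K\<close> depends on \<open>e\<close> and may blow up as
    \<open>e\<close> tends to 0. This bound serves only to justify the inversion; the uniform
    estimate is the one for \<open>m\<close>.\<close>
  have \<rho>2int: "integrable lborel (\<rho> 2)"
  proof (rule Bochner_Integration.integrable_bound)
    define K where "K = (LBINT t. cmod (g 2 t))"
    have K0: "0 \<le> K" unfolding K_def by (rule Bochner_Integration.integral_nonneg) simp
    show "integrable lborel (\<lambda>s. indicator {-L..L} s * K + N s ^ 3 * (c * norm y))"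
      by (intro Bochner_Integration.integrable_add indicator_integrable integrable_mult_left N_int)
    show "\<rho> 2 \<in> borel_measurable lborel" using \<rho>cont by (simp add: borel_measurable_continuous_onI)
    show "AE s in lborel. cmod (\<rho> 2 s) \<le> norm (indicator {-L..L} s * K + N s ^ 3 * (c * norm y))"
    proof (intro AE_I2)
      fix s
      have pos: "0 \<le> N s ^ 3 * (c * norm y)" "0 \<le> indicator {-L..L} s * K" using N_nonneg c K0 by auto
      show "cmod (\<rho> 2 s) \<le> norm (indicator {-L..L} s * K + N s ^ 3 * (c * norm y))"
      proof (cases "B s = 1 \<and> B' s = 0 \<and> B'' s = 0")
        case True
        then have "\<not> L < \<bar>s\<bar>" using B_supp[of s] by auto
        then have "s \<in> {-L..L}" by auto
        moreover have "2 * cmod (\<rho> 2 s) \<le> K" using ft_bounded[of "g 2" s] unfolding ftg K_def by (simp add: norm_mult)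
        ultimately show ?thesis using pos K0 by simp
      next
        case False
        then show ?thesis using \<rho>bound[of s 2] pos by (simp add: numeral_3_eq_3)
      qed
    qed
  qed
  show thesis
  proof (rule that)
    show "m \<in> borel_measurable borel" using mcont by (rule borel_measurable_continuous_onI)
    obtain b where b: "0 \<le> b" "\<And>s. cmod (B s) \<le> b" "\<And>s. cmod (B' s) \<le> b" "\<And>s. cmod (B'' s) \<le> b"
      "\<And>s. majorant s = indicator {-L..L} s * (b * Q + 2 * b * Q ^ 2 + 2 * b * Q ^ 3) + 2 * N s ^ 3"
      using majorant_obtain by metis
    show "cmod (m s) \<le> majorant s * (c * norm y)" for s
    proof (cases "B s = 1 \<and> B' s = 0 \<and> B'' s = 0")
      case True
      \<comment> \<open>On the critical set no uniform resolvent bound is at hand; there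
        \<open>p'' s = - 2 * \<rho> 2 s\<close>, and the two parts of \<open>m\<close> cancel
        exactly.\<close>
      then have "m s = 0" by (simp add: m_def p''_def algebra_simps)
      then show ?thesis using majorant_nonneg c by simp
    next
      case Z: False
      define k where "k = c * norm y"
      have k: "0 \<le> k" using c by (simp add: k_def)
      have r: "cmod (\<rho> 0 s) \<le> N s * k" "cmod (\<rho> 1 s) \<le> N s ^ 2 * k" "cmod (\<rho> 2 s) \<le> N s ^ 3 * k"
        using \<rho>bound[OF Z, of 0] \<rho>bound[OF Z, of 1] \<rho>bound[OF Z, of 2] by (simp_all add: k_def numeral_2_eq_2 numeral_3_eq_3)
      have m_eq: "m s = B'' s * \<rho> 0 s + (B' s * (- (2 * \<i>) * \<rho> 1 s) + (B s * (- 2 * \<rho> 2 s) + 2 * \<rho> 2 s))"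
        by (simp add: m_def p''_def algebra_simps)
      have pw: "N s * k \<le> Q * k" "N s ^ 2 * k \<le> Q ^ 2 * k" "N s ^ 3 * k \<le> Q ^ 3 * k"
        using N_nonneg N_le k by (auto intro!: mult_right_mono power_mono)
      have "cmod (B'' s * \<rho> 0 s) \<le> b * (Q * k)" "cmod (B' s * (- (2 * \<i>) * \<rho> 1 s)) \<le> b * (2 * (Q ^ 2 * k))"
        "cmod (B s * (- 2 * \<rho> 2 s)) \<le> b * (2 * (Q ^ 3 * k))"
        unfolding norm_mult using b r pw
        by (auto intro!: mult_mono order_trans[OF r(1) pw(1)] order_trans[OF r(2) pw(2)] order_trans[OF r(3) pw(3)])
      moreover have "cmod (2 * \<rho> 2 s) \<le> 2 * (N s ^ 3 * k)" using r(3) by (simp add: norm_mult)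
      moreover have "cmod (m s) \<le> cmod (B'' s * \<rho> 0 s) + (cmod (B' s * (- (2 * \<i>) * \<rho> 1 s)) + (cmod (B s * (- 2 * \<rho> 2 s)) + cmod (2 * \<rho> 2 s)))"
        unfolding m_eq by (intro norm_triangle_le add_left_mono norm_triangle_ineq)
      ultimately have 1: "cmod (m s) \<le> (b * Q + 2 * b * Q ^ 2 + 2 * b * Q ^ 3) * k + 2 * N s ^ 3 * k"
        by (simp add: algebra_simps)
      show ?thesis
      proof (cases "s \<in> {-L..L}")
        case True
        then show ?thesis using 1 by (simp add: b(5) k_def distrib_right)
      next
        case False
        then have "\<bar>s\<bar> > L" by auto
        then have "m s = 2 * \<rho> 2 s" using B_supp[of s] by (simp add: m_def p''_def)
        then have "cmod (m s) \<le> 2 * N s ^ 3 * k" using r(3) by (simp add: norm_mult)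
        then show ?thesis using False by (simp add: b(5) k_def)
      qed
    qed
    fix q :: real
    have gcont: "continuous_on UNIV (g 2)"
    proof -
      \<comment> \<open>The factor \<open>t\<^sup>2\<close> cancels the jump of the orbit at 0;
        writing it with \<open>max t 0\<close> in place of the indicator makes the continuity
        visible.\<close>
      have eq: "g 2 = (\<lambda>t. complex_of_real (max t 0 ^ 2) * (exp (- (complex_of_real e * t)) * l (S t y)))"
        by (auto simp: g_def orbit_def lap_kernel_def fun_eq_iff indicator_def max_def)
      show ?thesis unfolding eq by (intro continuous_intros functional_S_continuous[OF l])
    qed
    have gb: "cmod (g 2 t) \<le> 4 / (e\<^sup>2) * (M * c * norm y)" for t
    proof (cases "0 \<le> t")
      case True
      have lS: "cmod (l (S t y)) \<le> M * c * norm y"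
        using functional_bound_linear(3)[OF functional_bound_S[OF l], of t y] c by (simp add: mult_ac)
      \<comment> \<open>Squaring this gives
        \<open>t\<^sup>2 * exp (- (e * t)) \<le> 4 / e\<^sup>2\<close>, the boundedness required by
        \<open>fourier_inversion\<close>; this too is not uniform in \<open>e\<close>.\<close>
      have "e * t / 2 \<le> exp (e * t / 2)" using exp_ge_add_one_self[of "e * t / 2"] by linarith
      then have "(e * t / 2)\<^sup>2 \<le> exp (e * t / 2) ^ 2" using True e by (intro power_mono) auto
      also have "\<dots> = exp (e * t)" by (simp add: exp_double[symmetric])
      finally have "t\<^sup>2 * exp (- (e * t)) \<le> 4 / e\<^sup>2"
        using e by (simp add: exp_minus field_simps power_mult_distrib)
      then have "(t\<^sup>2 * exp (- (e * t))) * cmod (l (S t y)) \<le> 4 / e\<^sup>2 * (M * c * norm y)"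
        using lS by (intro mult_mono) auto
      then show ?thesis using True by (simp add: g_def orbit_def norm_mult norm_lap_kernel norm_power mult_ac)
    next
      case False
      then show ?thesis using e c M_ge1 by (simp add: g_def orbit_def lap_kernel_def)
    qed
    have inv: "(LBINT s. (2 * \<rho> 2 s) * cis (s * q)) = 2 * pi * g 2 q"
    proof -
      have "(LBINT s. ft (g 2) s * cis (s * q)) = 2 * pi * g 2 q"
        by (rule fourier_inversion[OF gcont gb gint]) (simp add: ftg \<rho>2int)
      then show ?thesis by (simp add: ftg)
    qed
    \<comment> \<open>Convolution with \<psi> multiplies the transform by \<open>B\<close>; this is
      that rule read backwards through Fubini.\<close>
    have conv: "(LBINT r. orbit e l y r * \<psi> (q - r)) = (LBINT s. p s * cis (s * q)) / (2 * pi)"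
    proof -
      have oint: "integrable lborel (orbit e l y)" using gint[of 0] by (simp add: g_def[abs_def])
      have [measurable]: "orbit e l y \<in> borel_measurable borel" using oint by auto
      have Bint: "integrable lborel B" by (rule C2_compact_integrable[OF B])
      have [measurable]: "B \<in> borel_measurable borel" using Bint by auto
      have "(LBINT r. orbit e l y r * \<psi> (q - r)) = (LBINT r. LBINT s. orbit e l y r * (B s * cis (s * (q - r)))) / (2 * pi)"
        unfolding \<psi>_def inv_ft_def by simp
      also have "(LBINT r. LBINT s. orbit e l y r * (B s * cis (s * (q - r)))) = (LBINT s. LBINT r. orbit e l y r * (B s * cis (s * (q - r))))"
        by (rule fubini_bound_swap[where g = "\<lambda>r. cmod (orbit e l y r)" and k = "\<lambda>s. cmod (B s)" and c = 0])
           (use oint Bint in \<open>auto simp: norm_mult\<close>)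
      also have "\<dots> = (LBINT s. p s * cis (s * q))"
      proof (rule Bochner_Integration.integral_cong[OF refl])
        fix s
        have "cis (s * (q - r)) = cis (s * q) * cis (- (s * r))" for r by (simp add: cis_mult algebra_simps)
        then have "(LBINT r. orbit e l y r * (B s * cis (s * (q - r)))) = (LBINT r. (B s * cis (s * q)) * (orbit e l y r * cis (- (s * r))))"
          by (intro Bochner_Integration.integral_cong refl) simp
        also have "\<dots> = (B s * cis (s * q)) * ft (g 0) s"
          unfolding ft_def integral_mult_right_zero by (simp add: g_def)
        finally show "(LBINT r. orbit e l y r * (B s * cis (s * (q - r)))) = p s * cis (s * q)"
          by (simp add: ftg p_def mult_ac)
      qed
      finally show ?thesis .
    qed
    have "(LBINT s. m s * cis (s * q)) = (LBINT s. p'' s * cis (s * q)) + (LBINT s. (2 * \<rho> 2 s) * cis (s * q))"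
      unfolding m_def distrib_right
      using integrable_mult_cis(1)[OF C2_compact_integrable(2)[OF C2p], of q]
        integrable_mult_cis(1)[OF integrable_mult_right[OF \<rho>2int, of 2], of q]
      by (intro Bochner_Integration.integral_add) (simp_all add: mult.commute[of q])
    also have "\<dots> = - complex_of_real (q\<^sup>2) * (LBINT s. p s * cis (s * q)) + 2 * pi * g 2 q"
      unfolding inv C2_compact_fourier_by_parts[OF C2p] ..
    finally have "(LBINT s. m s * cis (s * q)) / (2 * pi) = g 2 q - complex_of_real (q\<^sup>2) * ((LBINT s. p s * cis (s * q)) / (2 * pi))"
      by (simp add: field_simps)
    then show "complex_of_real (q\<^sup>2) * conv_kernel e l y q = (LBINT s. m s * cis (s * q)) / (2 * pi)"
      by (simp add: conv_kernel_def conv g_def right_diff_distrib)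
  qed
qed

definition kernel_sup :: real where "kernel_sup = M * (1 + (LBINT s. cmod (\<psi> s)))"
definition kernel_moment :: real where "kernel_moment = (LBINT s. majorant s)"
definition \<omega> :: "real \<Rightarrow> real" where "\<omega> h = (LBINT s. majorant s * cmod (cis (s * h) - 1))"
text \<open>\<open>\<omega> h\<close> controls the increment of \<open>q\<^sup>2 * H q\<close>, and
  the terms in |h| pay for replacing \<open>(q + h)\<^sup>2\<close> by \<open>q\<^sup>2\<close>. The
  extra 1 keeps \<open>\<eta> h\<close> positive for h \<noteq> 0, so that
  \<open>\<eta> h + q\<^sup>2\<close> may stand in a denominator.\<close>

definition \<eta> :: "real \<Rightarrow> real" where "\<eta> h = \<omega> h + (2 * kernel_sup + kernel_moment + 1) * \<bar>h\<bar>"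

lemma constants_nonneg: "0 \<le> kernel_sup" "0 \<le> kernel_moment" "0 \<le> \<omega> h"
proof -
  show "0 \<le> kernel_moment" unfolding kernel_moment_def by (rule Bochner_Integration.integral_nonneg) (rule majorant_nonneg)
  show "0 \<le> \<omega> h" unfolding \<omega>_def
    by (rule Bochner_Integration.integral_nonneg) (simp add: majorant_nonneg)
  have "0 \<le> (LBINT s. cmod (\<psi> s))" by (rule Bochner_Integration.integral_nonneg) simp
  then show "0 \<le> kernel_sup" using M_ge1 unfolding kernel_sup_def by (intro mult_nonneg_nonneg) auto
qed

lemma majorant_measurable [measurable]: "majorant \<in> borel_measurable borel"
  using majorant_integrable by auto

lemma \<eta>_pos: "h \<noteq> 0 \<Longrightarrow> 0 < \<eta> h"
  unfolding \<eta>_def using constants_nonneg(1,2) constants_nonneg(3)[of h]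
  by (intro add_nonneg_pos mult_pos_pos) auto

lemma cis_minus_one_bound: "cmod (cis x - 1) \<le> 2"
  using norm_triangle_ineq4[of "cis x" 1] by simp

lemma majorant_cis_integrable: "integrable lborel (\<lambda>s. majorant s * cmod (cis (s * h) - 1))"
proof (rule Bochner_Integration.integrable_bound[OF integrable_mult_right[OF majorant_integrable, of 2]])
  show "AE s in lborel. norm (majorant s * cmod (cis (s * h) - 1)) \<le> norm (2 * majorant s)"
    using majorant_nonneg cis_minus_one_bound
    by (intro AE_I2) (simp add: abs_mult mult.commute[of 2] mult_left_mono)
qed measurable

lemma \<eta>_tendsto: "(\<eta> \<longlongrightarrow> 0) (at 0)"
proof -
  have "(\<omega> \<longlongrightarrow> 0) (at 0)"
    unfolding tendsto_at_iff_sequentially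
  proof (intro allI impI)
    fix X :: "nat \<Rightarrow> real" assume X: "X \<longlonglongrightarrow> 0"
    have "(\<lambda>n. LBINT s. majorant s * cmod (cis (s * X n) - 1)) \<longlonglongrightarrow> (LBINT s::real. 0)"
    proof (rule integral_dominated_convergence[where w = "\<lambda>s. 2 * majorant s"])
      show "integrable lborel (\<lambda>s. 2 * majorant s)" using majorant_integrable by (rule integrable_mult_right)
      show "AE s in lborel. norm (majorant s * cmod (cis (s * X n) - 1)) \<le> 2 * majorant s" for n
        using majorant_nonneg cis_minus_one_bound
        by (intro AE_I2) (simp add: abs_mult mult.commute[of 2] mult_left_mono)
      show "AE s in lborel. (\<lambda>n. majorant s * cmod (cis (s * X n) - 1)) \<longlonglongrightarrow> 0"
      proof (intro AE_I2)
        fix s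
        have "(\<lambda>n. majorant s * cmod (cis (s * X n) - 1)) \<longlonglongrightarrow> majorant s * cmod (cis (s * 0) - 1)"
          by (intro tendsto_intros X)
        then show "(\<lambda>n. majorant s * cmod (cis (s * X n) - 1)) \<longlonglongrightarrow> 0" by simp
      qed
    qed measurable
    then show "(\<omega> \<circ> X) \<longlonglongrightarrow> 0" by (simp add: comp_def \<omega>_def)
  qed
  moreover have "((\<lambda>h::real. (2 * kernel_sup + kernel_moment + 1) * \<bar>h\<bar>) \<longlongrightarrow> (2 * kernel_sup + kernel_moment + 1) * \<bar>0\<bar>) (at 0)"
    by (intro tendsto_intros)
  ultimately have "((\<lambda>h. \<omega> h + (2 * kernel_sup + kernel_moment + 1) * \<bar>h\<bar>) \<longlongrightarrow> 0 + (2 * kernel_sup + kernel_moment + 1) * \<bar>0\<bar>) (at 0)"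
    by (rule tendsto_add)
  then show ?thesis by (simp add: \<eta>_def[abs_def])
qed

text \<open>The first bound comes from the boundedness of the semigroup and the L1 norm of \<psi>.
  The other two are read off the Fourier representation of \<open>q\<^sup>2\<close> times the
  kernel: the integrand is dominated by \<open>majorant\<close>, and a shift by \<open>h\<close>
  contributes the factor \<open>cis (s * h) - 1\<close>.\<close>

lemma conv_kernel_bounds:
  assumes e: "0 < e" "e \<le> e0" and l: "functional_bound l c" and c: "0 \<le> c"
  shows conv_kernel_bound: "cmod (conv_kernel e l y q) \<le> kernel_sup * (c * norm y)"
    and conv_kernel_quadratic: "q\<^sup>2 * cmod (conv_kernel e l y q) \<le> kernel_moment * (c * norm y)"
    and conv_kernel_modulus:
      "cmod (complex_of_real ((q + h)\<^sup>2) * conv_kernel e l y (q + h) - complex_of_real (q\<^sup>2) * conv_kernel e l y q) \<le> \<omega> h * (c * norm y)"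
proof -
  define k where "k = c * norm y"
  have k: "0 \<le> k" using c by (simp add: k_def)
  have ob: "cmod (orbit e l y t) \<le> M * k" for t using orbit_bound[OF e(1) l c] by (simp add: k_def mult.assoc)
  have om: "orbit e l y \<in> borel_measurable borel" 
    using orbit_power_integrable[OF e(1) l, of 0 y] by auto
  have rint: "integrable lborel (\<lambda>r. \<psi> (q - r))" by (rule lborel_integrable_reflect[OF \<psi>_int])
  have "cmod (LBINT r. orbit e l y r * \<psi> (q - r)) \<le> M * k * (LBINT r. cmod (\<psi> (q - r)))"
    using integrable_mult_bounded(2)[OF rint om ob] by (simp add: mult.commute)
  also have "(LBINT r. cmod (\<psi> (q - r))) = (LBINT s. cmod (\<psi> s))" by (rule lborel_integral_reflect)
  finally have "cmod (conv_kernel e l y q) \<le> M * k + M * k * (LBINT s. cmod (\<psi> s))"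
    unfolding conv_kernel_def using ob[of q] by (intro norm_triangle_le_diff add_mono)
  then show "cmod (conv_kernel e l y q) \<le> kernel_sup * (c * norm y)" by (simp add: kernel_sup_def k_def algebra_simps)
  obtain m where mm: "m \<in> borel_measurable borel" and mb': "\<And>s. cmod (m s) \<le> majorant s * (c * norm y)"
    and meq: "\<And>q. complex_of_real (q\<^sup>2) * conv_kernel e l y q = (LBINT s. m s * cis (s * q)) / (2 * pi)"
    by (rule conv_kernel_fourier[OF e l c, of y], rule that)
  have mb: "cmod (m s) \<le> majorant s * k" for s using mb' by (simp add: k_def)
  have mint: "integrable lborel m"
    by (rule Bochner_Integration.integrable_bound[OF integrable_mult_left[OF majorant_integrable, of k]])
       (use mm mb majorant_nonneg k in \<open>auto simp: abs_mult\<close>)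
  have pi: "x / (2 * pi) \<le> x" if "0 \<le> x" for x
    using divide_left_mono[of 1 "2 * pi" x] pi_gt3 that by simp
  have "q\<^sup>2 * cmod (conv_kernel e l y q) = cmod (complex_of_real (q\<^sup>2) * conv_kernel e l y q)"
    by (simp add: norm_mult norm_power)
  also have "\<dots> = cmod (LBINT s. m s * cis (s * q)) / (2 * pi)" unfolding meq by (simp add: norm_divide norm_mult)
  also have "\<dots> \<le> cmod (LBINT s. m s * cis (s * q))" by (rule pi) simp
  also have "\<dots> \<le> (LBINT s. cmod (m s * cis (s * q)))" by (rule integral_norm_bound)
  also have "\<dots> \<le> (LBINT s. majorant s * k)"
    by (intro integral_mono) (use mint mb majorant_integrable in \<open>auto simp: norm_mult\<close>)
  finally show "q\<^sup>2 * cmod (conv_kernel e l y q) \<le> kernel_moment * (c * norm y)" by (simp add: kernel_moment_def k_def)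
  have i: "integrable lborel (\<lambda>s. m s * cis (s * q))" for q
    using integrable_mult_cis(1)[OF mint, of q] by (simp add: mult.commute)
  have "complex_of_real ((q + h)\<^sup>2) * conv_kernel e l y (q + h) - complex_of_real (q\<^sup>2) * conv_kernel e l y q
      = ((LBINT s. m s * cis (s * (q + h))) - (LBINT s. m s * cis (s * q))) / (2 * pi)"
    using meq[of "q + h"] meq[of q] by (simp add: diff_divide_distrib)
  also have "\<dots> = (LBINT s. m s * cis (s * (q + h)) - m s * cis (s * q)) / (2 * pi)"
    by (simp add: Bochner_Integration.integral_diff[OF i i])
  finally have "cmod (complex_of_real ((q + h)\<^sup>2) * conv_kernel e l y (q + h) - complex_of_real (q\<^sup>2) * conv_kernel e l y q)
      = cmod (LBINT s. m s * cis (s * (q + h)) - m s * cis (s * q)) / (2 * pi)"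
    by (simp add: norm_divide norm_mult)
  also have "\<dots> \<le> cmod (LBINT s. m s * cis (s * (q + h)) - m s * cis (s * q))" by (rule pi) simp
  also have "\<dots> \<le> (LBINT s. cmod (m s * cis (s * (q + h)) - m s * cis (s * q)))" by (rule integral_norm_bound)
  also have "\<dots> \<le> (LBINT s. majorant s * cmod (cis (s * h) - 1) * k)"
  proof (rule integral_mono)
    show "integrable lborel (\<lambda>s. cmod (m s * cis (s * (q + h)) - m s * cis (s * q)))"
      by (intro integrable_norm Bochner_Integration.integrable_diff i)
    show "integrable lborel (\<lambda>s. majorant s * cmod (cis (s * h) - 1) * k)"
      by (intro integrable_mult_left majorant_cis_integrable)
    fix s
    have "m s * cis (s * (q + h)) - m s * cis (s * q) = m s * cis (s * q) * (cis (s * h) - 1)"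
      by (simp add: cis_mult[symmetric] distrib_left algebra_simps)
    then have "cmod (m s * cis (s * (q + h)) - m s * cis (s * q)) = cmod (m s) * cmod (cis (s * h) - 1)"
      by (simp add: norm_mult)
    also have "\<dots> \<le> majorant s * k * cmod (cis (s * h) - 1)" by (intro mult_right_mono mb) simp
    finally show "cmod (m s * cis (s * (q + h)) - m s * cis (s * q)) \<le> majorant s * cmod (cis (s * h) - 1) * k"
      by (simp add: mult_ac)
  qed
  also have "\<dots> = \<omega> h * k" by (simp add: \<omega>_def)
  finally show "cmod (complex_of_real ((q + h)\<^sup>2) * conv_kernel e l y (q + h) - complex_of_real (q\<^sup>2) * conv_kernel e l y q) \<le> \<omega> h * (c * norm y)"
    by (simp add: k_def)
qed

lemma conv_kernel_decay:
  assumes e: "0 < e" "e \<le> e0" and l: "functional_bound l c" and c: "0 \<le> c"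
  shows "cmod (conv_kernel e l y q) \<le> (kernel_sup + kernel_moment) * (c * norm y) / (1 + q\<^sup>2)"
  using conv_kernel_bound[OF assms, of y q] conv_kernel_quadratic[OF assms, of q y]
  by (simp add: pos_le_divide_eq add_pos_nonneg algebra_simps)

text \<open>With \<open>k = c * norm y\<close>, the increment \<open>d\<close> satisfies
  \<open>d \<le> 2 * kernel_sup * k\<close> and \<open>q\<^sup>2 * d \<le> \<eta> h * k\<close>.
  Adding \<open>\<eta> h\<close> times the first to the second gives the quotient
  \<open>\<eta> h / (\<eta> h + q\<^sup>2)\<close>, whose integral is of order
  \<open>sqrt (\<eta> h)\<close>: pointwise bounds turn into a small L1 modulus.\<close>

lemma conv_kernel_shift:
  assumes e: "0 < e" "e \<le> e0" and l: "functional_bound l c" and c: "0 \<le> c" and h: "h \<noteq> 0" "\<bar>h\<bar> \<le> 1"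
  shows "cmod (conv_kernel e l y (q + h) - conv_kernel e l y q) \<le> (2 * kernel_sup + 1) * (c * norm y) * (\<eta> h / (\<eta> h + q\<^sup>2))"
proof -
  define k where "k = c * norm y"
  have k: "0 \<le> k" using c by (simp add: k_def)
  define H where "H = conv_kernel e l y"
  define d where "d = cmod (H (q + h) - H q)"
  have H1: "cmod (H x) \<le> kernel_sup * k" "x\<^sup>2 * cmod (H x) \<le> kernel_moment * k" for x
    unfolding H_def k_def using conv_kernel_bound[OF e l c] conv_kernel_quadratic[OF e l c] by auto
  have d1: "d \<le> 2 * kernel_sup * k"
    unfolding d_def using norm_triangle_ineq4[of "H (q + h)" "H q"] H1(1)[of "q + h"] H1(1)[of q] by linarith
  \<comment> \<open>The factor is expressed through \<open>q + h\<close> because it multiplies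
    \<open>H (q + h)\<close>, where the sup bound absorbs 2 and the quadratic bound absorbs
    \<open>(q + h)\<^sup>2\<close>.\<close>
  have "\<bar>(q + h)\<^sup>2 - q\<^sup>2\<bar> \<le> \<bar>h\<bar> * (2 + (q + h)\<^sup>2)"
  proof -
    have "(q + h)\<^sup>2 - q\<^sup>2 = h * (2 * (q + h) - h)" by (simp add: power2_eq_square algebra_simps)
    moreover have "\<bar>2 * (q + h) - h\<bar> \<le> 2 * \<bar>q + h\<bar> + 1" 
    proof -
      have "\<bar>2 * x - h\<bar> \<le> 2 * \<bar>x\<bar> + 1" for x
      proof -
        have "\<bar>2 * x - h\<bar> \<le> \<bar>2 * x\<bar> + \<bar>h\<bar>" by (rule abs_triangle_ineq4)
        moreover have "\<bar>2 * x\<bar> = 2 * \<bar>x\<bar>" by (simp add: abs_mult)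
        ultimately show ?thesis using h(2) by linarith
      qed
      then show ?thesis .
    qed
    moreover have "2 * \<bar>q + h\<bar> \<le> 1 + (q + h)\<^sup>2"
      using zero_le_power2[of "\<bar>q + h\<bar> - 1"] by (simp add: power2_diff)
    ultimately show ?thesis by (simp add: abs_mult mult_left_mono)
  qed
  then have "\<bar>(q + h)\<^sup>2 - q\<^sup>2\<bar> * cmod (H (q + h)) \<le> \<bar>h\<bar> * (2 + (q + h)\<^sup>2) * cmod (H (q + h))"
    by (rule mult_right_mono) simp
  also have "\<dots> = \<bar>h\<bar> * (2 * cmod (H (q + h)) + (q + h)\<^sup>2 * cmod (H (q + h)))" by (simp add: algebra_simps)
  also have "\<dots> \<le> \<bar>h\<bar> * (2 * (kernel_sup * k) + kernel_moment * k)" using H1[of "q + h"] by (intro mult_left_mono add_mono) auto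
  finally have a: "\<bar>(q + h)\<^sup>2 - q\<^sup>2\<bar> * cmod (H (q + h)) \<le> \<bar>h\<bar> * (2 * (kernel_sup * k) + kernel_moment * k)" .
  have "complex_of_real (q\<^sup>2) * (H (q + h) - H q) = (complex_of_real ((q + h)\<^sup>2) * H (q + h) - complex_of_real (q\<^sup>2) * H q) - complex_of_real ((q + h)\<^sup>2 - q\<^sup>2) * H (q + h)"
    by (simp add: algebra_simps)
  then have "cmod (complex_of_real (q\<^sup>2) * (H (q + h) - H q)) \<le> cmod (complex_of_real ((q + h)\<^sup>2) * H (q + h) - complex_of_real (q\<^sup>2) * H q) + cmod (complex_of_real ((q + h)\<^sup>2 - q\<^sup>2) * H (q + h))"
    by (metis norm_triangle_ineq4)
  also have "cmod (complex_of_real ((q + h)\<^sup>2 - q\<^sup>2) * H (q + h)) = \<bar>(q + h)\<^sup>2 - q\<^sup>2\<bar> * cmod (H (q + h))"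
    by (simp only: norm_mult norm_of_real)
  also have "cmod (complex_of_real (q\<^sup>2) * (H (q + h) - H q)) = q\<^sup>2 * d"
    unfolding d_def by (simp only: norm_mult norm_of_real) simp
  also have "cmod (complex_of_real ((q + h)\<^sup>2) * H (q + h) - complex_of_real (q\<^sup>2) * H q) \<le> \<omega> h * k"
    unfolding H_def k_def by (rule conv_kernel_modulus[OF e l c])
  finally have "q\<^sup>2 * d \<le> \<omega> h * k + \<bar>h\<bar> * (2 * (kernel_sup * k) + kernel_moment * k)" using a by linarith
  also have "\<dots> \<le> \<eta> h * k" using k by (simp add: \<eta>_def algebra_simps mult_nonneg_nonneg)
  finally have d2: "q\<^sup>2 * d \<le> \<eta> h * k" .
  have pos: "0 < \<eta> h" by (rule \<eta>_pos[OF h(1)])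
  have "d * (\<eta> h + q\<^sup>2) = \<eta> h * d + q\<^sup>2 * d" by (simp add: algebra_simps)
  also have "\<dots> \<le> \<eta> h * (2 * kernel_sup * k) + \<eta> h * k" using d1 d2 pos by (intro add_mono mult_left_mono) auto
  also have "\<dots> = (2 * kernel_sup + 1) * k * \<eta> h" by (simp add: algebra_simps)
  finally have "d * (\<eta> h + q\<^sup>2) \<le> (2 * kernel_sup + 1) * k * \<eta> h" .
  then have "d \<le> (2 * kernel_sup + 1) * k * \<eta> h / (\<eta> h + q\<^sup>2)" using pos by (simp add: pos_le_divide_eq add_pos_nonneg)
  then show ?thesis by (simp add: d_def H_def k_def)
qed

end

section \<open>Convolution of the damped semigroup with the forcing term\<close>

definition cauchy_mass :: real where "cauchy_mass = (LBINT q. 1 / (1 + q\<^sup>2))"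

text \<open>The substitution \<open>q = sqrt a * x\<close>. The factor \<open>sqrt a\<close> is what
  makes the modulus of continuity tend to 0 later on.\<close>

lemma scaled_cauchy:
  assumes a: "0 < a"
  shows "integrable lborel (\<lambda>q. a / (a + q\<^sup>2) :: real)" "(LBINT q. a / (a + q\<^sup>2)) = sqrt a * cauchy_mass"
proof -
  have eq: "a / (a + (0 + sqrt a * x)\<^sup>2) = 1 / (1 + x\<^sup>2)" for x
  proof -
    have "a + (0 + sqrt a * x)\<^sup>2 = a * (1 + x\<^sup>2)" using a by (simp add: power_mult_distrib algebra_simps)
    then show ?thesis using a by simp
  qed
  have s: "sqrt a \<noteq> 0" using a by simp
  have "integrable lborel (\<lambda>x. a / (a + (0 + sqrt a * x)\<^sup>2))"
    unfolding eq by (rule integrable_cauchy_density)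
  then show "integrable lborel (\<lambda>q. a / (a + q\<^sup>2) :: real)"
    by (subst (asm) lborel_integrable_real_affine_iff[OF s]) simp
  show "(LBINT q. a / (a + q\<^sup>2)) = sqrt a * cauchy_mass"
    unfolding cauchy_mass_def using lborel_integral_real_affine[OF s, of "\<lambda>q. a / (a + q\<^sup>2)" 0] a
    unfolding eq by simp
qed

locale cutoff_forcing = spectral_cutoff +
  fixes \<phi> :: "real \<Rightarrow> 'a" and C :: real
  assumes \<phi>_simple: "simple_limit lborel \<phi>" and \<phi>_bound: "\<And>t. norm (\<phi> t) \<le> C"
    and \<phi>_cutoff: "\<And>l c t. functional_bound l c \<Longrightarrow> (LBINT s. \<psi> s * l (\<phi> (t - s))) = 0"
begin

definition full_conv :: "real \<Rightarrow> ('a \<Rightarrow> complex) \<Rightarrow> real \<Rightarrow> complex" where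
  "full_conv e l t = (LBINT q. orbit e l (\<phi> (t - q)) q)"

lemma S_\<phi>_bound: "functional_bound l c \<Longrightarrow> 0 \<le> c \<Longrightarrow> cmod (l (S r (\<phi> s))) \<le> c * M * C"
proof -
  assume l: "functional_bound l c" and c: "0 \<le> c"
  have "cmod (l (S r (\<phi> s))) \<le> c * M * norm (\<phi> s)"
    using functional_bound_linear(3)[OF functional_bound_S[OF l], of r "\<phi> s"] c by simp
  also have "\<dots> \<le> c * M * C" using \<phi>_bound c M_ge1 by (intro mult_left_mono) auto
  finally show ?thesis .
qed

lemma S_\<phi>_measurable:
  assumes l: "functional_bound l c" and f[measurable]: "f \<in> borel_measurable P" and g[measurable]: "g \<in> borel_measurable P"
  shows "(\<lambda>p. l (S (g p) (\<phi> (f p)))) \<in> borel_measurable P"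
proof -
  have "simple_limit P (\<lambda>p. S (g p) (\<phi> (f p)))"
    by (intro simple_limit_S simple_limit_measurable_compose[OF _ \<phi>_simple]) measurable
  then show ?thesis
    by (rule simple_limit_imp_borel_measurable[OF simple_limit_bounded_linear[OF functional_bound_linear(1)[OF l]]])
qed

lemma orbit_\<phi>_measurable:
  assumes l: "functional_bound l c" and f[measurable]: "f \<in> borel_measurable P" and g[measurable]: "g \<in> borel_measurable P"
  shows "(\<lambda>p. orbit e l (\<phi> (f p)) (g p)) \<in> borel_measurable P"
proof -
  have [measurable]: "(\<lambda>p. l (S (g p) (\<phi> (f p)))) \<in> borel_measurable P"
    by (rule S_\<phi>_measurable[OF l f g])
  show ?thesis unfolding orbit_def by measurable
qed

lemma orbit_\<phi>_bound:
  assumes l: "functional_bound l c" and c: "0 \<le> c"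
  shows "cmod (orbit e l (\<phi> s) q) \<le> cmod (lap_kernel (complex_of_real e) q) * (c * M * C)"
  unfolding orbit_def norm_mult by (intro mult_left_mono S_\<phi>_bound[OF l c]) simp

lemma orbit_\<phi>_integrable:
  assumes e: "0 < e" and l: "functional_bound l c" and c: "0 \<le> c" 
    and f: "f \<in> borel_measurable borel"
  shows "integrable lborel (\<lambda>q. orbit e l (\<phi> (f q)) q)"
proof (rule Bochner_Integration.integrable_bound)
  show "integrable lborel (\<lambda>q. cmod (lap_kernel (complex_of_real e) q) * (c * M * C))"
    using e by (intro integrable_mult_left integrable_norm lap_kernel_integrable) simp
  show "(\<lambda>q. orbit e l (\<phi> (f q)) q) \<in> borel_measurable lborel"
    using orbit_\<phi>_measurable[OF l, of f lborel "\<lambda>q. q"] f by simp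
  show "AE q in lborel. norm (orbit e l (\<phi> (f q)) q) \<le> norm (cmod (lap_kernel (complex_of_real e) q) * (c * M * C))"
    using orbit_\<phi>_bound[OF l c] by (intro AE_I2) (metis abs_ge_self order_trans real_norm_def)
qed

text \<open>After Fubini the convolution of \<open>E * \<psi>\<close> with \<phi> has as inner
  integral the convolution of \<psi> with \<phi>, tested with \<open>l\<close> composed with
  \<open>S r\<close>; it vanishes by \<open>\<phi>_cutoff\<close>. So \<open>E\<close> may be
  replaced by the integrable kernel \<open>H\<close>.\<close>

lemma full_conv_eq:
  assumes e: "0 < e" "e \<le> e0" and l: "functional_bound l c" and c: "0 \<le> c"
  shows "full_conv e l t = (LBINT q. conv_kernel e l (\<phi> (t - q)) q)"
    and "integrable lborel (\<lambda>q. conv_kernel e l (\<phi> (t - q)) q)"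
    and "(\<lambda>q. conv_kernel e l (\<phi> (t - q)) (q + h)) \<in> borel_measurable borel"
proof -
  define F where "F r q = orbit e l (\<phi> (t - q)) r * \<psi> (q - r)" for r q
  have kint: "integrable lborel (\<lambda>q. cmod (lap_kernel (complex_of_real e) q) * (c * M * C))"
    using e by (intro integrable_mult_left integrable_norm lap_kernel_integrable) simp
  have Fm: "case_prod F \<in> borel_measurable (lborel \<Otimes>\<^sub>M lborel)"
  proof -
    have [measurable]: "(\<lambda>p::real \<times> real. orbit e l (\<phi> (t - snd p)) (fst p)) \<in> borel_measurable (lborel \<Otimes>\<^sub>M lborel)"
      by (rule orbit_\<phi>_measurable[OF l]) measurable
    show ?thesis unfolding F_def split_beta' by measurable
  qed
  have Fb: "cmod (F r q) \<le> (cmod (lap_kernel (complex_of_real e) r) * (c * M * C)) * cmod (\<psi> (q + - 1 * r))" for r q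
    unfolding F_def norm_mult using orbit_\<phi>_bound[OF l c] by (simp add: mult_right_mono)
  note fub = fubini_bound[OF Fm kint integrable_norm[OF \<psi>_int] Fb]
  have "(LBINT q. F r q) = 0" for r
  proof -
    have "(LBINT q. F r q) = (LBINT s. F r (r + 1 * s))"
      using lborel_integral_real_affine[of 1 "\<lambda>q. F r q" r] by simp
    also have "\<dots> = (LBINT s. lap_kernel (complex_of_real e) r * (\<psi> s * l (S r (\<phi> ((t - r) - s)))))"
      unfolding F_def orbit_def by (intro Bochner_Integration.integral_cong refl) (simp add: algebra_simps)
    also have "\<dots> = 0"
      unfolding integral_mult_right_zero \<phi>_cutoff[OF functional_bound_S[OF l]] by simp
    finally show ?thesis .
  qed
  then have z: "(LBINT q. LBINT r. F r q) = 0" using fub(1) by simp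
  have oint: "integrable lborel (\<lambda>q. orbit e l (\<phi> (t - q)) q)"
    by (rule orbit_\<phi>_integrable[OF e(1) l c]) measurable
  have ck: "conv_kernel e l (\<phi> (t - q)) q = orbit e l (\<phi> (t - q)) q - (LBINT r. F r q)" for q
    by (simp add: conv_kernel_def F_def)
  show "integrable lborel (\<lambda>q. conv_kernel e l (\<phi> (t - q)) q)"
    unfolding ck by (intro Bochner_Integration.integrable_diff oint fub(3))
  show "full_conv e l t = (LBINT q. conv_kernel e l (\<phi> (t - q)) q)"
    unfolding ck using z oint fub(3) by (simp add: full_conv_def)
  have [measurable]: "(\<lambda>p::real \<times> real. orbit e l (\<phi> (t - fst p)) (snd p)) \<in> borel_measurable (borel \<Otimes>\<^sub>M lborel)"
    by (rule orbit_\<phi>_measurable[OF l]) measurable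
  have [measurable]: "(\<lambda>q. orbit e l (\<phi> (t - q)) (q + h)) \<in> borel_measurable borel"
    by (rule orbit_\<phi>_measurable[OF l]) measurable
  have "(\<lambda>q. LBINT r. (\<lambda>p. orbit e l (\<phi> (t - fst p)) (snd p) * \<psi> (fst p + h - snd p)) (q, r)) \<in> borel_measurable borel"
    by measurable
  then have [measurable]: "(\<lambda>q. LBINT r. orbit e l (\<phi> (t - q)) r * \<psi> (q + h - r)) \<in> borel_measurable borel" by simp
  show "(\<lambda>q. conv_kernel e l (\<phi> (t - q)) (q + h)) \<in> borel_measurable borel"
    unfolding conv_kernel_def by measurable
qed

definition conv_bound :: real where "conv_bound = (kernel_sup + kernel_moment) * C * cauchy_mass"
definition \<kappa> :: "real \<Rightarrow> real" where "\<kappa> h = (2 * kernel_sup + 1) * C * (sqrt (\<eta> h) * cauchy_mass)"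

lemma full_conv_bound:
  assumes e: "0 < e" "e \<le> e0" and l: "functional_bound l c" and c: "0 \<le> c"
  shows "cmod (full_conv e l t) \<le> conv_bound * c"
proof -
  have "cmod (full_conv e l t) \<le> (LBINT q. cmod (conv_kernel e l (\<phi> (t - q)) q))"
    unfolding full_conv_eq(1)[OF assms] by (rule integral_norm_bound)
  also have "\<dots> \<le> (LBINT q. ((kernel_sup + kernel_moment) * (c * C)) * (1 / (1 + q\<^sup>2)))"
  proof (intro integral_mono integrable_norm full_conv_eq(2)[OF assms] integrable_mult_right integrable_cauchy_density)
    fix q
    have "cmod (conv_kernel e l (\<phi> (t - q)) q) \<le> (kernel_sup + kernel_moment) * (c * norm (\<phi> (t - q))) / (1 + q\<^sup>2)"
      by (rule conv_kernel_decay[OF assms])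
    also have "\<dots> \<le> (kernel_sup + kernel_moment) * (c * C) / (1 + q\<^sup>2)"
      using constants_nonneg c \<phi>_bound by (intro divide_right_mono mult_left_mono) auto
    finally show "cmod (conv_kernel e l (\<phi> (t - q)) q) \<le> ((kernel_sup + kernel_moment) * (c * C)) * (1 / (1 + q\<^sup>2))" by simp
  qed
  also have "\<dots> = conv_bound * c" unfolding integral_mult_right_zero cauchy_mass_def[symmetric] by (simp add: conv_bound_def)
  finally show ?thesis .
qed

lemma full_conv_diff:
  assumes e: "0 < e" "e \<le> e0" and l: "functional_bound l c" and c: "0 \<le> c" and h: "h \<noteq> 0" "\<bar>h\<bar> \<le> 1"
  shows "cmod (full_conv e l (t + h) - full_conv e l t) \<le> \<kappa> h * c"
proof -
  \<comment> \<open>Substituting q + h moves the time shift from \<phi>, which may be discontinuous,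
    to the kernel.\<close>
  have 1: "full_conv e l (t + h) = (LBINT q. conv_kernel e l (\<phi> (t - q)) (q + h))"
    unfolding full_conv_eq(1)[OF e l c]
    using lborel_integral_real_affine[of 1 "\<lambda>q. conv_kernel e l (\<phi> (t + h - q)) q" h] by (simp add: add.commute)
  have 2: "integrable lborel (\<lambda>q. conv_kernel e l (\<phi> (t - q)) (q + h))"
    using lborel_integrable_real_affine[OF full_conv_eq(2)[OF e l c, of "t + h"], of 1 h] by (simp add: add.commute)
  have 3: "integrable lborel (\<lambda>q. conv_kernel e l (\<phi> (t - q)) q)"
    by (rule full_conv_eq(2)[OF e l c])
  have "full_conv e l (t + h) - full_conv e l t = (LBINT q. conv_kernel e l (\<phi> (t - q)) (q + h) - conv_kernel e l (\<phi> (t - q)) q)"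
    unfolding 1 full_conv_eq(1)[OF e l c, of t]
    by (rule Bochner_Integration.integral_diff[OF 2 full_conv_eq(2)[OF e l c], symmetric])
  then have "cmod (full_conv e l (t + h) - full_conv e l t)
      \<le> (LBINT q. cmod (conv_kernel e l (\<phi> (t - q)) (q + h) - conv_kernel e l (\<phi> (t - q)) q))"
    by (simp only: integral_norm_bound)
  also have "\<dots> \<le> (LBINT q. ((2 * kernel_sup + 1) * (c * C)) * (\<eta> h / (\<eta> h + q\<^sup>2)))"
  proof (rule integral_mono)
    show "integrable lborel (\<lambda>q. cmod (conv_kernel e l (\<phi> (t - q)) (q + h) - conv_kernel e l (\<phi> (t - q)) q))"
      by (rule integrable_norm[OF Bochner_Integration.integrable_diff[OF 2 3]])
    show "integrable lborel (\<lambda>q. ((2 * kernel_sup + 1) * (c * C)) * (\<eta> h / (\<eta> h + q\<^sup>2)))"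
      by (rule integrable_mult_right[OF scaled_cauchy(1)[OF \<eta>_pos[OF h(1)]]])
    fix q
    have pos: "0 < \<eta> h" by (rule \<eta>_pos[OF h(1)])
    have "cmod (conv_kernel e l (\<phi> (t - q)) (q + h) - conv_kernel e l (\<phi> (t - q)) q)
        \<le> (2 * kernel_sup + 1) * (c * norm (\<phi> (t - q))) * (\<eta> h / (\<eta> h + q\<^sup>2))"
      by (rule conv_kernel_shift[OF e l c h])
    also have "\<dots> \<le> (2 * kernel_sup + 1) * (c * C) * (\<eta> h / (\<eta> h + q\<^sup>2))"
      using constants_nonneg c \<phi>_bound pos by (intro mult_right_mono mult_left_mono) auto
    finally show "cmod (conv_kernel e l (\<phi> (t - q)) (q + h) - conv_kernel e l (\<phi> (t - q)) q)
      \<le> (2 * kernel_sup + 1) * (c * C) * (\<eta> h / (\<eta> h + q\<^sup>2))" .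
  qed
  also have "\<dots> = \<kappa> h * c" unfolding integral_mult_right_zero scaled_cauchy(2)[OF \<eta>_pos[OF h(1)]] by (simp add: \<kappa>_def)
  finally show ?thesis .
qed

subsection \<open>Duhamel's integral\<close>

definition duhamel :: "real \<Rightarrow> 'a" where
  "duhamel t = bochner_integral lborel (\<lambda>s. indicator {0..t} s *\<^sub>R S (t - s) (\<phi> s))"

lemma indicator_Icc_integrable: "integrable lborel (\<lambda>s. indicator {0..t::real} s * k :: real)"
  by (intro integrable_mult_left integrable_real_indicator) (auto simp: emeasure_lborel_Icc_eq)

lemma S_\<phi>_integrable:
  assumes l: "functional_bound l c" and c: "0 \<le> c" and f: "f \<in> borel_measurable borel" and g: "g \<in> borel_measurable borel"
  shows "integrable lborel (\<lambda>s::real. indicator {0..t} s *\<^sub>R l (S (g s) (\<phi> (f s))))"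
proof (rule Bochner_Integration.integrable_bound[OF indicator_Icc_integrable[of t "c * M * C"]])
  have [measurable]: "(\<lambda>s. l (S (g s) (\<phi> (f s)))) \<in> borel_measurable borel" by (rule S_\<phi>_measurable[OF l f g])
  show "(\<lambda>s. indicator {0..t} s *\<^sub>R l (S (g s) (\<phi> (f s)))) \<in> borel_measurable lborel" by measurable
  show "AE s in lborel. norm (indicator {0..t} s *\<^sub>R l (S (g s) (\<phi> (f s)))) \<le> norm (indicator {0..t} s * (c * M * C))"
    using S_\<phi>_bound[OF l c] by (intro AE_I2) (auto simp: indicator_def intro: order_trans[OF _ abs_ge_self])
qed

text \<open>The first form keeps the forcing term at \<open>s\<close> and suits Fubini; the second,
  after r = t - s, matches \<open>trunc_conv\<close>.\<close>

lemma duhamel_functional: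
  assumes l: "functional_bound l c"
  shows "l (duhamel t) = (LBINT s. indicator {0..t} s *\<^sub>R l (S (t - s) (\<phi> s)))"
    and "l (duhamel t) = (LBINT r. indicator {0..t} r *\<^sub>R l (S r (\<phi> (t - r))))"
proof -
  have sl: "simple_limit lborel (\<lambda>s. complex_of_real (indicator {0..t} s) *\<^sub>C S (t - s) (\<phi> s))"
    by (intro simple_limit_scaleC simple_limit_S \<phi>_simple borel_measurable_imp_simple_limit) measurable
  have "(\<integral>\<^sup>+s. norm (complex_of_real (indicator {0..t} s) *\<^sub>C S (t - s) (\<phi> s)) \<partial>lborel)
      \<le> (\<integral>\<^sup>+s. norm (indicator {0..t} s * (M * C)) \<partial>lborel)"
  proof (intro nn_integral_mono ennreal_leI)
    fix s
    have "norm (S (t - s) (\<phi> s)) \<le> M * norm (\<phi> s)" by (rule S_bound)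
    also have "\<dots> \<le> M * C" using M_ge1 \<phi>_bound by (intro mult_left_mono) auto
    finally show "norm (complex_of_real (indicator {0..t} s) *\<^sub>C S (t - s) (\<phi> s)) \<le> norm (indicator {0..t} s * (M * C))"
      by (auto simp: norm_scaleC indicator_def)
  qed
  also have "\<dots> < \<infinity>" using indicator_Icc_integrable[of t "M * C"] unfolding integrable_iff_bounded by blast
  finally have fin: "(\<integral>\<^sup>+s. norm (complex_of_real (indicator {0..t} s) *\<^sub>C S (t - s) (\<phi> s)) \<partial>lborel) < \<infinity>" .
  have d: "duhamel t = bochner_integral lborel (\<lambda>s. complex_of_real (indicator {0..t} s) *\<^sub>C S (t - s) (\<phi> s))"
    by (simp add: duhamel_def scaleR_scaleC)
  show 1: "l (duhamel t) = (LBINT s. indicator {0..t} s *\<^sub>R l (S (t - s) (\<phi> s)))"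
    unfolding d simple_limit_bochner_functional(2)[OF sl fin l]
    by (simp add: functional_bound_linear[OF l] scaleR_conv_of_real)
  have "(LBINT s. indicator {0..t} s *\<^sub>R l (S (t - s) (\<phi> s)))
      = (LBINT r. indicator {0..t} (t - r) *\<^sub>R l (S (t - (t - r)) (\<phi> (t - r))))"
    by (rule lborel_integral_reflect[symmetric])
  also have "\<dots> = (LBINT r. indicator {0..t} r *\<^sub>R l (S r (\<phi> (t - r))))"
    by (intro Bochner_Integration.integral_cong refl) (auto simp: indicator_def)
  finally show "l (duhamel t) = (LBINT r. indicator {0..t} r *\<^sub>R l (S r (\<phi> (t - r))))" using 1 by simp
qed

definition trunc_conv :: "real \<Rightarrow> ('a \<Rightarrow> complex) \<Rightarrow> real \<Rightarrow> complex" where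
  "trunc_conv e l t = (LBINT r. indicator {0..t} r *\<^sub>R orbit e l (\<phi> (t - r)) r)"

text \<open>The past is split at time 0, using \<open>E(t + q) = E(t) E(q)\<close>: what happened
  before time 0 reaches time \<open>t\<close> along an orbit of the damped semigroup. Estimates for
  the convolution on the whole line thereby pass to Duhamel's integral.\<close>

lemma full_conv_split:
  assumes e: "0 < e" and l: "functional_bound l c" and c: "0 \<le> c" and t: "0 \<le> t"
  shows "full_conv e l t = trunc_conv e l t + complex_of_real (exp (- (e * t))) * full_conv e (\<lambda>x. l (S t x)) 0"
proof -
  define G where "G r = orbit e l (\<phi> (t - r)) r" for r
  have Gi: "integrable lborel G" unfolding G_def[abs_def] by (rule orbit_\<phi>_integrable[OF e l c]) measurable
  have [measurable]: "G \<in> borel_measurable borel" using Gi by auto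
  have Ii: "integrable lborel (\<lambda>r. indicator {0..t} r *\<^sub>R G r)" using Gi by (intro integrable_mult_indicator) auto
  have l': "functional_bound (\<lambda>x. l (S t x)) (\<bar>c\<bar> * M)" by (rule functional_bound_S[OF l])
  have G': "integrable lborel (\<lambda>q. orbit e (\<lambda>x. l (S t x)) (\<phi> (0 - q)) q)"
    by (rule orbit_\<phi>_integrable[OF e l']) (use c M_ge1 in auto)
  have "full_conv e l t - trunc_conv e l t = (LBINT r. G r - indicator {0..t} r *\<^sub>R G r)"
    unfolding full_conv_def trunc_conv_def G_def[symmetric] using Gi Ii by simp
  also have "\<dots> = (LBINT q. G (t + 1 * q) - indicator {0..t} (t + 1 * q) *\<^sub>R G (t + 1 * q))"
    using lborel_integral_real_affine[of 1 "\<lambda>r. G r - indicator {0..t} r *\<^sub>R G r" t] by simp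
  also have "\<dots> = (LBINT q. complex_of_real (exp (- (e * t))) * orbit e (\<lambda>x. l (S t x)) (\<phi> (0 - q)) q)"
  proof (rule integral_cong_AE)
    show "(\<lambda>q. G (t + 1 * q) - indicator {0..t} (t + 1 * q) *\<^sub>R G (t + 1 * q)) \<in> borel_measurable lborel" by measurable
    show "(\<lambda>q. complex_of_real (exp (- (e * t))) * orbit e (\<lambda>x. l (S t x)) (\<phi> (0 - q)) q) \<in> borel_measurable lborel"
      by (rule borel_measurable_integrable[OF integrable_mult_right[OF G']])
    \<comment> \<open>As in \<open>lap_T\<close>, the end point q = 0 is lost to the closed
      indicator and is negligible.\<close>
    have "G (t + 1 * q) - indicator {0..t} (t + 1 * q) *\<^sub>R G (t + 1 * q) = complex_of_real (exp (- (e * t))) * orbit e (\<lambda>x. l (S t x)) (\<phi> (0 - q)) q"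
      if "q \<noteq> 0" for q
    proof (cases "q > 0")
      case True
      have "exp (- (complex_of_real e * complex_of_real (t + q))) = complex_of_real (exp (- (e * t))) * exp (- (complex_of_real e * complex_of_real q))"
        by (simp add: exp_add[symmetric] algebra_simps flip: exp_of_real)
      then show ?thesis using True t by (simp add: G_def orbit_def lap_kernel_def T_add)
    next
      case False
      then have "q < 0" using that by simp
      then show ?thesis using t by (simp add: G_def orbit_def lap_kernel_def indicator_def)
    qed
    then show "AE q in lborel. G (t + 1 * q) - indicator {0..t} (t + 1 * q) *\<^sub>R G (t + 1 * q) = complex_of_real (exp (- (e * t))) * orbit e (\<lambda>x. l (S t x)) (\<phi> (0 - q)) q"
      using AE_lborel_singleton[of 0] by (auto elim: eventually_mono)
  qed
  also have "\<dots> = complex_of_real (exp (- (e * t))) * full_conv e (\<lambda>x. l (S t x)) 0"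
    unfolding full_conv_def by (rule integral_mult_right_zero)
  finally show ?thesis by (simp add: algebra_simps)
qed

text \<open>On the bounded interval \<open>{0..t}\<close> the damping factor tends to 1 boundedly.
  On the half-line the undamped integrand has only a constant bound, so the split at time 0 precedes
  the limit.\<close>

lemma trunc_conv_tendsto:
  assumes l: "functional_bound l c" and c: "0 \<le> c" and e: "e \<longlonglongrightarrow> 0" and epos: "\<And>n. 0 < e n"
  shows "(\<lambda>n. trunc_conv (e n) l t) \<longlonglongrightarrow> l (duhamel t)"
  unfolding trunc_conv_def duhamel_functional(2)[OF l]
proof (rule integral_dominated_convergence[where w = "\<lambda>s. indicator {0..t} s * (c * M * C)"])
  show "integrable lborel (\<lambda>s. indicator {0..t} s * (c * M * C))" by (rule indicator_Icc_integrable)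
  show "(\<lambda>r. indicator {0..t} r *\<^sub>R l (S r (\<phi> (t - r)))) \<in> borel_measurable lborel"
    by (rule borel_measurable_integrable[OF S_\<phi>_integrable[OF l c]]) measurable
  have [measurable]: "(\<lambda>r. orbit (e n) l (\<phi> (t - r)) r) \<in> borel_measurable borel" for n
    by (rule orbit_\<phi>_measurable[OF l]) measurable
  show "(\<lambda>r. indicator {0..t} r *\<^sub>R orbit (e n) l (\<phi> (t - r)) r) \<in> borel_measurable lborel" for n by measurable
  show "AE r in lborel. norm (indicator {0..t} r *\<^sub>R orbit (e n) l (\<phi> (t - r)) r) \<le> indicator {0..t} r * (c * M * C)" for n
  proof (intro AE_I2)
    fix r
    have "cmod (lap_kernel (complex_of_real (e n)) r) \<le> 1" using epos[of n] by (auto simp: norm_lap_kernel indicator_def)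
    then have "cmod (orbit (e n) l (\<phi> (t - r)) r) \<le> c * M * C"
      using S_\<phi>_bound[OF l c, of r "t - r"] unfolding orbit_def norm_mult
      by (metis mult_left_le_one_le norm_ge_zero order_trans)
    then show "norm (indicator {0..t} r *\<^sub>R orbit (e n) l (\<phi> (t - r)) r) \<le> indicator {0..t} r * (c * M * C)"
      by (simp add: indicator_def)
  qed
  show "AE r in lborel. (\<lambda>n. indicator {0..t} r *\<^sub>R orbit (e n) l (\<phi> (t - r)) r) \<longlonglongrightarrow> indicator {0..t} r *\<^sub>R l (S r (\<phi> (t - r)))"
  proof (intro AE_I2)
    fix r
    have "(\<lambda>n. exp (- (complex_of_real (e n) * complex_of_real r))) \<longlonglongrightarrow> exp (- (complex_of_real 0 * complex_of_real r))"
      by (intro tendsto_intros e)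
    then have "(\<lambda>n. indicator {0..t} r *\<^sub>R (exp (- (complex_of_real (e n) * complex_of_real r)) * l (S r (\<phi> (t - r))))) \<longlonglongrightarrow>
        indicator {0..t} r *\<^sub>R (1 * l (S r (\<phi> (t - r))))"
      by (intro tendsto_scaleR tendsto_mult tendsto_const) simp
    moreover have "indicator {0..t} r *\<^sub>R (exp (- (complex_of_real (e n) * complex_of_real r)) * l (S r (\<phi> (t - r))))
        = indicator {0..t} r *\<^sub>R orbit (e n) l (\<phi> (t - r)) r" for n
      by (auto simp: indicator_def orbit_def lap_kernel_def)
    ultimately show "(\<lambda>n. indicator {0..t} r *\<^sub>R orbit (e n) l (\<phi> (t - r)) r) \<longlonglongrightarrow> indicator {0..t} r *\<^sub>R l (S r (\<phi> (t - r)))"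
      by simp
  qed
qed

text \<open>The first bound, uniform in \<open>t\<close>, comes from \<open>full_conv_split\<close>;
  the second, from the size of the integrand, is for the short interval of length \<open>h\<close>
  in \<open>trunc_conv_diff\<close>.\<close>

lemma trunc_conv_bound:
  assumes e: "0 < e" "e \<le> e0" and l: "functional_bound l c" and c: "0 \<le> c" and t: "0 \<le> t"
  shows "cmod (trunc_conv e l t) \<le> conv_bound * (1 + M) * c"
    and "cmod (trunc_conv e l t) \<le> t * M * C * c"
proof -
  have l': "functional_bound (\<lambda>x. l (S t x)) (c * M)" using functional_bound_S[OF l, of t] c by simp
  have cM: "0 \<le> c * M" using c M_ge1 by simp
  have "trunc_conv e l t = full_conv e l t - complex_of_real (exp (- (e * t))) * full_conv e (\<lambda>x. l (S t x)) 0"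
    using full_conv_split[OF e(1) l c t] by simp
  then have "cmod (trunc_conv e l t) \<le> cmod (full_conv e l t) + cmod (complex_of_real (exp (- (e * t))) * full_conv e (\<lambda>x. l (S t x)) 0)"
    by (metis norm_triangle_ineq4)
  also have "cmod (complex_of_real (exp (- (e * t))) * full_conv e (\<lambda>x. l (S t x)) 0) \<le> 1 * cmod (full_conv e (\<lambda>x. l (S t x)) 0)"
    unfolding norm_mult using e t by (intro mult_right_mono) auto
  also have "cmod (full_conv e l t) + 1 * cmod (full_conv e (\<lambda>x. l (S t x)) 0) \<le> conv_bound * c + conv_bound * (c * M)"
    using full_conv_bound[OF e l c, of t] full_conv_bound[OF e l' cM, of 0] by simp
  finally show "cmod (trunc_conv e l t) \<le> conv_bound * (1 + M) * c" by (simp add: algebra_simps)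
  have le: "norm (indicator {0..t} r *\<^sub>R orbit e l (\<phi> (t - r)) r) \<le> indicator {0..t} r * (c * M * C)" for r
  proof -
    have "cmod (lap_kernel (complex_of_real e) r) \<le> 1" using e by (auto simp: norm_lap_kernel indicator_def)
    then have "cmod (orbit e l (\<phi> (t - r)) r) \<le> c * M * C"
      using S_\<phi>_bound[OF l c, of r "t - r"] unfolding orbit_def norm_mult
      by (metis mult_left_le_one_le norm_ge_zero order_trans)
    then show ?thesis by (simp add: indicator_def)
  qed
  have oi: "integrable lborel (\<lambda>r. orbit e l (\<phi> (t - r)) r)"
    by (rule orbit_\<phi>_integrable[OF e(1) l c]) measurable
  have "cmod (trunc_conv e l t) \<le> (LBINT r. norm (indicator {0..t} r *\<^sub>R orbit e l (\<phi> (t - r)) r))"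
    unfolding trunc_conv_def by (rule integral_norm_bound)
  also have "\<dots> \<le> (LBINT r. indicator {0..t} r * (c * M * C))"
    using le oi by (intro integral_mono integrable_norm indicator_Icc_integrable integrable_mult_indicator) auto
  also have "\<dots> = t * M * C * c" using t by simp
  finally show "cmod (trunc_conv e l t) \<le> t * M * C * c" .
qed

definition e_seq :: "nat \<Rightarrow> real" where "e_seq n = e0 * inverse (Suc n)"

lemma e_seq:
  assumes "0 < e0"
  shows "e_seq \<longlonglongrightarrow> 0" "0 < e_seq n" "e_seq n \<le> e0"
proof -
  have "(\<lambda>n. e0 * inverse (real (Suc n))) \<longlonglongrightarrow> e0 * 0"
    by (intro tendsto_mult tendsto_const LIMSEQ_inverse_real_of_nat)
  then show "e_seq \<longlonglongrightarrow> 0" by (simp add: e_seq_def[abs_def])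
  show "0 < e_seq n" using assms by (simp add: e_seq_def)
  have "inverse (real (Suc n)) \<le> 1" by (simp add: inverse_le_1_iff)
  then show "e_seq n \<le> e0" using assms mult_left_mono[of "inverse (real (Suc n))" 1 e0] by (simp add: e_seq_def)
qed

lemma duhamel_bound:
  assumes e0: "0 < e0" and t: "0 \<le> t"
  shows "norm (duhamel t) \<le> conv_bound * (1 + M)"
proof (rule norm_le_functionals)
  fix l :: "'a \<Rightarrow> complex" assume l: "functional_bound l 1"
  have "(\<lambda>n. cmod (trunc_conv (e_seq n) l t)) \<longlonglongrightarrow> cmod (l (duhamel t))"
    by (intro tendsto_norm trunc_conv_tendsto[OF l _ e_seq(1,2)[OF e0]]) simp
  moreover have "cmod (trunc_conv (e_seq n) l t) \<le> conv_bound * (1 + M)" for n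
    using trunc_conv_bound(1)[OF e_seq(2,3)[OF e0] l _ t] by simp
  ultimately show "cmod (l (duhamel t)) \<le> conv_bound * (1 + M)"
    by (intro LIMSEQ_le_const2[where X = "\<lambda>n. cmod (trunc_conv (e_seq n) l t)"]) auto
qed

text \<open>\<open>full_conv_split\<close> is used at t + h, at t and, for \<open>k = l\<close>
  composed with \<open>S t\<close>, at h. The last use rewrites the past term at t + h through
  \<open>full_conv e k (0 + h) - trunc_conv e k h\<close>, so that only increments of
  \<open>full_conv\<close> and one integral over a short interval remain.\<close>

lemma trunc_conv_diff:
  assumes e: "0 < e" "e \<le> e0" and l: "functional_bound l 1" and t: "0 \<le> t" and h: "0 < h" "h \<le> 1"
  shows "cmod (trunc_conv e l (t + h) - trunc_conv e l t) \<le> (1 + M) * \<kappa> h + h * M * C * M"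
proof -
  define k where "k = (\<lambda>x. l (S t x))"
  have k: "functional_bound k M" unfolding k_def using functional_bound_S[OF l, of t] by simp
  have kh: "(\<lambda>x. k (S h x)) = (\<lambda>x. l (S (t + h) x))"
    unfolding k_def using t h by (simp add: T_add)
  have M0: "0 \<le> M" using M_ge1 by simp
  have ex: "exp (- (e * (t + h))) = exp (- (e * t)) * exp (- (e * h))" by (simp add: exp_add[symmetric] algebra_simps)
  have "full_conv e k (0 + h) = trunc_conv e k h + complex_of_real (exp (- (e * h))) * full_conv e (\<lambda>x. k (S h x)) 0"
    using full_conv_split[OF e(1) k M0, of h] h by simp
  then have 2: "complex_of_real (exp (- (e * h))) * full_conv e (\<lambda>x. l (S (t + h) x)) 0 = full_conv e k (0 + h) - trunc_conv e k h"
    unfolding kh by simp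
  have "trunc_conv e l (t + h) = full_conv e l (t + h) - complex_of_real (exp (- (e * (t + h)))) * full_conv e (\<lambda>x. l (S (t + h) x)) 0"
    using full_conv_split[OF e(1) l, of "t + h"] t h by simp
  also have "complex_of_real (exp (- (e * (t + h)))) * full_conv e (\<lambda>x. l (S (t + h) x)) 0 = complex_of_real (exp (- (e * t))) * (full_conv e k (0 + h) - trunc_conv e k h)"
    unfolding ex 2[symmetric] by simp
  finally have 3: "trunc_conv e l (t + h) = full_conv e l (t + h) - complex_of_real (exp (- (e * t))) * (full_conv e k (0 + h) - trunc_conv e k h)" .
  have 4: "trunc_conv e l t = full_conv e l t - complex_of_real (exp (- (e * t))) * full_conv e k 0"
    using full_conv_split[OF e(1) l _ t] by (simp add: k_def)
  have "trunc_conv e l (t + h) - trunc_conv e l t = (full_conv e l (t + h) - full_conv e l t)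
      - complex_of_real (exp (- (e * t))) * ((full_conv e k (0 + h) - full_conv e k 0) - trunc_conv e k h)"
    unfolding 3 4 by (simp add: algebra_simps)
  then have "cmod (trunc_conv e l (t + h) - trunc_conv e l t) \<le> cmod (full_conv e l (t + h) - full_conv e l t)
      + cmod (complex_of_real (exp (- (e * t))) * ((full_conv e k (0 + h) - full_conv e k 0) - trunc_conv e k h))"
    by (metis norm_triangle_ineq4)
  moreover have "cmod (full_conv e l (t + h) - full_conv e l t) \<le> \<kappa> h * 1"
    using full_conv_diff[OF e l _ , of h t] h by simp
  moreover have "cmod (complex_of_real (exp (- (e * t))) * ((full_conv e k (0 + h) - full_conv e k 0) - trunc_conv e k h))
      \<le> 1 * (\<kappa> h * M + h * M * C * M)"
  proof -
    have "cmod ((full_conv e k (0 + h) - full_conv e k 0) - trunc_conv e k h) \<le> \<kappa> h * M + h * M * C * M"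
      using norm_triangle_ineq4[of "full_conv e k (0 + h) - full_conv e k 0" "trunc_conv e k h"]
        full_conv_diff[OF e k M0, of h 0] trunc_conv_bound(2)[OF e k M0, of h] h by simp
    then show ?thesis unfolding norm_mult using e t by (intro mult_mono) auto
  qed
  ultimately show ?thesis by (simp add: algebra_simps)
qed

lemma duhamel_diff:
  assumes e0: "0 < e0" and t: "0 \<le> t" and h: "0 < h" "h \<le> 1"
  shows "norm (duhamel (t + h) - duhamel t) \<le> (1 + M) * \<kappa> h + h * M * C * M"
proof (rule norm_le_functionals)
  fix l :: "'a \<Rightarrow> complex" assume l: "functional_bound l 1"
  have "(\<lambda>n. cmod (trunc_conv (e_seq n) l (t + h) - trunc_conv (e_seq n) l t)) \<longlonglongrightarrow> cmod (l (duhamel (t + h)) - l (duhamel t))"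
    by (intro tendsto_norm tendsto_diff trunc_conv_tendsto[OF l _ e_seq(1,2)[OF e0]]) simp_all
  moreover have "cmod (trunc_conv (e_seq n) l (t + h) - trunc_conv (e_seq n) l t) \<le> (1 + M) * \<kappa> h + h * M * C * M" for n
    by (rule trunc_conv_diff[OF e_seq(2,3)[OF e0] l t h])
  ultimately show "cmod (l (duhamel (t + h) - duhamel t)) \<le> (1 + M) * \<kappa> h + h * M * C * M"
    unfolding functional_bound_linear(6)[OF l]
    by (intro LIMSEQ_le_const2[where X = "\<lambda>n. cmod (trunc_conv (e_seq n) l (t + h) - trunc_conv (e_seq n) l t)"]) auto
qed

lemma duhamel_uniformly_continuous:
  assumes e0: "0 < e0"
  shows "uniformly_continuous_on {0..} duhamel"
proof (rule uniformly_continuous_on_nonnegI)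
  fix d :: real assume d: "0 < d"
  have "((\<lambda>h. (1 + M) * ((2 * kernel_sup + 1) * C * (sqrt (\<eta> h) * cauchy_mass)) + h * M * C * M) \<longlongrightarrow>
      (1 + M) * ((2 * kernel_sup + 1) * C * (sqrt 0 * cauchy_mass)) + 0 * M * C * M) (at 0)"
    by (intro tendsto_intros \<eta>_tendsto)
  then have "((\<lambda>h. (1 + M) * \<kappa> h + h * M * C * M) \<longlongrightarrow> 0) (at 0)" by (simp add: \<kappa>_def)
  then have "\<forall>\<^sub>F h in at 0. (1 + M) * \<kappa> h + h * M * C * M < d" using d by (rule order_tendstoD)
  then obtain r where r: "0 < r" "\<And>h. h \<noteq> 0 \<Longrightarrow> \<bar>h\<bar> < r \<Longrightarrow> (1 + M) * \<kappa> h + h * M * C * M < d"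
    unfolding eventually_at by (auto simp: dist_real_def)
  show "\<exists>r>0. \<forall>t\<ge>0. \<forall>h>0. h < r \<longrightarrow> dist (duhamel (t + h)) (duhamel t) < d"
  proof (intro exI[of _ "min r 1"] conjI allI impI)
    fix t h :: real assume t: "0 \<le> t" and h: "0 < h" "h < min r 1"
    have "norm (duhamel (t + h) - duhamel t) \<le> (1 + M) * \<kappa> h + h * M * C * M"
      by (rule duhamel_diff[OF e0 t]) (use h in auto)
    also have "\<dots> < d" using r(2)[of h] h by simp
    finally show "dist (duhamel (t + h)) (duhamel t) < d" by (simp add: dist_norm)
  qed (use r in simp)
qed

text \<open>Fubini on the triangle 0 \<le> r \<le> s \<le> t. The inner integral is the integrated
  semigroup at \<open>t - r\<close>, whose values lie in the domain of \<open>A\<close>; this is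
  what puts the integral of \<open>duhamel\<close> there.\<close>

lemma functional_integral_duhamel:
  assumes l: "functional_bound l c" and c: "0 \<le> c" and dct: "continuous_on {0..t} duhamel"
  shows "l (integral {0..t} duhamel) = (LBINT r. indicator {0..t} r *\<^sub>R l (int_semigroup (t - r) (\<phi> r)))"
    and "integrable lborel (\<lambda>r. indicator {0..t} r *\<^sub>R l (int_semigroup (t - r) (\<phi> r)))"
proof -
  define F where "F r s = indicator {0..t} s *\<^sub>R (indicator {0..s} r *\<^sub>R l (S (s - r) (\<phi> r)))" for r s :: real
  have Fm: "case_prod F \<in> borel_measurable (lborel \<Otimes>\<^sub>M lborel)"
  proof -
    have [measurable]: "(\<lambda>p::real \<times> real. l (S (snd p - fst p) (\<phi> (fst p)))) \<in> borel_measurable (lborel \<Otimes>\<^sub>M lborel)"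
      by (rule S_\<phi>_measurable[OF l]) measurable
    have "(\<lambda>p::real \<times> real. (if 0 \<le> snd p \<and> snd p \<le> t \<and> 0 \<le> fst p \<and> fst p \<le> snd p then l (S (snd p - fst p) (\<phi> (fst p))) else 0))
        \<in> borel_measurable (lborel \<Otimes>\<^sub>M lborel)" by measurable
    also have "(\<lambda>p::real \<times> real. (if 0 \<le> snd p \<and> snd p \<le> t \<and> 0 \<le> fst p \<and> fst p \<le> snd p then l (S (snd p - fst p) (\<phi> (fst p))) else 0)) = case_prod F"
      by (auto simp: F_def fun_eq_iff indicator_def)
    finally show ?thesis .
  qed
  have Fb: "cmod (F r s) \<le> (indicator {0..t} r * (c * M * C)) * indicator {0..t} (s + 0 * r)" for r s
    using S_\<phi>_bound[OF l c, of "s - r" r] order_trans[OF norm_ge_zero S_\<phi>_bound[OF l c]]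
    by (auto simp: F_def indicator_def)
  have ii: "integrable lborel (indicator {0..t} :: real \<Rightarrow> real)"
    by (intro integrable_real_indicator) (auto simp: emeasure_lborel_Icc_eq)
  note fub = fubini_bound[OF Fm indicator_Icc_integrable[of t "c * M * C"] ii Fb]
  have Feq: "(LBINT s. F r s) = indicator {0..t} r *\<^sub>R l (int_semigroup (t - r) (\<phi> r))" for r
  proof (cases "r \<in> {0..t}")
    case True
    have "(LBINT s. F r s) = (LBINT u. F r (r + 1 * u))"
      using lborel_integral_real_affine[of 1 "\<lambda>s. F r s" r] by simp
    also have "\<dots> = (LBINT u. indicator {0..t - r} u *\<^sub>R l (S u (\<phi> r)))"
      using True by (intro Bochner_Integration.integral_cong refl) (auto simp: F_def indicator_def)
    also have "\<dots> = l (int_semigroup (t - r) (\<phi> r))"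
      unfolding int_semigroup_def by (rule functional_integral(1)[OF continuous_on_subset[OF S_continuous] l, symmetric]) simp
    finally show ?thesis using True by simp
  next
    case False
    then have "F r s = 0" for s by (auto simp: F_def indicator_def)
    then show ?thesis using False by simp
  qed
  show "l (integral {0..t} duhamel) = (LBINT r. indicator {0..t} r *\<^sub>R l (int_semigroup (t - r) (\<phi> r)))"
  proof -
    have "l (integral {0..t} duhamel) = (LBINT s. indicator {0..t} s *\<^sub>R l (duhamel s))" by (rule functional_integral(1)[OF dct l])
    also have "\<dots> = (LBINT s. LBINT r. F r s)" unfolding duhamel_functional(1)[OF l] F_def integral_scaleR_right ..
    also have "\<dots> = (LBINT r. LBINT s. F r s)" using fub(1) by simp
    also have "\<dots> = (LBINT r. indicator {0..t} r *\<^sub>R l (int_semigroup (t - r) (\<phi> r)))"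
      unfolding Feq ..
    finally show ?thesis .
  qed
  show "integrable lborel (\<lambda>r. indicator {0..t} r *\<^sub>R l (int_semigroup (t - r) (\<phi> r)))"
    using fub(2) unfolding Feq .
qed

lemma duhamel_0: "duhamel 0 = 0"
proof (rule eq_functionals)
  fix l :: "'a \<Rightarrow> complex" assume l: "functional_bound l 1"
  have "AE s in lborel. indicator {0..0::real} s *\<^sub>R l (S (0 - s) (\<phi> s)) = 0"
    using AE_lborel_singleton[of "0::real"] by eventually_elim (simp add: indicator_def)
  then have "(LBINT s. indicator {0..0} s *\<^sub>R l (S (0 - s) (\<phi> s))) = 0" by (rule integral_eq_zero_AE)
  then show "l (duhamel 0) = l 0"
    unfolding duhamel_functional(1)[OF l] using linear_0[OF bounded_linear.linear[OF functional_bound_linear(1)[OF l]]] by simp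
qed

text \<open>By \<open>domain_iff_lap\<close> the equation \<open>A P = duhamel t - \<Phi>\<close>
  becomes an identity between bounded operators. Tested against \<open>l\<close> it holds under the
  integral for each \<open>r\<close>, where it says that \<open>A\<close> maps
  \<open>int_semigroup (t - r) (\<phi> r)\<close> to
  \<open>T (t - r) (\<phi> r) - \<phi> r\<close>.\<close>

lemma mild_solution_duhamel:
  assumes e0: "0 < e0" and AE: "AE s in lebesgue. \<phi>0 s = \<phi> s"
  shows "mild_solution D A \<phi>0 (\<lambda>t. S t x + duhamel t)"
  unfolding mild_solution_def
proof (intro conjI allI impI)
  have dc: "continuous_on {0..} duhamel"
    using duhamel_uniformly_continuous[OF e0] by (rule uniformly_continuous_imp_continuous)
  show cont: "continuous_on {0..} (\<lambda>t. S t x + duhamel t)"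
    by (intro continuous_on_add dc continuous_on_subset[OF S_continuous]) auto
  fix t :: real assume t: "0 \<le> t"
  have dct: "continuous_on {0..t} duhamel" using dc by (rule continuous_on_subset) auto
  define P where "P = integral {0..t} duhamel"
  define \<Phi> where "\<Phi> = bochner_integral (lebesgue_on {0..t}) \<phi>"
  have P: "P = lap 1 (P - (duhamel t - \<Phi>))"
  proof (rule eq_functionals)
    fix l :: "'a \<Rightarrow> complex" assume l: "functional_bound l 1"
    define b where "b = (LBINT t. cmod (lap_kernel 1 t)) * M"
    have b0: "0 \<le> b" unfolding b_def using M_ge1
      by (intro mult_nonneg_nonneg Bochner_Integration.integral_nonneg) auto
    have m: "functional_bound (\<lambda>x. l (lap 1 x)) b"
      unfolding functional_bound_def
    proof (intro conjI allI)
      show "bounded_clinear (\<lambda>x. l (lap 1 x))"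
        by (rule bounded_clinear_compose) (use l lap_bounded_clinear[of 1] in \<open>auto simp: functional_bound_def\<close>)
      show "cmod (l (lap 1 y)) \<le> b * norm y" for y
        using functional_bound_linear(3)[OF l, of "lap 1 y"] lap_bound[of 1 y] unfolding b_def by simp
    qed
    note lP = functional_integral_duhamel(1)[OF l _ dct, folded P_def, simplified]
    note mP = functional_integral_duhamel(1)[OF m b0 dct, folded P_def]
    note mPi = functional_integral_duhamel(2)[OF m b0 dct]
    have md: "l (lap 1 (duhamel t)) = (LBINT r. indicator {0..t} r *\<^sub>R l (lap 1 (S (t - r) (\<phi> r))))"
      by (rule duhamel_functional(1)[OF m])
    have mdi: "integrable lborel (\<lambda>r. indicator {0..t} r *\<^sub>R l (lap 1 (S (t - r) (\<phi> r))))"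
      by (rule S_\<phi>_integrable[OF m b0]) measurable
    have m\<Phi>: "l (lap 1 \<Phi>) = (LBINT r. indicator {0..t} r *\<^sub>R l (lap 1 (\<phi> r)))"
      unfolding \<Phi>_def by (rule bochner_integral_lebesgue_on(2)[OF \<phi>_simple \<phi>_bound _ m, where g = \<phi>]) simp
    have m\<Phi>i: "integrable lborel (\<lambda>r. indicator {0..t} r *\<^sub>R l (lap 1 (\<phi> r)))"
      using S_\<phi>_integrable[OF m b0, of "\<lambda>r. r" "\<lambda>r. 0" t] by simp
    have "l (lap 1 (P - (duhamel t - \<Phi>))) = l (lap 1 P) - l (lap 1 (duhamel t)) + l (lap 1 \<Phi>)"
      by (simp add: functional_bound_linear[OF m])
    also have "\<dots> = (LBINT r. indicator {0..t} r *\<^sub>R l (lap 1 (int_semigroup (t - r) (\<phi> r)))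
        - indicator {0..t} r *\<^sub>R l (lap 1 (S (t - r) (\<phi> r))) + indicator {0..t} r *\<^sub>R l (lap 1 (\<phi> r)))"
      unfolding mP md m\<Phi> using mPi mdi m\<Phi>i by simp
    also have "\<dots> = l P" unfolding lP
    proof (rule Bochner_Integration.integral_cong[OF refl])
      fix r
      show "indicator {0..t} r *\<^sub>R l (lap 1 (int_semigroup (t - r) (\<phi> r))) - indicator {0..t} r *\<^sub>R l (lap 1 (S (t - r) (\<phi> r)))
          + indicator {0..t} r *\<^sub>R l (lap 1 (\<phi> r)) = indicator {0..t} r *\<^sub>R l (int_semigroup (t - r) (\<phi> r))"
      proof (cases "r \<in> {0..t}")
        case True
        then have "int_semigroup (t - r) (\<phi> r) \<in> D \<and> A (int_semigroup (t - r) (\<phi> r)) = T (t - r) (\<phi> r) - \<phi> r"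
          using int_semigroup_domain[of "t - r" "\<phi> r"] by simp
        then have "int_semigroup (t - r) (\<phi> r) = lap 1 (int_semigroup (t - r) (\<phi> r) - (T (t - r) (\<phi> r) - \<phi> r))"
          by (simp only: domain_iff_lap)
        then have "l (int_semigroup (t - r) (\<phi> r)) = l (lap 1 (int_semigroup (t - r) (\<phi> r) - (T (t - r) (\<phi> r) - \<phi> r)))"
          by (rule arg_cong)
        then show ?thesis using True by (simp add: functional_bound_linear[OF m])
      qed simp
    qed
    finally show "l P = l (lap 1 (P - (duhamel t - \<Phi>)))" by simp
  qed
  have PD: "P \<in> D \<and> A P = duhamel t - \<Phi>" unfolding domain_iff_lap using P .
  have J: "int_semigroup t x \<in> D" "A (int_semigroup t x) = T t x - x" by (rule int_semigroup_domain[OF t])+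
  have U: "bochner_integral (lebesgue_on {0..t}) (\<lambda>t. S t x + duhamel t) = int_semigroup t x + P"
    unfolding bochner_integral_continuous[OF cont t] int_semigroup_def P_def
    by (rule integral_add[OF S_integrable_on integrable_continuous_real[OF dct]])
  have \<Phi>0: "bochner_integral (lebesgue_on {0..t}) \<phi>0 = \<Phi>"
    unfolding \<Phi>_def by (rule bochner_integral_lebesgue_on(1)[OF \<phi>_simple \<phi>_bound AE])
  show "bochner_integral (lebesgue_on {0..t}) (\<lambda>t. S t x + duhamel t) \<in> D"
    unfolding U by (rule generator_add(1)) (use J PD in auto)
  show "S t x + duhamel t = S 0 x + duhamel 0 + A (bochner_integral (lebesgue_on {0..t}) (\<lambda>t. S t x + duhamel t))
      + bochner_integral (lebesgue_on {0..t}) \<phi>0"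
    unfolding U \<Phi>0 duhamel_0 using J PD t by (simp add: generator_add)
qed

end

subsection \<open>Cut-offs subordinate to the Beurling spectrum\<close>

lemma integrable_one_plus_abs_powr:
  assumes p: "1 < p"
  shows "integrable lborel (\<lambda>s::real. (1 + \<bar>s\<bar>) powr (- p))"
proof -
  have d: "((\<lambda>s. - ((1 + s) powr (1 - p) / (p - 1))) has_real_derivative (1 + s) powr (- p)) (at s)" if "0 \<le> s" for s
  proof -
    have "((\<lambda>s. (1 + s) powr (1 - p)) has_real_derivative (1 - p) * (1 + s) powr (1 - p - 1) * 1) (at s)"
      by (rule DERIV_chain2[OF has_real_derivative_powr]) (use that in \<open>auto intro!: derivative_eq_intros\<close>)
    then have "((\<lambda>s. - ((1 + s) powr (1 - p) / (p - 1))) has_real_derivative - ((1 - p) * (1 + s) powr (1 - p - 1) * 1 / (p - 1))) (at s)"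
      by (intro DERIV_minus DERIV_cdivide)
    moreover have "- ((1 - p) * (1 + s) powr (1 - p - 1) * 1 / (p - 1)) = (1 + s) powr (- p)"
      using p by (simp add: divide_simps) (simp add: algebra_simps)
    ultimately show ?thesis by simp
  qed
  have lim: "((\<lambda>s::real. - ((1 + s) powr (1 - p) / (p - 1))) \<longlongrightarrow> - (0 / (p - 1))) at_top"
  proof (intro tendsto_intros)
    show "((\<lambda>s::real. (1 + s) powr (1 - p)) \<longlongrightarrow> 0) at_top"
      using p by (intro tendsto_neg_powr filterlim_tendsto_add_at_top[OF tendsto_const] filterlim_ident) auto
  qed (use p in simp)
  have "(\<integral>\<^sup>+s. ennreal ((1 + s) powr (- p)) * indicator {0..} s \<partial>lborel) = - (0 / (p - 1)) - (- ((1 + 0) powr (1 - p) / (p - 1)))"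
    by (rule nn_integral_FTC_atLeast[OF _ d _ lim]) auto
  then have fin: "(\<integral>\<^sup>+s. ennreal ((1 + s) powr (- p)) * indicator {0..} s \<partial>lborel) < \<infinity>" by (simp only:) simp
  have i: "integrable lborel (\<lambda>s::real. indicator {0..} s * (1 + s) powr (- p))"
  proof (rule integrableI_nonneg)
    have "(\<lambda>s::real. ennreal (indicator {0..} s * (1 + s) powr (- p))) = (\<lambda>s. ennreal ((1 + s) powr (- p)) * indicator {0..} s)"
      by (auto simp: indicator_def)
    then show "(\<integral>\<^sup>+s. ennreal (indicator {0..} s * (1 + s) powr (- p)) \<partial>lborel) < \<infinity>" using fin by simp
  qed (auto simp: indicator_def)
  have i': "integrable lborel (\<lambda>s::real. indicator {0..} (- s) * (1 + - s) powr (- p))"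
    using lborel_integrable_real_affine[OF i, of "-1" 0] by simp
  show ?thesis
    by (rule Bochner_Integration.integrable_bound[OF Bochner_Integration.integrable_add[OF i i']])
       (auto simp: indicator_def)
qed

lemma lebesgue_integrable_borel_version:
  fixes f :: "real \<Rightarrow> complex"
  assumes "integrable lebesgue f"
  obtains g where "integrable lborel g" "AE x in lborel. f x = g x"
proof -
  have "(\<lambda>x. Re (f x)) \<in> borel_measurable lebesgue" "(\<lambda>x. Im (f x)) \<in> borel_measurable lebesgue"
    using assms by (auto intro: borel_measurable_integrable)
  then obtain u v where [measurable]: "u \<in> borel_measurable lborel" "v \<in> borel_measurable lborel"
    and uv: "AE x in lborel. Re (f x) = u x" "AE x in lborel. Im (f x) = v x"
    using completion_ex_borel_measurable_real[of _ lborel] by metis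
  define g where "g x = Complex (u x) (v x)" for x
  have gm: "g \<in> borel_measurable lborel" unfolding g_def[abs_def] Complex_eq by measurable
  have AE: "AE x in lborel. f x = g x"
    using uv by eventually_elim (simp add: g_def complex_eq_iff)
  have "integrable lebesgue g"
    by (rule integrable_cong_AE_imp[OF assms measurable_completion[OF gm]]) (use AE in \<open>auto simp: AE_completion_iff\<close>)
  then have "integrable lborel g" using integrable_completion[OF gm] by simp
  then show ?thesis using AE that by blast
qed

lemma AE_lebesgue_reflect:
  assumes "AE s in lebesgue. P s"
  shows "AE s in lebesgue. P (t - s :: real)"
proof -
  have "AE s in lborel. P s" using assms by (simp add: AE_completion_iff)
  then obtain N where N: "N \<in> null_sets lborel" "{s. \<not> P s} \<subseteq> N"
    unfolding eventually_ae_filter by auto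
  have [measurable]: "N \<in> sets borel" using N by auto
  have "AE s in lborel. s \<notin> N" using N(1) by (rule AE_not_in)
  then have "AE s in lborel. t + -1 * s \<notin> N" by (intro AE_borel_affine) auto
  then have "AE s in lborel. P (t - s)" by eventually_elim (use N in auto)
  then show ?thesis by (simp add: AE_completion_iff)
qed

text \<open>The witness from the definition of the spectrum is only Lebesgue measurable and is
  convolved with the original representative. Borel versions of both are substituted, so that the
  Fubini arguments over \<open>lborel\<close> apply to them.\<close>

lemma beurling_separating_function:
  fixes \<phi>0 \<phi> :: "real \<Rightarrow> 'a::complex_banach"
  assumes \<phi>: "simple_limit lborel \<phi>" and C: "\<And>t. norm (\<phi> t) \<le> C"
    and AE: "AE s in lebesgue. \<phi>0 s = \<phi> s" and w: "w \<notin> beurling_spectrum \<phi>0"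
  obtains f where "integrable lborel f" "ft f w \<noteq> 0"
    "\<And>l c t. functional_bound l c \<Longrightarrow> (LBINT s. f s * l (\<phi> (t - s))) = 0"
proof -
  obtain f0 where f0: "integrable lebesgue f0" and conv: "\<And>t. Defs.convolution \<phi>0 f0 t = 0" and fw: "fourier f0 w \<noteq> 0"
    using w by (auto simp: beurling_spectrum_def)
  obtain f where f: "integrable lborel f" and ff: "AE x in lborel. f0 x = f x"
    using lebesgue_integrable_borel_version[OF f0] by blast
  have [measurable]: "f \<in> borel_measurable borel" using f by auto
  have ff': "AE x in lebesgue. f0 x = f x" using ff by (simp add: AE_completion_iff)
  have cis: "exp (- \<i> * complex_of_real w * complex_of_real t) = cis (- (w * t))" for t
    by (simp add: cis_conv_exp mult.assoc)
  have "fourier f0 w = (LINT t|lebesgue. f t * cis (- (w * t)))"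
    unfolding fourier_def cis
  proof (rule integral_cong_AE)
    have "f0 \<in> borel_measurable lebesgue" using f0 by (rule borel_measurable_integrable)
    moreover have "(\<lambda>t. cis (- (w * t))) \<in> borel_measurable lebesgue"
      by (rule measurable_completion) measurable
    ultimately show "(\<lambda>t. f0 t * cis (- (w * t))) \<in> borel_measurable lebesgue"
      by (rule borel_measurable_times)
    show "(\<lambda>t. f t * cis (- (w * t))) \<in> borel_measurable lebesgue"
      by (intro measurable_completion) measurable
    show "AE t in lebesgue. f0 t * cis (- (w * t)) = f t * cis (- (w * t))"
      using ff' by eventually_elim simp
  qed
  also have "\<dots> = ft f w" unfolding ft_def by (rule integral_completion) measurable
  finally have ftf: "ft f w \<noteq> 0" using fw by simp
  have "(LBINT s. f s * l (\<phi> (t - s))) = 0" if l: "functional_bound l c" for l c t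
  proof -
    have sl: "simple_limit lborel (\<lambda>s. f s *\<^sub>C \<phi> (t - s))"
      by (intro simple_limit_scaleC borel_measurable_imp_simple_limit simple_limit_measurable_compose[OF _ \<phi>]) measurable
    have id: "(\<lambda>x. x) \<in> measurable lebesgue (lborel :: real measure)"
      by (rule measurable_completion) simp
    have sl': "simple_limit lebesgue (\<lambda>s. f s *\<^sub>C \<phi> (t - s))"
      by (rule simple_limit_measurable_compose[OF id sl])
    have "(\<integral>\<^sup>+s. norm (f s *\<^sub>C \<phi> (t - s)) \<partial>lebesgue) \<le> (\<integral>\<^sup>+s. norm (cmod (f s) * C) \<partial>lebesgue)"
    proof (intro nn_integral_mono ennreal_leI)
      fix s
      have "cmod (f s) * norm (\<phi> (t - s)) \<le> cmod (f s) * C" using C by (intro mult_left_mono) auto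
      then show "norm (f s *\<^sub>C \<phi> (t - s)) \<le> norm (cmod (f s) * C)" by (simp add: norm_scaleC)
    qed
    also have "\<dots> = (\<integral>\<^sup>+s. norm (cmod (f s) * C) \<partial>lborel)" by (rule nn_integral_completion)
    also have "\<dots> < \<infinity>"
      using integrable_mult_left[OF integrable_norm[OF f], of C] unfolding integrable_iff_bounded by blast
    finally have fin: "(\<integral>\<^sup>+s. norm (f s *\<^sub>C \<phi> (t - s)) \<partial>lebesgue) < \<infinity>" .
    have AEc: "AE s in lebesgue. f0 s *\<^sub>C \<phi>0 (t - s) = f s *\<^sub>C \<phi> (t - s)"
      using ff' AE_lebesgue_reflect[OF AE, of t] by eventually_elim simp
    have "has_bochner lebesgue (\<lambda>s. f0 s *\<^sub>C \<phi>0 (t - s)) = has_bochner lebesgue (\<lambda>s. f s *\<^sub>C \<phi> (t - s))"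
      by (rule has_bochner_cong_AE[OF borel_measurable_completion_AE[OF simple_limit_imp_borel_measurable[OF sl] AEc]
            simple_limit_imp_borel_measurable[OF sl'] AEc])
    then have "bochner_integral lebesgue (\<lambda>s. f s *\<^sub>C \<phi> (t - s)) = Defs.convolution \<phi>0 f0 t"
      by (simp add: Defs.convolution_def bochner_integral_def)
    then have "l 0 = (LINT s|lebesgue. l (f s *\<^sub>C \<phi> (t - s)))"
      using simple_limit_bochner_functional(2)[OF sl' fin l] conv by simp
    also have "\<dots> = (LBINT s. l (f s *\<^sub>C \<phi> (t - s)))"
      by (rule integral_completion, rule simple_limit_imp_borel_measurable,
          rule simple_limit_bounded_linear[OF functional_bound_linear(1)[OF l] sl])
    finally show ?thesis
      using linear_0[OF bounded_linear.linear[OF functional_bound_linear(1)[OF l]]]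
      by (simp add: functional_bound_linear(2)[OF l])
  qed
  then show ?thesis using that[OF f ftf] by blast
qed

lemma inv_ft_sum:
  assumes "\<And>j. j \<in> J \<Longrightarrow> integrable lborel (p j)"
  shows "inv_ft (\<lambda>s. \<Sum>j\<in>J. p j s) t = (\<Sum>j\<in>J. inv_ft (p j) t)"
proof -
  have "integrable lborel (\<lambda>s. p j s * cis (s * t))" if "j \<in> J" for j
    using integrable_mult_cis(1)[OF assms[OF that], of t] by (simp add: mult.commute)
  then have "(LBINT s. \<Sum>j\<in>J. p j s * cis (s * t)) = (\<Sum>j\<in>J. LBINT s. p j s * cis (s * t))"
    by (rule Bochner_Integration.integral_sum)
  then show ?thesis by (simp add: inv_ft_def sum_distrib_right sum_divide_distrib)
qed

text \<open>The condition excluded in \<open>N_bound\<close> asks for \<open>B s = 1\<close>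
  together with vanishing derivatives; this supplies the latter.\<close>

lemma C2_compact_locally_one:
  assumes B: "C2_compact B B' B''" and U: "open U" "s \<in> U" and one: "\<And>s. s \<in> U \<Longrightarrow> B s = 1"
  shows "B' s = 0" "B'' s = 0"
proof -
  have *: "B' s = 0" if s: "s \<in> U" for s
  proof -
    have "((\<lambda>_. 1 :: complex) has_vector_derivative 0) (at s)" by (rule has_vector_derivative_const)
    then have "(B has_vector_derivative 0) (at s)"
      by (rule has_vector_derivative_transform_within_open[OF _ U(1) s]) (simp add: one)
    then show ?thesis using C2_compactD(1)[OF B, of s] by (metis vector_derivative_unique_at)
  qed
  show "B' s = 0" by (rule *[OF U(2)])
  have "((\<lambda>_. 0 :: complex) has_vector_derivative 0) (at s)" by (rule has_vector_derivative_const)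
  then have "(B' has_vector_derivative 0) (at s)"
    by (rule has_vector_derivative_transform_within_open[OF _ U]) (simp add: *)
  then show "B'' s = 0" using C2_compactD(2)[OF B, of s] by (metis vector_derivative_unique_at)
qed

text \<open>Translates of one cubic B-spline sum to 1 because consecutive steps telescope; the
  Lebesgue number of the cover by balls makes each retained translate fit into one of the
  balls.\<close>

lemma subordinate_partition:
  fixes K :: "real set" and r :: "real \<Rightarrow> real"
  assumes K: "compact K" and r: "\<And>w. w \<in> K \<Longrightarrow> 0 < r w"
  obtains h J and p p' p'' :: "nat \<Rightarrow> real \<Rightarrow> complex" where "0 < h" "finite J"
    "\<And>j. j \<in> J \<Longrightarrow> C2_compact (p j) (p' j) (p'' j)"
    "\<And>j. j \<in> J \<Longrightarrow> \<exists>w\<in>K. \<forall>s. p j s \<noteq> 0 \<longrightarrow> \<bar>s - w\<bar> \<le> r w"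
    "\<And>s x. x \<in> K \<Longrightarrow> \<bar>s - x\<bar> < h \<Longrightarrow> (\<Sum>j\<in>J. p j s) = 1"
proof -
  have "K \<subseteq> \<Union>((\<lambda>w. ball w (r w)) ` K)" using r by auto
  then obtain \<epsilon> where \<epsilon>: "0 < \<epsilon>" "\<And>x. x \<in> K \<Longrightarrow> \<exists>G\<in>(\<lambda>w. ball w (r w)) ` K. ball x \<epsilon> \<subseteq> G"
    by (rule Heine_Borel_lemma[OF K]) auto
  \<comment> \<open>9 = 4 + 5: a bump has support of length \<open>4 * h\<close>, and the definition
    of \<open>J\<close> places its left end within \<open>5 * h\<close> of a point of
    \<open>K\<close>. The support then stays within the Lebesgue number \<epsilon> of that
    point.\<close>
  define h where "h = \<epsilon> / 9"
  have h: "0 < h" using \<epsilon> by (simp add: h_def)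
  obtain a where a: "\<And>x. x \<in> K \<Longrightarrow> \<bar>x\<bar> \<le> a"
    using compact_imp_bounded[OF K] unfolding bounded_iff real_norm_def by blast
  \<comment> \<open>\<open>m\<close> shifts the grid so that it is indexed by naturals. The slack 5
    ensures that near \<open>K\<close> the telescoping sum starts at a step of value 1 and ends at
    one of value 0.\<close>
  obtain m :: nat where m: "\<bar>a\<bar> / h + 5 \<le> real m" using real_arch_simple by blast
  define n where "n = 2 * m"
  define p where "p = (\<lambda>k j. spline_bump h (real j - real m) (real j - real m + 1) k)"
  \<comment> \<open>5 = 4 + 1: a bump whose left end is at least \<open>5 * h\<close> away from
    every point of \<open>K\<close> vanishes within distance \<open>h\<close> of \<open>K\<close>,
    so discarding it leaves the sum there unchanged.\<close>
  define J where "J = {j. j < n \<and> (\<exists>x\<in>K. \<bar>x / h - (real j - real m)\<bar> < 5)}"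
  have zero: "p 3 j s = 0" if "\<not> (0 < s / h - (real j - real m) \<and> s / h - (real j - real m) < 4)" for j s
  proof (cases "s / h - (real j - real m) \<le> 0")
    case True
    then show ?thesis by (simp add: p_def spline_bump_def spline_step_values)
  next
    case False
    then have "s / h - (real j - real m) \<ge> 4" using that by linarith
    then show ?thesis by (simp add: p_def spline_bump_def spline_step_values)
  qed
  show thesis
  proof (rule that[OF h])
    show "finite J" by (rule finite_subset[of _ "{..<n}"]) (auto simp: J_def)
    show "C2_compact (p 3 j) (p 2 j) (p 1 j)" for j
      unfolding p_def by (rule C2_compact_spline_bump[OF h])
    show "\<exists>w\<in>K. \<forall>s. p 3 j s \<noteq> 0 \<longrightarrow> \<bar>s - w\<bar> \<le> r w" if "j \<in> J" for j
    proof -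
      obtain x where x: "x \<in> K" "\<bar>x / h - (real j - real m)\<bar> < 5" using \<open>j \<in> J\<close> by (auto simp: J_def)
      obtain w where w: "w \<in> K" "ball x \<epsilon> \<subseteq> ball w (r w)" using \<epsilon>(2)[OF x(1)] by auto
      have "\<bar>s - w\<bar> \<le> r w" if "p 3 j s \<noteq> 0" for s
      proof -
        have "0 < s / h - (real j - real m)" "s / h - (real j - real m) < 4" using zero that by blast+
        then have "\<bar>s / h - x / h\<bar> < 9" using x(2) by linarith
        then have "\<bar>s - x\<bar> < \<epsilon>" using h by (simp add: h_def field_simps abs_divide flip: diff_divide_distrib)
        then have "s \<in> ball x \<epsilon>" by (simp add: dist_real_def abs_minus_commute)
        then have "s \<in> ball w (r w)" using w by blast
        then show ?thesis by (simp add: dist_real_def abs_minus_commute)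
      qed
      then show ?thesis using w by blast
    qed
    show "(\<Sum>j\<in>J. p 3 j s) = 1" if x: "x \<in> K" "\<bar>s - x\<bar> < h" for s x
    proof -
      have sx: "\<bar>s / h - x / h\<bar> < 1" using x(2) h by (simp add: abs_divide field_simps flip: diff_divide_distrib)
      have xa: "\<bar>x / h\<bar> \<le> \<bar>a\<bar> / h"
        using a[OF x(1)] h by (simp add: abs_divide divide_right_mono)
      have "(\<Sum>j\<in>J. p 3 j s) = (\<Sum>j<n. p 3 j s)"
      proof (rule sum.mono_neutral_left)
        show "\<forall>j\<in>{..<n} - J. p 3 j s = 0"
        proof
          fix j assume "j \<in> {..<n} - J"
          then have "\<not> \<bar>x / h - (real j - real m)\<bar> < 5" using x(1) by (auto simp: J_def)
          then show "p 3 j s = 0" using sx by (intro zero) linarith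
        qed
      qed (auto simp: J_def)
      also have "\<dots> = (\<Sum>j<n. complex_of_real (spline_step 3 (s / h + m - real j)) - complex_of_real (spline_step 3 (s / h + m - real (Suc j))))"
        by (rule sum.cong) (simp_all add: p_def spline_bump_def algebra_simps)
      also have "\<dots> = complex_of_real (spline_step 3 (s / h + m - real 0)) - complex_of_real (spline_step 3 (s / h + m - real n))"
        by (rule sum_lessThan_telescope')
      also have "\<dots> = 1"
      proof -
        have "real n = 2 * real m" by (simp add: n_def)
        then have "s / h + m - real 0 \<ge> 3" "s / h + m - real n \<le> 0" using sx xa m of_nat_0 by linarith+
        then show ?thesis by (simp add: spline_step_values)
      qed
      finally show ?thesis .
    qed
  qed
qed

context bounded_semigroup
begin

abbreviation axis_spectrum :: "real set" where
  "axis_spectrum \<equiv> {t. \<i> * complex_of_real t \<in> spectrum D A}"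

lemma closed_axis_spectrum: "closed axis_spectrum"
proof -
  have "open (- axis_spectrum)"
    unfolding open_contains_ball
  proof
    fix t assume "t \<in> - axis_spectrum"
    then have "\<i> * complex_of_real t \<notin> spectrum D A" by simp
    then obtain d where d: "d > 0" "\<And>w. cmod (w - \<i> * complex_of_real t) < d \<Longrightarrow> w \<notin> spectrum D A"
      using resolvent_set_open by blast
    have "cmod (\<i> * complex_of_real s - \<i> * complex_of_real t) = \<bar>s - t\<bar>" for s
      by (simp add: norm_mult flip: right_diff_distrib of_real_diff)
    then have "ball t d \<subseteq> - axis_spectrum" using d(2) by (auto simp: dist_real_def abs_minus_commute)
    then show "\<exists>e>0. ball t e \<subseteq> - axis_spectrum" using d(1) by blast
  qed
  then show ?thesis by (simp add: closed_def)
qed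

text \<open>On the part of \<open>[-a, a]\<close> at distance at least \<open>h\<close> from the
  spectrum the resolvent is locally bounded by \<open>resolvent_bound_near\<close>, and compactness
  makes the bound global. For |s| > a the assumed decay applies; the constants convert |s| into 1 +
  |s|.\<close>

lemma resolvent_decay:
  assumes a: "0 < a" and th: "0 < \<theta>"
    and decay: "\<And>t. a \<le> \<bar>t\<bar> \<Longrightarrow> \<bar>t\<bar> powr \<theta> * onorm (res (\<i> * complex_of_real t)) \<le> C1" and h: "0 < h"
  obtains Q where "0 \<le> Q" "\<And>s. s \<notin> axis_spectrum \<Longrightarrow> \<forall>x\<in>axis_spectrum. h \<le> \<bar>s - x\<bar> \<Longrightarrow>
      onorm (res (\<i> * complex_of_real s)) \<le> Q * (1 + \<bar>s\<bar>) powr (- \<theta>)"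
proof -
  define f where "f t = onorm (res (\<i> * complex_of_real t))" for t
  define Z where "Z = {-a..a} \<inter> (\<Inter>x\<in>axis_spectrum. {s. h \<le> \<bar>s - x\<bar>})"
  have Zn: "\<i> * complex_of_real s \<notin> spectrum D A" if "s \<in> Z" for s
  proof
    assume "\<i> * complex_of_real s \<in> spectrum D A"
    then have "h \<le> \<bar>s - s\<bar>" using that unfolding Z_def by blast
    then show False using h by simp
  qed
  have f0: "0 \<le> f s" if "s \<in> Z" for s
    unfolding f_def by (rule onorm_pos_le[OF resolvent_facts(4)[OF Zn[OF that]]])
  have "closed (\<Inter>x\<in>axis_spectrum. {s. h \<le> \<bar>s - x\<bar>})"
    by (intro closed_INT ballI closed_Collect_le continuous_intros)
  then have cZ: "compact Z" unfolding Z_def by (rule compact_Int_closed[OF compact_Icc])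
  \<comment> \<open>Chosen so that \<open>d s * f s \<le> 1 / 2\<close>, with 1 added to cover
    \<open>f s = 0\<close>.\<close>
  define d where "d s = 1 / (2 * (f s + 1))" for s
  have near: "f t \<le> 2 * f s" if s: "s \<in> Z" and t: "t \<in> Z" and st: "\<bar>t - s\<bar> < d s" for s t
    unfolding f_def
  proof (rule resolvent_bound_near[OF Zn[OF s] Zn[OF t]])
    have "cmod (\<i> * complex_of_real t - \<i> * complex_of_real s) = \<bar>t - s\<bar>"
      by (simp add: norm_mult flip: right_diff_distrib of_real_diff)
    then have "cmod (\<i> * complex_of_real t - \<i> * complex_of_real s) * f s \<le> d s * f s"
      using st f0[OF s] by (simp add: mult_right_mono)
    also have "\<dots> \<le> 1 / 2" using f0[OF s] by (simp add: d_def field_simps)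
    finally show "cmod (\<i> * complex_of_real t - \<i> * complex_of_real s) * onorm (res (\<i> * complex_of_real s)) \<le> 1 / 2"
      by (simp add: f_def)
  qed
  have "Z \<subseteq> (\<Union>s\<in>Z. ball s (d s))"
  proof
    fix s assume "s \<in> Z"
    moreover have "0 < d s" using f0[OF \<open>s \<in> Z\<close>] by (simp add: d_def)
    ultimately show "s \<in> (\<Union>s\<in>Z. ball s (d s))" by (intro UN_I[of s]) auto
  qed
  then obtain Z' where Z': "Z' \<subseteq> Z" "finite Z'" "Z \<subseteq> (\<Union>s\<in>Z'. ball s (d s))"
    using compactE_image[OF cZ, of Z "\<lambda>s. ball s (d s)"] by (metis open_ball)
  define C2 where "C2 = (\<Sum>s\<in>Z'. 2 * f s)"
  have C2: "f t \<le> C2" if t: "t \<in> Z" for t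
  proof -
    obtain s where s: "s \<in> Z'" "t \<in> ball s (d s)" using Z'(3) t by blast
    have "f t \<le> 2 * f s" by (rule near) (use s Z'(1) t in \<open>auto simp: dist_real_def abs_minus_commute\<close>)
    also have "\<dots> \<le> C2" unfolding C2_def using s Z' f0 by (intro member_le_sum) auto
    finally show ?thesis .
  qed
  have C20: "0 \<le> C2" unfolding C2_def using Z' f0 by (intro sum_nonneg) auto
  define Q where "Q = C2 * (1 + a) powr \<theta> + \<bar>C1\<bar> * (1 + 1 / a) powr \<theta>"
  show thesis
  proof (rule that)
    show "0 \<le> Q" unfolding Q_def using C20 by simp
    fix s assume s: "s \<notin> axis_spectrum" and far: "\<forall>x\<in>axis_spectrum. h \<le> \<bar>s - x\<bar>"
    have pos: "0 < (1 + \<bar>s\<bar>) powr \<theta>" by simp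
    have "f s * (1 + \<bar>s\<bar>) powr \<theta> \<le> Q"
    proof (cases "\<bar>s\<bar> \<le> a")
      case True
      then have "s \<in> Z" using far by (auto simp: Z_def)
      have "f s * (1 + \<bar>s\<bar>) powr \<theta> \<le> C2 * (1 + a) powr \<theta>"
        using C2[OF \<open>s \<in> Z\<close>] C20 True th by (intro mult_mono powr_mono2) auto
      then show ?thesis by (simp add: Q_def add_increasing2)
    next
      case False
      have fs: "0 \<le> f s" unfolding f_def by (rule onorm_pos_le[OF resolvent_facts(4)]) (use s in simp)
      have "1 \<le> \<bar>s\<bar> / a" using False a by simp
      then have "1 + \<bar>s\<bar> \<le> (1 + 1 / a) * \<bar>s\<bar>" by (simp add: algebra_simps)
      then have "(1 + \<bar>s\<bar>) powr \<theta> \<le> ((1 + 1 / a) * \<bar>s\<bar>) powr \<theta>" using th by (intro powr_mono2) auto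
      also have "\<dots> = (1 + 1 / a) powr \<theta> * \<bar>s\<bar> powr \<theta>" by (rule powr_mult)
      finally have "f s * (1 + \<bar>s\<bar>) powr \<theta> \<le> f s * ((1 + 1 / a) powr \<theta> * \<bar>s\<bar> powr \<theta>)" using fs by (rule mult_left_mono)
      also have "\<dots> = (\<bar>s\<bar> powr \<theta> * f s) * (1 + 1 / a) powr \<theta>" by simp
      also have "\<dots> \<le> \<bar>C1\<bar> * (1 + 1 / a) powr \<theta>"
        using decay[of s] False unfolding f_def by (intro mult_right_mono) auto
      finally show ?thesis using C20 by (simp add: Q_def add_increasing)
    qed
    then show "onorm (res (\<i> * complex_of_real s)) \<le> Q * (1 + \<bar>s\<bar>) powr (- \<theta>)"
      using pos by (simp add: f_def powr_minus field_simps)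
  qed
qed

lemma uniformly_continuous_S: "uniformly_continuous_on {0..} (\<lambda>t. S t x)"
proof (rule uniformly_continuous_on_nonnegI)
  fix e :: real assume e: "0 < e"
  have "((\<lambda>h. S h x) \<longlongrightarrow> S 0 x) (at 0)"
    using S_continuous[of x] unfolding continuous_on_eq_continuous_at[OF open_UNIV] isCont_def by blast
  then have "\<forall>\<^sub>F h in at 0. dist (S h x) (S 0 x) < e / M" using e M_ge1 by (intro tendstoD) auto
  then obtain d where d: "0 < d" "\<And>h. h \<noteq> 0 \<Longrightarrow> \<bar>h\<bar> < d \<Longrightarrow> norm (S h x - x) < e / M"
    unfolding eventually_at by (auto simp: dist_norm)
  show "\<exists>d>0. \<forall>t\<ge>0. \<forall>h>0. h < d \<longrightarrow> dist (S (t + h) x) (S t x) < e"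
  proof (intro exI[of _ d] conjI allI impI d(1))
    fix t h :: real assume t: "0 \<le> t" and h: "0 < h" "h < d"
    have "S (t + h) x - S t x = S t (S h x - x)" using t h T_add[of t h x] by (simp add: T_linear)
    then have "norm (S (t + h) x - S t x) \<le> M * norm (S h x - x)" using S_bound by metis
    also have "\<dots> < M * (e / M)" using d(2)[of h] h M_ge1 by (intro mult_strict_left_mono) auto
    finally show "dist (S (t + h) x) (S t x) < e" using M_ge1 by (simp add: dist_norm)
  qed
qed

end

section \<open>Existence, uniqueness, boundedness and uniform continuity of mild solutions\<close>

theorem corollary5p6:
  fixes D :: "'a::complex_banach set"
    and A :: "'a \<Rightarrow> 'a"
    and T :: "real \<Rightarrow> 'a \<Rightarrow> 'a"
    and K :: "real set"
    and a \<theta> :: real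
    and \<phi> :: "real \<Rightarrow> 'a"
  assumes "C0_semigroup T"
    and "is_generator D A T"
    and "bdd_above ((\<lambda>t. onorm (T t)) ` {0<..})"
    and "K = {t. \<i> * complex_of_real t \<in> spectrum D A}"
    and "0 < a"
    and "K \<subseteq> {-a<..<a}"
    and "1 / 2 < \<theta>"
    and "bdd_above ((\<lambda>t. \<bar>t\<bar> powr \<theta> * onorm (resolvent D A (\<i> * complex_of_real t))) ` (UNIV - {-a<..<a}))"
    and "\<phi> \<in> L_infinity"
    and "(\<lambda>w. \<i> * complex_of_real w) ` beurling_spectrum \<phi> \<inter> spectrum D A = {}"
  shows "(\<forall>x. \<exists>u. mild_solution D A \<phi> u \<and> u 0 = x \<and>
              (\<forall>v. mild_solution D A \<phi> v \<and> v 0 = x \<longrightarrow> (\<forall>t\<ge>0. v t = u t))) \<and>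
         (\<forall>u. mild_solution D A \<phi> u \<longrightarrow> u \<in> BUC)"
proof -
  obtain M0 where M0: "\<And>t. 0 < t \<Longrightarrow> onorm (T t) \<le> M0"
    using assms(3) unfolding bdd_above_def by auto
  \<comment> \<open>The maximum with 1 covers \<open>T 0\<close>, which the supremum over t > 0 does
    not see.\<close>
  define M where "M = max 1 M0"
  interpret bounded_semigroup T D A M
  proof
    show "norm (T t x) \<le> M * norm x" if "0 \<le> t" for t x
    proof (cases "t = 0")
      case True
      then have "T t x = x" using assms(1) by (simp add: C0_semigroup_def)
      moreover have "1 * norm x \<le> M * norm x" by (intro mult_right_mono) (auto simp: M_def)
      ultimately show ?thesis by simp
    next
      case False
      then have "bounded_linear (T t)" using assms(1) that by (simp add: C0_semigroup_def bounded_clinear_def)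
      then have "norm (T t x) \<le> onorm (T t) * norm x" by (rule onorm)
      also have "\<dots> \<le> M * norm x" using M0[of t] False that by (intro mult_right_mono) (auto simp: M_def)
      finally show ?thesis .
    qed
  qed (use assms in \<open>auto simp: M_def\<close>)
  have K: "K = axis_spectrum" by (rule assms(4))
  have compact_K: "compact K"
  proof -
    have "bounded K" using assms(6) bounded_subset[OF bounded_closed_interval[of "-a" a], of K] by fastforce
    then show ?thesis using closed_axis_spectrum K by (simp add: compact_eq_bounded_closed)
  qed
  obtain \<phi>' C where \<phi>': "simple_limit lborel \<phi>'" "\<And>t. norm (\<phi>' t) \<le> C" "AE t in lebesgue. \<phi> t = \<phi>' t"
    using L_infinity_representative[OF assms(9)] by metis
  \<comment> \<open>Packing the conclusion of \<open>convolution_vanishes_near\<close> into a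
    predicate allows a radius \<open>r w\<close> to be chosen for all \<open>w\<close> in
    \<open>K\<close> at once, uniformly in the functional.\<close>
  define separates where "separates w r \<longleftrightarrow> (\<forall>l c p p' p'' t. functional_bound l c \<longrightarrow> C2_compact p p' p'' \<longrightarrow>
      (\<forall>s. p s \<noteq> 0 \<longrightarrow> \<bar>s - w\<bar> \<le> r) \<longrightarrow> (LBINT s. inv_ft p s * l (\<phi>' (t - s))) = 0)" for w r
  have "\<exists>r>0. separates w r" if w: "w \<in> K" for w
  proof -
    have "w \<notin> beurling_spectrum \<phi>" using assms(10) w K by blast
    then obtain f where f: "integrable lborel f" "ft f w \<noteq> 0"
      and zero: "\<And>l c t. functional_bound l c \<Longrightarrow> (LBINT s. f s * l (\<phi>' (t - s))) = 0"
      using beurling_separating_function[OF \<phi>'] by metis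
    obtain r where r: "r > 0" and van: "\<And>\<phi> C p p' p'' t. \<phi> \<in> borel_measurable borel \<Longrightarrow> (\<And>t. cmod (\<phi> t) \<le> C) \<Longrightarrow>
       (\<And>t. (LBINT s. f s * \<phi> (t - s)) = 0) \<Longrightarrow> C2_compact p p' p'' \<Longrightarrow>
       (\<And>s. p s \<noteq> 0 \<Longrightarrow> \<bar>s - w\<bar> \<le> r) \<Longrightarrow> (LBINT s. inv_ft p s * \<phi> (t - s)) = 0"
      by (rule convolution_vanishes_near[OF f], rule that) blast+
    have "(LBINT s. inv_ft p s * l (\<phi>' (t - s))) = 0"
      if l: "functional_bound l c" and p: "C2_compact p p' p''" "\<And>s. p s \<noteq> 0 \<Longrightarrow> \<bar>s - w\<bar> \<le> r" for l c p p' p'' t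
    proof (rule van[of "\<lambda>s. l (\<phi>' s)" "\<bar>c\<bar> * C", OF _ _ zero[OF l] p])
      show "(\<lambda>s. l (\<phi>' s)) \<in> borel_measurable borel"
        using simple_limit_imp_borel_measurable[OF simple_limit_bounded_linear[OF functional_bound_linear(1)[OF l] \<phi>'(1)]] by simp
      show "cmod (l (\<phi>' s)) \<le> \<bar>c\<bar> * C" for s
      proof -
        have "cmod (l (\<phi>' s)) \<le> c * norm (\<phi>' s)" by (rule functional_bound_linear(3)[OF l])
        also have "\<dots> \<le> \<bar>c\<bar> * C" using \<phi>'(2) by (intro mult_mono) auto
        finally show ?thesis .
      qed
    qed
    then have "separates w r" unfolding separates_def by blast
    then show ?thesis using r by blast
  qed
  then obtain r where r: "\<And>w. w \<in> K \<Longrightarrow> 0 < r w" and sep: "\<And>w. w \<in> K \<Longrightarrow> separates w (r w)"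
    by metis
  have van: "(LBINT s. inv_ft p s * l (\<phi>' (t - s))) = 0"
    if "w \<in> K" "functional_bound l c" "C2_compact p p' p''" "\<forall>s. p s \<noteq> 0 \<longrightarrow> \<bar>s - w\<bar> \<le> r w" for w l c p p' p'' t
    using sep[OF that(1)] that(2-4) unfolding separates_def by blast
  obtain h J and p p' p'' :: "nat \<Rightarrow> real \<Rightarrow> complex" where h: "0 < h" and J: "finite J"
    and p: "\<And>j. j \<in> J \<Longrightarrow> C2_compact (p j) (p' j) (p'' j)"
    and psupp: "\<And>j. j \<in> J \<Longrightarrow> \<exists>w\<in>K. \<forall>s. p j s \<noteq> 0 \<longrightarrow> \<bar>s - w\<bar> \<le> r w"
    and psum: "\<And>s x. x \<in> K \<Longrightarrow> \<bar>s - x\<bar> < h \<Longrightarrow> (\<Sum>j\<in>J. p j s) = 1"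
    by (rule subordinate_partition[OF compact_K r]) (assumption, rule that)
  define B B' B'' where "B s = (\<Sum>j\<in>J. p j s)" and "B' s = (\<Sum>j\<in>J. p' j s)" and "B'' s = (\<Sum>j\<in>J. p'' j s)" for s
  have B: "C2_compact B B' B''" unfolding B_def[abs_def] B'_def[abs_def] B''_def[abs_def]
    using J p by (rule C2_compact_sum)
  obtain L where L: "\<And>s. \<bar>s\<bar> > L \<Longrightarrow> B s = 0 \<and> B' s = 0 \<and> B'' s = 0"
    using B by (auto simp: C2_compact_def)
  obtain C1 where C1: "\<And>t. a \<le> \<bar>t\<bar> \<Longrightarrow> \<bar>t\<bar> powr \<theta> * onorm (resolvent D A (\<i> * complex_of_real t)) \<le> C1"
  proof -
    obtain C1 where C1: "\<forall>y\<in>(\<lambda>t. \<bar>t\<bar> powr \<theta> * onorm (resolvent D A (\<i> * complex_of_real t))) ` (UNIV - {-a<..<a}). y \<le> C1"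
      using assms(8) unfolding bdd_above_def by blast
    have "\<bar>t\<bar> powr \<theta> * onorm (resolvent D A (\<i> * complex_of_real t)) \<le> C1" if "a \<le> \<bar>t\<bar>" for t
    proof -
      have "t \<in> UNIV - {-a<..<a}" using that by auto
      then show ?thesis using C1 by blast
    qed
    then show ?thesis by (rule that)
  qed
  have th: "0 < \<theta>" using assms(7) by simp
  obtain Q0 where Q0: "0 \<le> Q0" and decay: "\<And>s. s \<notin> axis_spectrum \<Longrightarrow> \<forall>x\<in>axis_spectrum. h \<le> \<bar>s - x\<bar> \<Longrightarrow>
      onorm (res (\<i> * complex_of_real s)) \<le> Q0 * (1 + \<bar>s\<bar>) powr (- \<theta>)"
    by (rule resolvent_decay[OF assms(5) th C1 h]) (assumption, rule that)
  \<comment> \<open>This gives \<open>e0 * Q0 \<le> 1 / 2\<close>, the smallness asked for by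
    \<open>lap_bound_resolvent\<close>; the 1 in the denominator covers \<open>Q0 = 0\<close>. The
    factor 2 in that lemma explains the \<open>2 * Q0\<close> in the interpretation below.\<close>
  define e0 where "e0 = 1 / (2 * Q0 + 1)"
  have e0: "0 < e0" using Q0 by (simp add: e0_def)
  have le1: "(1 + \<bar>s\<bar>) powr (- \<theta>) \<le> 1" for s :: real
    using powr_mono2'[of "- \<theta>" 1 "1 + \<bar>s\<bar>"] th by simp
  interpret spectral_cutoff T D A M B B' B'' "\<lambda>s. 2 * Q0 * (1 + \<bar>s\<bar>) powr (- \<theta>)" L e0 "2 * Q0"
  proof
    show "C2_compact B B' B''" by (rule B)
    show "B s = 0 \<and> B' s = 0 \<and> B'' s = 0" if "L < \<bar>s\<bar>" for s using L that .
    show "0 \<le> 2 * Q0 * (1 + \<bar>s\<bar>) powr (- \<theta>)" for s using Q0 by simp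
    show "2 * Q0 * (1 + \<bar>s\<bar>) powr (- \<theta>) \<le> 2 * Q0" for s
      using mult_left_mono[OF le1, of "2 * Q0"] Q0 by simp
    \<comment> \<open>The cube stems from the second derivative of the resolvent, and it is
      integrable because 3 \<theta> > 1.\<close>
    have "(2 * Q0 * (1 + \<bar>s\<bar>) powr (- \<theta>)) ^ 3 = (2 * Q0) ^ 3 * (1 + \<bar>s\<bar>) powr (- (3 * \<theta>))" for s :: real
      by (simp add: power_mult_distrib powr_power mult.commute)
    then show "integrable lborel (\<lambda>s. (2 * Q0 * (1 + \<bar>s\<bar>) powr (- \<theta>)) ^ 3)"
      using assms(7) by (simp only:) (intro integrable_mult_right integrable_one_plus_abs_powr, simp)
    fix e s x assume e: "0 < e" "e \<le> e0" and Z: "\<not> (B s = 1 \<and> B' s = 0 \<and> B'' s = 0)"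
    \<comment> \<open>Points within \<open>h\<close> of the spectrum lie in a ball on which
      \<open>B\<close> is 1, so they satisfy the condition excluded by \<open>Z\<close>.\<close>
    have far: "h \<le> \<bar>s - x\<bar>" if "x \<in> axis_spectrum" for x
    proof (rule ccontr)
      assume "\<not> h \<le> \<bar>s - x\<bar>"
      then have sx: "s \<in> ball x h" by (simp add: dist_real_def abs_minus_commute)
      have one: "B s = 1" if "s \<in> ball x h" for s
        unfolding B_def by (rule psum[of x]) (use \<open>x \<in> axis_spectrum\<close> K that in \<open>auto simp: dist_real_def abs_minus_commute\<close>)
      show False using Z one[OF sx] C2_compact_locally_one[OF B open_ball sx one] by blast
    qed
    have s: "s \<notin> axis_spectrum" using far[of s] h by auto
    define N where "N = Q0 * (1 + \<bar>s\<bar>) powr (- \<theta>)"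
    have N: "0 \<le> N" "N \<le> Q0" using mult_left_mono[OF le1 Q0, of s] Q0 by (auto simp: N_def)
    have "Complex e s - \<i> * complex_of_real s = complex_of_real e" by (simp add: complex_eq_iff)
    then have "cmod (Complex e s - \<i> * complex_of_real s) * N = e * N" using e by simp
    also have "\<dots> \<le> e0 * Q0" using e N by (intro mult_mono) auto
    also have "\<dots> \<le> 1 / 2" using Q0 by (simp add: e0_def field_simps)
    finally have d: "cmod (Complex e s - \<i> * complex_of_real s) * N \<le> 1 / 2" .
    have "norm (lap (Complex e s) x) \<le> 2 * N * norm x"
      by (rule lap_bound_resolvent[OF _ _ _ d]) (use e s decay[OF s ballI[OF far]] in \<open>auto simp: N_def\<close>)
    then show "norm (lap (Complex e s) x) \<le> 2 * Q0 * (1 + \<bar>s\<bar>) powr (- \<theta>) * norm x" by (simp add: N_def)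
  qed
  interpret cutoff_forcing T D A M B B' B'' "\<lambda>s. 2 * Q0 * (1 + \<bar>s\<bar>) powr (- \<theta>)" L e0 "2 * Q0" \<phi>' C
  proof
    show "simple_limit lborel \<phi>'" "norm (\<phi>' t) \<le> C" for t by (rule \<phi>')+
    fix l c t assume l: "functional_bound (l :: 'a \<Rightarrow> complex) c"
    have m: "(\<lambda>s. l (\<phi>' (t - s))) \<in> borel_measurable borel"
    proof -
      have "simple_limit borel (\<lambda>s. \<phi>' (t - s))"
        by (rule simple_limit_measurable_compose[OF _ \<phi>'(1)]) measurable
      then show ?thesis
        by (rule simple_limit_imp_borel_measurable[OF simple_limit_bounded_linear[OF functional_bound_linear(1)[OF l]]])
    qed
    have lb: "cmod (l (\<phi>' (t - s))) \<le> \<bar>c\<bar> * C" for s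
    proof -
      have "cmod (l (\<phi>' (t - s))) \<le> c * norm (\<phi>' (t - s))" by (rule functional_bound_linear(3)[OF l])
      also have "\<dots> \<le> \<bar>c\<bar> * C" using \<phi>'(2) by (intro mult_mono) auto
      finally show ?thesis .
    qed
    have \<psi>_eq: "inv_ft B s = (\<Sum>j\<in>J. inv_ft (p j) s)" for s
      unfolding B_def[abs_def] by (rule inv_ft_sum) (rule C2_compact_integrable(1)[OF p])
    have int: "integrable lborel (\<lambda>s. inv_ft (p j) s * l (\<phi>' (t - s)))" if "j \<in> J" for j
      by (rule integrable_mult_bounded(1)[OF inv_ft_integrable[OF p[OF that]] m lb])
    have "(LBINT s. inv_ft B s * l (\<phi>' (t - s))) = (\<Sum>j\<in>J. LBINT s. inv_ft (p j) s * l (\<phi>' (t - s)))"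
      unfolding \<psi>_eq sum_distrib_right using int by (rule Bochner_Integration.integral_sum)
    also have "\<dots> = 0"
    proof (intro sum.neutral ballI)
      fix j assume j: "j \<in> J"
      then obtain w where "w \<in> K" "\<forall>s. p j s \<noteq> 0 \<longrightarrow> \<bar>s - w\<bar> \<le> r w" using psupp by blast
      then show "(LBINT s. inv_ft (p j) s * l (\<phi>' (t - s))) = 0" by (intro van[OF _ l p[OF j]])
    qed
    finally show "(LBINT s. \<psi> s * l (\<phi>' (t - s))) = 0"
      unfolding \<psi>_def .
  qed
  have mild: "mild_solution D A \<phi> (\<lambda>t. S t x + duhamel t)" for x
    by (rule mild_solution_duhamel[OF e0 \<phi>'(3)])
  have init: "S 0 x + duhamel 0 = x" for x by (simp add: duhamel_0)
  show ?thesis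
  proof (intro conjI allI impI)
    fix x
    show "\<exists>u. mild_solution D A \<phi> u \<and> u 0 = x \<and> (\<forall>v. mild_solution D A \<phi> v \<and> v 0 = x \<longrightarrow> (\<forall>t\<ge>0. v t = u t))"
    proof (intro exI[of _ "\<lambda>t. S t x + duhamel t"] conjI allI impI)
      show "mild_solution D A \<phi> (\<lambda>t. S t x + duhamel t)" by (rule mild)
      show "S 0 x + duhamel 0 = x" by (rule init)
      fix v t assume v: "mild_solution D A \<phi> v \<and> v 0 = x" and t: "0 \<le> (t::real)"
      show "v t = S t x + duhamel t"
        using mild_solution_unique[OF conjunct1[OF v] mild[of x] _ t] v init by simp
    qed
  next
    fix u assume u: "mild_solution D A \<phi> u"
    \<comment> \<open>Uniqueness turns the bounds for the constructed solution into bounds for every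
      mild solution.\<close>
    have eq: "u t = S t (u 0) + duhamel t" if "0 \<le> t" for t
      using mild_solution_unique[OF u mild[of "u 0"] _ that] init by simp
    have "norm (u t) \<le> M * norm (u 0) + conv_bound * (1 + M)" if "t \<in> {0..}" for t
    proof -
      have t: "0 \<le> t" using that by simp
      show ?thesis unfolding eq[OF t] by (intro norm_triangle_le add_mono S_bound duhamel_bound[OF e0 t])
    qed
    then have "bounded (u ` {0..})" unfolding bounded_iff by blast
    moreover have "uniformly_continuous_on {0..} u"
    proof -
      define w where "w t = S t (u 0) + duhamel t" for t
      have "uniformly_continuous_on {0..} w" unfolding w_def
        by (intro uniformly_continuous_on_add uniformly_continuous_S duhamel_uniformly_continuous[OF e0])
      moreover have "u t = w t" if "0 \<le> t" for t unfolding w_def using that by (rule eq)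
      ultimately show ?thesis unfolding uniformly_continuous_on_def by simp
    qed
    ultimately show "u \<in> BUC" by (simp add: BUC_def)
  qed
qed

end
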